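(* Let $(s_1,s_2)\in\mathbb{R}^2$ and $-1\le\alpha<0$. Then there does not exist $T>0$ such that the Cauchy problem $$u_t=u_{xxx}-\mathscr{H}D_x^{\alpha}u_{yy}+uu_x,\qquad u(0)=\phi,$$ has a unique solution $u$ on $[0,T]$ for every $\phi\in H^{s_1,s_2}(\mathbb{R}^2)$ and such that the flow $S_t:\phi\mapsto u(t)$, $t\in[0,T]$, is of class $C^2$ at $0$ from $H^{s_1,s_2}(\mathbb{R}^2)$ to $H^{s_1,s_2}(\mathbb{R}^2)$.
   Context: Functions are of $(x,y)\in\mathbb{R}^2$ with dual Fourier variables $(\xi,\eta)$. $\mathscr{H}$ is the Hilbert transform in $x$ (Fourier symbol $-i\,\mathrm{sgn}(\xi)$), $D_x^\alpha$ has Fourier symbol $|\xi|^\alpha$, $\langle a\rangle=(1+a^2)^{1/2}$. $H^{s_1,s_2}(\mathbb{R}^2)$ is the space of tempered distributions with $\|f\|_{H^{s_1,s_2}}^2=\int(\langle\xi\rangle^{2s_1}+\langle\eta\rangle^{2s_2})|\widehat f(\xi,\eta)|^2d\xi d\eta<\infty$. Solutions satisfy the Duhamel formula $u(t)=W_\alpha(t)\phi+\int_0^tW_\alpha(t-t')(uu_x)(t')\,dt'$, where $W_\alpha(t)$ is the Fourier multiplier $e^{-it(\xi^3+\mathrm{sgn}(\xi)|\xi|^\alpha\eta^2)}$. *)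

theory Defs
  imports "HOL-Analysis.Analysis"
begin

section \<open>Schwartz functions on the plane\<close>

definition dx :: "(real \<times> real \<Rightarrow> complex) \<Rightarrow> real \<times> real \<Rightarrow> complex" where
  "dx f = (\<lambda>(x, y). vector_derivative (\<lambda>s. f (s, y)) (at x))"

definition dy :: "(real \<times> real \<Rightarrow> complex) \<Rightarrow> real \<times> real \<Rightarrow> complex" where
  "dy f = (\<lambda>(x, y). vector_derivative (\<lambda>s. f (x, s)) (at y))"

definition dxy :: "nat \<Rightarrow> nat \<Rightarrow> (real \<times> real \<Rightarrow> complex) \<Rightarrow> real \<times> real \<Rightarrow> complex" where
  "dxy c d f = (dy ^^ d) ((dx ^^ c) f)"

text \<open>If all the functions \<open>dxy c d f\<close> are (Frechet) differentiable, then \<open>f\<close> is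
  infinitely differentiable and its partial derivatives commute.\<close>

definition schwartz :: "(real \<times> real \<Rightarrow> complex) set" where
  "schwartz = {f. (\<forall>c d p. dxy c d f differentiable (at p)) \<and>
     (\<forall>a b c d. bounded (range (\<lambda>(x, y). of_real (x ^ a * y ^ b) * dxy c d f (x, y))))}"

definition schwartz_seminorm ::
    "nat \<Rightarrow> nat \<Rightarrow> nat \<Rightarrow> nat \<Rightarrow> (real \<times> real \<Rightarrow> complex) \<Rightarrow> real" where
  "schwartz_seminorm a b c d f =
     (SUP (x, y). cmod (of_real (x ^ a * y ^ b) * dxy c d f (x, y)))"

definition schwartz_norm :: "nat \<Rightarrow> (real \<times> real \<Rightarrow> complex) \<Rightarrow> real" where
  "schwartz_norm n f = (\<Sum>a\<le>n. \<Sum>b\<le>n. \<Sum>c\<le>n. \<Sum>d\<le>n. schwartz_seminorm a b c d f)"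

lemma slice_x_differentiable:
  fixes f :: "real \<times> real \<Rightarrow> complex"
  assumes "f differentiable (at (x, y))"
  shows "(\<lambda>s. f (s, y)) differentiable (at x)"
proof -
  have "(\<lambda>s::real. (s, y)) differentiable (at x)"
    by (rule differentiableI, rule has_derivative_Pair[OF has_derivative_ident has_derivative_const])
  from differentiable_chain_at[OF this assms] show ?thesis by (simp add: o_def)
qed

lemma slice_y_differentiable:
  fixes f :: "real \<times> real \<Rightarrow> complex"
  assumes "f differentiable (at (x, y))"
  shows "(\<lambda>s. f (x, s)) differentiable (at y)"
proof -
  have "(\<lambda>s::real. (x, s)) differentiable (at y)"
    by (rule differentiableI, rule has_derivative_Pair[OF has_derivative_const has_derivative_ident])
  from differentiable_chain_at[OF this assms] show ?thesis by (simp add: o_def)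
qed

lemma dx_lincomb:
  assumes "\<And>p. f differentiable (at p)" "\<And>p. g differentiable (at p)"
  shows "dx (\<lambda>p. k * f p + g p) = (\<lambda>p. k * dx f p + dx g p)"
proof (rule ext, clarify)
  fix x y :: real
  have "((\<lambda>s. f (s, y)) has_vector_derivative dx f (x, y)) (at x)"
       "((\<lambda>s. g (s, y)) has_vector_derivative dx g (x, y)) (at x)"
    unfolding dx_def using slice_x_differentiable[OF assms(1)] slice_x_differentiable[OF assms(2)]
    by (auto simp: vector_derivative_works)
  then have "((\<lambda>s. k * f (s, y) + g (s, y)) has_vector_derivative k * dx f (x, y) + dx g (x, y)) (at x)"
    by (intro has_vector_derivative_add has_vector_derivative_mult_right)
  then show "dx (\<lambda>p. k * f p + g p) (x, y) = k * dx f (x, y) + dx g (x, y)"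
    by (simp add: dx_def vector_derivative_at)
qed

lemma dy_lincomb:
  assumes "\<And>p. f differentiable (at p)" "\<And>p. g differentiable (at p)"
  shows "dy (\<lambda>p. k * f p + g p) = (\<lambda>p. k * dy f p + dy g p)"
proof (rule ext, clarify)
  fix x y :: real
  have "((\<lambda>s. f (x, s)) has_vector_derivative dy f (x, y)) (at y)"
       "((\<lambda>s. g (x, s)) has_vector_derivative dy g (x, y)) (at y)"
    unfolding dy_def using slice_y_differentiable[OF assms(1)] slice_y_differentiable[OF assms(2)]
    by (auto simp: vector_derivative_works)
  then have "((\<lambda>s. k * f (x, s) + g (x, s)) has_vector_derivative k * dy f (x, y) + dy g (x, y)) (at y)"
    by (intro has_vector_derivative_add has_vector_derivative_mult_right)
  then show "dy (\<lambda>p. k * f p + g p) (x, y) = k * dy f (x, y) + dy g (x, y)"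
    by (simp add: dy_def vector_derivative_at)
qed

lemma dxy_lincomb:
  assumes "\<And>c d p. dxy c d f differentiable (at p)" "\<And>c d p. dxy c d g differentiable (at p)"
  shows "dxy c d (\<lambda>p. k * f p + g p) = (\<lambda>p. k * dxy c d f p + dxy c d g p)"
proof (induction d)
  case 0
  show ?case
  proof (induction c)
    case (Suc c)
    have "dxy (Suc c) 0 h = dx (dxy c 0 h)" for h by (simp add: dxy_def)
    then show ?case using Suc by (simp add: dx_lincomb assms)
  qed (simp add: dxy_def)
next
  case (Suc d)
  have "dxy c (Suc d) h = dy (dxy c d h)" for h by (simp add: dxy_def)
  then show ?case using Suc by (simp add: dy_lincomb assms)
qed

lemma schwartz_lincomb:
  assumes "f \<in> schwartz" "g \<in> schwartz"
  shows "(\<lambda>p. k * f p + g p) \<in> schwartz"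
proof -
  have df: "dxy c d f differentiable (at p)" and dg: "dxy c d g differentiable (at p)" for c d p
    using assms unfolding schwartz_def by blast+
  have eq: "dxy c d (\<lambda>p. k * f p + g p) = (\<lambda>p. k * dxy c d f p + dxy c d g p)" for c d
    by (rule dxy_lincomb[OF df dg])
  have diff: "dxy c d (\<lambda>p. k * f p + g p) differentiable (at p)" for c d p
    unfolding eq by (intro differentiable_add differentiable_mult differentiable_const df dg)
  have bd: "bounded (range (\<lambda>(x, y). of_real (x ^ a * y ^ b) * dxy c d (\<lambda>p. k * f p + g p) (x, y)))"
    for a b c d
  proof -
    let ?u = "\<lambda>f. \<lambda>(x, y). of_real (x ^ a * y ^ b) * dxy c d f (x, y)"
    have "bounded (range (?u f))" "bounded (range (?u g))"
      using assms by (auto simp: schwartz_def)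
    then obtain F G where F: "\<And>p. cmod (?u f p) \<le> F" and G: "\<And>p. cmod (?u g p) \<le> G"
      unfolding bounded_iff by blast
    have "cmod (k * ?u f p + ?u g p) \<le> cmod k * F + G" for p
      by (rule norm_triangle_le) (use F[of p] G[of p] in \<open>auto simp only: norm_mult intro!: add_mono mult_left_mono norm_ge_zero\<close>)
    moreover have "?u (\<lambda>p. k * f p + g p) = (\<lambda>p. k * ?u f p + ?u g p)"
      unfolding eq by (auto simp: fun_eq_iff algebra_simps)
    ultimately have "bounded (range (?u (\<lambda>p. k * f p + g p)))"
      unfolding bounded_iff by auto
    then show ?thesis .
  qed
  show ?thesis unfolding schwartz_def using diff bd by blast
qed

lemma zero_schwartz: "(\<lambda>_. 0) \<in> schwartz"
proof -
  have x: "(dx ^^ c) (\<lambda>_. 0) = (\<lambda>_. 0)" for c by (induction c) (auto simp: dx_def)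
  have y: "(dy ^^ c) (\<lambda>_. 0) = (\<lambda>_. 0)" for c by (induction c) (auto simp: dy_def)
  have "dxy c d (\<lambda>_. 0) = (\<lambda>_. 0)" for c d by (simp add: dxy_def x y)
  then show ?thesis by (auto simp: schwartz_def bounded_def)
qed

lemma schwartz_add: "f \<in> schwartz \<Longrightarrow> g \<in> schwartz \<Longrightarrow> (\<lambda>p. f p + g p) \<in> schwartz"
  using schwartz_lincomb[of f g 1] by simp

lemma schwartz_scale: "f \<in> schwartz \<Longrightarrow> (\<lambda>p. k * f p) \<in> schwartz"
  using schwartz_lincomb[OF _ zero_schwartz, of f k] by simp

lemma dxy_dx: "dxy c d (dx f) = dxy (Suc c) d f"
  by (simp add: dxy_def funpow_swap1)

lemma schwartz_dx: "f \<in> schwartz \<Longrightarrow> dx f \<in> schwartz"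
  by (simp add: schwartz_def dxy_dx)

lemma schwartz_seminorm_nonneg:
  assumes "f \<in> schwartz" shows "0 \<le> schwartz_seminorm a b c d f"
proof -
  have "bounded (range (\<lambda>(x, y). of_real (x ^ a * y ^ b) * dxy c d f (x, y)))"
    using assms by (auto simp: schwartz_def)
  then have "bdd_above (range (\<lambda>(x, y). cmod (of_real (x ^ a * y ^ b) * dxy c d f (x, y))))"
    by (auto simp: bounded_iff bdd_above_def)
  from cSUP_upper[OF UNIV_I this, of "(0, 0)"]
  have "cmod (of_real (0 ^ a * 0 ^ b) * dxy c d f (0, 0)) \<le> schwartz_seminorm a b c d f"
    unfolding schwartz_seminorm_def by simp
  then show ?thesis using norm_ge_zero order_trans by blast
qed

lemma schwartz_norm_nonneg: "f \<in> schwartz \<Longrightarrow> 0 \<le> schwartz_norm n f"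
  unfolding schwartz_norm_def by (intro sum_nonneg schwartz_seminorm_nonneg)

lemma schwartz_norm_mono:
  assumes "f \<in> schwartz" "m \<le> n"
  shows "schwartz_norm m f \<le> schwartz_norm n f"
proof -
  let ?S = "\<lambda>(a, b, c, d). schwartz_seminorm a b c d f"
  have eq: "schwartz_norm k f = sum ?S ({..k} \<times> {..k} \<times> {..k} \<times> {..k})" for k
    unfolding schwartz_norm_def by (simp add: sum.cartesian_product split_def)
  show ?thesis unfolding eq using assms
    by (intro sum_mono2) (auto intro: schwartz_seminorm_nonneg)
qed

lemma schwartz_norm_dx:
  assumes "f \<in> schwartz"
  shows "schwartz_norm n (dx f) \<le> schwartz_norm (Suc n) f"
proof -
  let ?S = "\<lambda>(a, b, c, d). schwartz_seminorm a b c d f"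
  let ?h = "\<lambda>(a::nat, b::nat, c::nat, d::nat). (a, b, Suc c, d)"
  have "schwartz_norm n (dx f) = sum (?S \<circ> ?h) ({..n} \<times> {..n} \<times> {..n} \<times> {..n})"
    unfolding schwartz_norm_def
    by (simp add: sum.cartesian_product split_def schwartz_seminorm_def dxy_dx)
  also have "\<dots> = sum ?S (?h ` ({..n} \<times> {..n} \<times> {..n} \<times> {..n}))"
    by (rule sum.reindex[symmetric]) (auto simp: inj_on_def)
  also have "\<dots> \<le> sum ?S ({..Suc n} \<times> {..Suc n} \<times> {..Suc n} \<times> {..Suc n})"
    using assms by (intro sum_mono2) (auto intro: schwartz_seminorm_nonneg)
  also have "\<dots> = schwartz_norm (Suc n) f"
    unfolding schwartz_norm_def by (simp add: sum.cartesian_product split_def del: sum.atMost_Suc)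
  finally show ?thesis .
qed


section \<open>Tempered distributions\<close>

text \<open>A tempered distribution is a functional on Schwartz functions; the value \<open>0\<close> at all
  other functions makes equality of functionals the equality of distributions.\<close>

definition tempered :: "((real \<times> real \<Rightarrow> complex) \<Rightarrow> complex) \<Rightarrow> bool" where
  "tempered L \<longleftrightarrow>
     (\<forall>f\<in>schwartz. \<forall>g\<in>schwartz. L (\<lambda>p. f p + g p) = L f + L g) \<and>
     (\<forall>f\<in>schwartz. \<forall>k. L (\<lambda>p. k * f p) = k * L f) \<and>
     (\<exists>n C. \<forall>f\<in>schwartz. cmod (L f) \<le> C * schwartz_norm n f) \<and>
     (\<forall>f. f \<notin> schwartz \<longrightarrow> L f = 0)"

typedef tdist = "{L. tempered L}"
  morphisms pairing Abs_tdist
  by (rule exI[of _ "\<lambda>_. 0"]) (auto simp: tempered_def intro!: exI[of _ 0])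

setup_lifting type_definition_tdist

instantiation tdist :: real_vector
begin

lift_definition zero_tdist :: tdist is "\<lambda>_. 0"
  by (auto simp: tempered_def intro!: exI[of _ 0])

lift_definition plus_tdist :: "tdist \<Rightarrow> tdist \<Rightarrow> tdist" is "\<lambda>L M f. L f + M f"
proof -
  fix L M assume L: "tempered L" and M: "tempered M"
  obtain n C m D where b: "\<forall>f\<in>schwartz. cmod (L f) \<le> C * schwartz_norm n f"
      "\<forall>f\<in>schwartz. cmod (M f) \<le> D * schwartz_norm m f"
    using L M unfolding tempered_def by blast
  have "cmod (L f + M f) \<le> (\<bar>C\<bar> + \<bar>D\<bar>) * schwartz_norm (max n m) f" if f: "f \<in> schwartz" for f
  proof -
    have "C * schwartz_norm n f \<le> \<bar>C\<bar> * schwartz_norm (max n m) f"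
         "D * schwartz_norm m f \<le> \<bar>D\<bar> * schwartz_norm (max n m) f"
      using f by (auto intro!: mult_mono schwartz_norm_mono schwartz_norm_nonneg)
    then show ?thesis using b f norm_triangle_ineq[of "L f" "M f"] by (fastforce simp: algebra_simps)
  qed
  then have "\<exists>n C. \<forall>f\<in>schwartz. cmod (L f + M f) \<le> C * schwartz_norm n f" by blast
  then show "tempered (\<lambda>f. L f + M f)"
    using L M by (simp add: tempered_def algebra_simps)
qed

lift_definition scaleR_tdist :: "real \<Rightarrow> tdist \<Rightarrow> tdist" is "\<lambda>r L f. r *\<^sub>R L f"
proof -
  fix r L assume L: "tempered L"
  obtain n C where b: "\<forall>f\<in>schwartz. cmod (L f) \<le> C * schwartz_norm n f"
    using L unfolding tempered_def by blast
  have "cmod (r *\<^sub>R L f) \<le> (\<bar>r\<bar> * C) * schwartz_norm n f" if f: "f \<in> schwartz" for f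
    using b f by (simp add: mult_left_mono mult.assoc)
  then have "\<exists>n C. \<forall>f\<in>schwartz. cmod (r *\<^sub>R L f) \<le> C * schwartz_norm n f" by blast
  then show "tempered (\<lambda>f. r *\<^sub>R L f)"
    using L by (simp add: tempered_def scaleR_right_distrib)
qed

definition uminus_tdist :: "tdist \<Rightarrow> tdist" where "uminus_tdist L = (- 1) *\<^sub>R L"

definition minus_tdist :: "tdist \<Rightarrow> tdist \<Rightarrow> tdist" where "minus_tdist L M = L + (- 1) *\<^sub>R M"

instance
proof
  fix a b c :: tdist and r s :: real
  show "a + b + c = a + (b + c)" by transfer (simp add: algebra_simps)
  show "a + b = b + a" by transfer (simp add: algebra_simps)
  show "0 + a = a" by transfer simp
  show "- a + a = 0" unfolding uminus_tdist_def by transfer simp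
  show "a - b = a + - b" by (simp add: uminus_tdist_def minus_tdist_def)
  show "r *\<^sub>R (a + b) = r *\<^sub>R a + r *\<^sub>R b" by transfer (simp add: algebra_simps)
  show "(r + s) *\<^sub>R a = r *\<^sub>R a + s *\<^sub>R a" by transfer (simp add: algebra_simps)
  show "r *\<^sub>R s *\<^sub>R a = (r * s) *\<^sub>R a" by transfer simp
  show "1 *\<^sub>R a = a" by transfer simp
qed

end

lift_definition dist_dx :: "tdist \<Rightarrow> tdist" is
  "\<lambda>L f. if f \<in> schwartz then - L (dx f) else 0"
proof -
  fix L assume L: "tempered L"
  obtain n C where b: "\<forall>f\<in>schwartz. cmod (L f) \<le> C * schwartz_norm n f"
    using L unfolding tempered_def by blast
  have "cmod (L (dx f)) \<le> \<bar>C\<bar> * schwartz_norm (Suc n) f" if f: "f \<in> schwartz" for f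
  proof -
    have "cmod (L (dx f)) \<le> C * schwartz_norm n (dx f)" using b f schwartz_dx by blast
    also have "\<dots> \<le> \<bar>C\<bar> * schwartz_norm (Suc n) f"
      using f by (intro mult_mono schwartz_norm_dx schwartz_norm_nonneg schwartz_dx) auto
    finally show ?thesis .
  qed
  then have cont: "\<exists>n C. \<forall>f\<in>schwartz. cmod (if f \<in> schwartz then - L (dx f) else 0) \<le> C * schwartz_norm n f"
    by auto
  have diff: "f differentiable (at p)" if "f \<in> schwartz" for f p
  proof -
    have "dxy 0 0 f differentiable (at p)" using that unfolding schwartz_def by blast
    then show ?thesis by (simp add: dxy_def)
  qed
  have add: "dx (\<lambda>p. f p + g p) = (\<lambda>p. dx f p + dx g p)" if "f \<in> schwartz" "g \<in> schwartz" for f g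
    using dx_lincomb[of f g 1] diff that by simp
  have scale: "dx (\<lambda>p. k * f p) = (\<lambda>p. k * dx f p)" if "f \<in> schwartz" for f k
  proof -
    have "dx (\<lambda>_. 0) = (\<lambda>_. 0)" by (auto simp: dx_def)
    then show ?thesis using dx_lincomb[of f "\<lambda>_. 0" k] diff that by simp
  qed
  show "tempered (\<lambda>f. if f \<in> schwartz then - L (dx f) else 0)"
    using L cont by (simp add: tempered_def add scale schwartz_add schwartz_scale schwartz_dx)
qed


section \<open>Fourier transform\<close>

definition fourier :: "(real \<times> real \<Rightarrow> complex) \<Rightarrow> real \<times> real \<Rightarrow> complex" where
  "fourier f \<zeta> = (\<integral>p. cis (- (p \<bullet> \<zeta>)) * f p \<partial>lborel)"

text \<open>\<open>has_fourier L g\<close>: the Fourier transform of \<open>L\<close>, i.e. the functional \<open>\<psi> \<mapsto> L (fourier \<psi>)\<close>,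
  is the function \<open>g\<close>.\<close>

definition has_fourier :: "tdist \<Rightarrow> (real \<times> real \<Rightarrow> complex) \<Rightarrow> bool" where
  "has_fourier L g \<longleftrightarrow> g \<in> borel_measurable borel \<and>
     (\<forall>\<psi>\<in>schwartz. integrable lborel (\<lambda>\<zeta>. g \<zeta> * \<psi> \<zeta>) \<and>
        pairing L (fourier \<psi>) = (\<integral>\<zeta>. g \<zeta> * \<psi> \<zeta> \<partial>lborel))"

text \<open>\<open>hat L\<close> is a representative of the Fourier transform of \<open>L\<close>, which is determined only
  up to null sets; \<open>of_hat g\<close> is the distribution with Fourier transform \<open>g\<close>. Both are meaningful
  only if \<open>has_fourier L g\<close> for some \<open>g\<close> (respectively some \<open>L\<close>).\<close>

definition hat :: "tdist \<Rightarrow> real \<times> real \<Rightarrow> complex" where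
  "hat L = (SOME g. has_fourier L g)"

definition of_hat :: "(real \<times> real \<Rightarrow> complex) \<Rightarrow> tdist" where
  "of_hat g = (THE L. has_fourier L g)"

definition fourier_multiplier :: "(real \<times> real \<Rightarrow> complex) \<Rightarrow> tdist \<Rightarrow> tdist" where
  "fourier_multiplier m L = of_hat (\<lambda>\<zeta>. m \<zeta> * hat L \<zeta>)"


section \<open>Anisotropic Sobolev spaces\<close>

definition japanese :: "real \<Rightarrow> real" where
  "japanese a = sqrt (1 + a\<^sup>2)"

definition sobolev_weight :: "real \<Rightarrow> real \<Rightarrow> real \<times> real \<Rightarrow> real" where
  "sobolev_weight s1 s2 = (\<lambda>(\<xi>, \<eta>). japanese \<xi> powr (2 * s1) + japanese \<eta> powr (2 * s2))"

definition sobolev :: "real \<Rightarrow> real \<Rightarrow> tdist set" where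
  "sobolev s1 s2 = {f. (\<exists>g. has_fourier f g) \<and>
     integrable lborel (\<lambda>\<zeta>. sobolev_weight s1 s2 \<zeta> * (cmod (hat f \<zeta>))\<^sup>2)}"

definition sobolev_norm :: "real \<Rightarrow> real \<Rightarrow> tdist \<Rightarrow> real" where
  "sobolev_norm s1 s2 f =
     sqrt (\<integral>\<zeta>. sobolev_weight s1 s2 \<zeta> * (cmod (hat f \<zeta>))\<^sup>2 \<partial>lborel)"


section \<open>The Cauchy problem\<close>

definition W :: "real \<Rightarrow> real \<Rightarrow> tdist \<Rightarrow> tdist" where
  "W \<alpha> t = fourier_multiplier
     (\<lambda>(\<xi>, \<eta>). cis (- (t * (\<xi> ^ 3 + sgn \<xi> * \<bar>\<xi>\<bar> powr \<alpha> * \<eta>\<^sup>2))))"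

text \<open>For negative \<open>s1\<close> and \<open>s2\<close> the elements of \<open>sobolev s1 s2\<close> need not be functions. The product
  of two distributions is defined by the convolution of their Fourier transforms whenever this
  converges absolutely almost everywhere to the Fourier transform of a tempered distribution. For
  square integrable functions this is always the case and gives the pointwise product. The factor
  \<open>(2 * pi)\<^sup>2\<close> comes from the normalization of \<open>fourier\<close>.\<close>

definition hat_convolution :: "tdist \<Rightarrow> tdist \<Rightarrow> real \<times> real \<Rightarrow> complex" where
  "hat_convolution f g \<zeta> =
     (\<integral>\<zeta>'. hat f (\<zeta> - \<zeta>') * hat g \<zeta>' \<partial>lborel) / of_real ((2 * pi)\<^sup>2)"

definition product_exists :: "tdist \<Rightarrow> tdist \<Rightarrow> bool" where
  "product_exists f g \<longleftrightarrow> (\<exists>h. has_fourier f h) \<and> (\<exists>h. has_fourier g h) \<and>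
     (AE \<zeta> in lborel. integrable lborel (\<lambda>\<zeta>'. hat f (\<zeta> - \<zeta>') * hat g \<zeta>')) \<and>
     (\<exists>p. has_fourier p (hat_convolution f g))"

definition product :: "tdist \<Rightarrow> tdist \<Rightarrow> tdist" where
  "product f g = of_hat (hat_convolution f g)"

text \<open>\<open>u u\<^sub>x = (u\<^sup>2)\<^sub>x / 2\<close>\<close>

definition uux :: "tdist \<Rightarrow> tdist" where
  "uux u = (1 / 2) *\<^sub>R dist_dx (product u u)"

text \<open>Solutions on \<open>[0, T]\<close> of
  \<open>u\<^sub>t = u\<^sub>x\<^sub>x\<^sub>x - H D\<^sub>x\<^sup>\<alpha> u\<^sub>y\<^sub>y + u u\<^sub>x\<close>, \<open>u(0) = \<phi>\<close> are continuous curves in \<open>sobolev s1 s2\<close> that satisfy the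
  Duhamel formula; the time integral of distributions is taken in the weak sense, after pairing
  with a Schwartz function. The integrand matters only for almost every time, hence so does the
  existence of \<open>u\<^sup>2\<close>; as it is arbitrary on the exceptional null set, the integral is with
  respect to the complete measure \<open>lebesgue\<close>.\<close>

definition is_solution ::
    "real \<Rightarrow> real \<Rightarrow> real \<Rightarrow> real \<Rightarrow> tdist \<Rightarrow> (real \<Rightarrow> tdist) \<Rightarrow> bool" where
  "is_solution \<alpha> s1 s2 T \<phi> u \<longleftrightarrow>
     u 0 = \<phi> \<and>
     (\<forall>t\<in>{0..T}. u t \<in> sobolev s1 s2) \<and>
     (\<forall>t\<in>{0..T}. ((\<lambda>t'. sobolev_norm s1 s2 (u t' - u t)) \<longlongrightarrow> 0) (at t within {0..T})) \<and>
     (AE t in lebesgue. t \<in> {0..T} \<longrightarrow> product_exists (u t) (u t)) \<and>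
     (\<forall>t\<in>{0..T}. \<forall>\<psi>\<in>schwartz.
        set_integrable lebesgue {0..t} (\<lambda>t'. pairing (W \<alpha> (t - t') (uux (u t'))) \<psi>) \<and>
        pairing (u t) \<psi> = pairing (W \<alpha> t \<phi>) \<psi>
          + (LINT t':{0..t}|lebesgue. pairing (W \<alpha> (t - t') (uux (u t'))) \<psi>))"


section \<open>Maps of class \<open>C\<^sup>2\<close> on a normed space given by a carrier and a norm\<close>

text \<open>The spaces \<open>sobolev s1 s2\<close> depend on real parameters, so they cannot be types of class
  \<open>real_normed_vector\<close>. The following are the usual Frechet notions for self-maps of a subspace \<open>V\<close>
  with norm \<open>N\<close>, over the real scalars.\<close>

definition linear_bounded_on :: "'a::real_vector set \<Rightarrow> ('a \<Rightarrow> real) \<Rightarrow> ('a \<Rightarrow> 'a) \<Rightarrow> bool" where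
  "linear_bounded_on V N A \<longleftrightarrow>
     (\<forall>h\<in>V. A h \<in> V) \<and>
     (\<forall>h\<in>V. \<forall>k\<in>V. A (h + k) = A h + A k) \<and>
     (\<forall>h\<in>V. \<forall>r. A (r *\<^sub>R h) = r *\<^sub>R A h) \<and>
     (\<exists>C. \<forall>h\<in>V. N (A h) \<le> C * N h)"

definition bilinear_bounded_on :: "'a::real_vector set \<Rightarrow> ('a \<Rightarrow> real) \<Rightarrow> ('a \<Rightarrow> 'a \<Rightarrow> 'a) \<Rightarrow> bool" where
  "bilinear_bounded_on V N B \<longleftrightarrow>
     (\<forall>h\<in>V. linear_bounded_on V N (B h)) \<and>
     (\<forall>k\<in>V. linear_bounded_on V N (\<lambda>h. B h k)) \<and>
     (\<exists>C. \<forall>h\<in>V. \<forall>k\<in>V. N (B h k) \<le> C * N h * N k)"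

definition has_frechet_derivative_on ::
    "'a::real_vector set \<Rightarrow> ('a \<Rightarrow> real) \<Rightarrow> ('a \<Rightarrow> 'a) \<Rightarrow> ('a \<Rightarrow> 'a) \<Rightarrow> 'a \<Rightarrow> bool" where
  "has_frechet_derivative_on V N F A x \<longleftrightarrow> linear_bounded_on V N A \<and>
     (\<forall>\<epsilon>>0. \<exists>\<delta>>0. \<forall>h\<in>V. N h < \<delta> \<longrightarrow> N (F (x + h) - F x - A h) \<le> \<epsilon> * N h)"

text \<open>\<open>D2 x h k\<close> is the derivative of \<open>D\<close> at \<open>x\<close> in direction \<open>h\<close>, applied to \<open>k\<close>; estimates
  uniform in \<open>k\<close> are estimates in operator norm.\<close>

definition C2_at :: "'a::real_vector set \<Rightarrow> ('a \<Rightarrow> real) \<Rightarrow> ('a \<Rightarrow> 'a) \<Rightarrow> 'a \<Rightarrow> bool" where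
  "C2_at V N F x0 \<longleftrightarrow> x0 \<in> V \<and> (\<exists>r>0. \<exists>D D2.
     (\<forall>x\<in>V. N (x - x0) < r \<longrightarrow>
        has_frechet_derivative_on V N F (D x) x \<and>
        bilinear_bounded_on V N (D2 x) \<and>
        (\<forall>\<epsilon>>0. \<exists>\<delta>>0. \<forall>h\<in>V. N h < \<delta> \<longrightarrow>
           (\<forall>k\<in>V. N (D (x + h) k - D x k - D2 x h k) \<le> \<epsilon> * N h * N k))) \<and>
     (\<forall>\<epsilon>>0. \<exists>\<delta>>0. \<forall>x\<in>V. N (x - x0) < \<delta> \<longrightarrow>
        (\<forall>h\<in>V. \<forall>k\<in>V. N (D2 x h k - D2 x0 h k) \<le> \<epsilon> * N h * N k)))"

end

theory Submission
  imports Defs "HOL-Probability.Probability" "HOL-Real_Asymp.Real_Asymp"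
    "HOL-Computational_Algebra.Polynomial"
begin

text \<open>
  On the Fourier side, in the variable \<open>\<zeta> = (\<xi>, \<eta>)\<close>, the interaction of two waves with frequencies \<open>p\<close> and \<open>q\<close>
  oscillates in time with the phase \<open>\<omega>(p + q) - \<omega>(p) - \<omega>(q)\<close>, where
  \<open>\<omega>(\<xi>, \<eta>) = \<xi>\<^sup>3 + sgn \<xi> \<bar>\<xi>\<bar> powr \<alpha> \<eta>\<^sup>2\<close>. For negative \<open>\<alpha>\<close> this phase stays bounded on a box \<open>D\<^sub>1\<close> of
  low and a box \<open>D\<^sub>2\<close> of high frequencies \<open>\<xi> \<approx> N\<close>, both of area about \<open>N powr (- (4 + \<alpha>) / 2)\<close>. For data \<open>\<phi>\<close>
  concentrated on \<open>D\<^sub>1\<close> and \<open>D\<^sub>2\<close> with norm about one, the second Picard iterate has norm about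
  \<open>N\<close> times the square root of the area, i.e. \<open>N powr (- \<alpha> / 4)\<close>, which is unbounded; a flow of class \<open>C\<^sup>2\<close> would
  have a bounded second derivative.

  For negative \<open>s1\<close> and \<open>s2\<close> the product is not continuous on the Sobolev space, so the Duhamel formula
  cannot be differentiated directly. But all frequencies of the data satisfy \<open>\<xi> \<ge> a\<close> for some \<open>a > 0\<close>, so on
  \<open>\<xi> < m a\<close> the Picard iteration is stationary after finitely many steps. Its limit is a solution with rapidly
  decaying Fourier transform for the data \<open>\<epsilon> \<phi>\<close> with small \<open>\<epsilon>\<close>. By uniqueness this solution is the
  flow, and its expansion in powers of \<open>\<epsilon>\<close> identifies the second derivative at \<open>0\<close>.
\<close>

section \<open>Lebesgue measure on the plane\<close>

text \<open>Members of \<open>sobolev s1 s2\<close> may be complex-valued, so data whose frequencies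
  lie in a half plane \<xi> \<ge> a are admissible. The obstacle is the derivative in the
  nonlinearity, which costs a factor \<xi>. It is regained as in the Cauchy-Kovalevskaya theorem, by
  exponential decay in \<xi> at a rate that shrinks linearly in time. The price is a smallness
  condition that depends on \<phi>. This is harmless: a second derivative along the ray through
  \<phi> only sees small multiples of \<phi>, whereas its bound is uniform in \<phi>. The expansion
  of the flow is tested with one bounded real functional that lives on the output frequencies and
  carries the conjugate phase, so that the second iterate contributes with positive real part. The
  high box and the output frequencies have comparable Sobolev weights, so s1 and s2 cancel from the
  comparison. The time T is given and may be large; it is the boxes that are shrunk, by a constant c
  depending on T, until T times the phase is at most 1.\<close>

lemma lborel_distr_reflect:
  fixes a :: "'a::euclidean_space"
  shows "distr lborel borel (\<lambda>x. a - x) = lborel"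
  using lborel_affine[of "-1" a] by (simp add: density_1)

lemma lborel_integrable_reflect:
  fixes f :: "'a::euclidean_space \<Rightarrow> 'b::{banach, second_countable_topology}"
  assumes [measurable]: "f \<in> borel_measurable borel"
  shows "integrable lborel (\<lambda>x. f (a - x)) \<longleftrightarrow> integrable lborel f"
proof -
  have "integrable (distr lborel borel (\<lambda>x. a - x)) f \<longleftrightarrow> integrable lborel (\<lambda>x. f (a - x))"
    by (rule integrable_distr_eq) auto
  then show ?thesis by (simp add: lborel_distr_reflect)
qed

lemma lborel_integral_reflect:
  fixes f :: "'a::euclidean_space \<Rightarrow> 'b::{banach, second_countable_topology}"
  assumes [measurable]: "f \<in> borel_measurable borel"
  shows "(\<integral>x. f (a - x) \<partial>lborel) = (\<integral>x. f x \<partial>lborel)"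
proof -
  have "integral\<^sup>L (distr lborel borel (\<lambda>x. a - x)) f = (\<integral>x. f (a - x) \<partial>lborel)"
    by (rule integral_distr) auto
  then show ?thesis by (simp add: lborel_distr_reflect)
qed

lemma lborel_AE_reflect:
  fixes a :: "'a::euclidean_space"
  assumes "AE x in lborel. P x"
  shows "AE x in lborel. P (a - x)"
  proof (rule AE_distrD[of "\<lambda>x. a - x" lborel borel])
  show "AE x in distr lborel borel (\<lambda>x. a - x). P x"
    unfolding lborel_distr_reflect by (rule assms)
qed auto

lemma lborel_tensor:
  fixes f g :: "real \<Rightarrow> 'b::{real_normed_field, banach, second_countable_topology}"
  assumes f: "integrable lborel f" and g: "integrable lborel g"
  shows "integrable lborel (\<lambda>(x, y). f x * g y)"
    and "(\<integral>(x, y). f x * g y \<partial>lborel) = (\<integral>x. f x \<partial>lborel) * (\<integral>y. g y \<partial>lborel)"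
proof -
  have [measurable]: "f \<in> borel_measurable borel" "g \<in> borel_measurable borel"
    using f g by auto
  have m: "(\<lambda>(x, y). f x * g y) \<in> borel_measurable (lborel \<Otimes>\<^sub>M lborel)" by measurable
  have i: "integrable (lborel \<Otimes>\<^sub>M lborel) (\<lambda>(x, y). f x * g y)"
    by (rule lborel_pair.Fubini_integrable[OF m]) (use f g in \<open>auto simp: norm_mult\<close>)
  then show "integrable lborel (\<lambda>(x, y). f x * g y)" by (simp add: lborel_prod)
  show "(\<integral>(x, y). f x * g y \<partial>lborel) = (\<integral>x. f x \<partial>lborel) * (\<integral>y. g y \<partial>lborel)"
    using lborel_pair.integral_fst[OF i] g by (simp add: lborel_prod)
qed

lemma integrable_inverse_square: "integrable lborel (\<lambda>x::real. inverse (1 + x\<^sup>2))"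
  using integrable_inverse_1_plus_square by (simp add: set_integrable_def)

lemma integrable_inverse_squares:
  "integrable lborel (\<lambda>(x::real, y::real). inverse ((1 + x\<^sup>2) * (1 + y\<^sup>2)))"
  using lborel_tensor(1)[OF integrable_inverse_square integrable_inverse_square] by simp

lemma one_plus_square_pos: "0 < 1 + x\<^sup>2" for x :: real
  using zero_le_power2[of x] by linarith


section \<open>Schwartz functions\<close>

text \<open>The weight is a product of one factor per variable, so that its inverse is integrable
  over the plane and along every horizontal and vertical line. Integration by parts in one variable
  followed by Fubini uses both.\<close>

definition decaying :: "(real \<times> real \<Rightarrow> complex) \<Rightarrow> bool" where
  "decaying f \<longleftrightarrow> continuous_on UNIV f \<and>
     (\<exists>C. \<forall>x y. cmod (f (x, y)) * ((1 + x\<^sup>2) * (1 + y\<^sup>2)) \<le> C)"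

text \<open>The explicit bound on the integral is what later makes \<open>dist_of g\<close>
  continuous with respect to a Schwartz norm.\<close>

lemma integrable_of_decay:
  assumes f: "f \<in> borel_measurable borel"
    and C: "\<And>x y. cmod (f (x, y)) * ((1 + x\<^sup>2) * (1 + y\<^sup>2)) \<le> C"
  shows "integrable lborel f"
    and "(\<integral>p. cmod (f p) \<partial>lborel) \<le> C * (\<integral>(x::real, y::real). inverse ((1 + x\<^sup>2) * (1 + y\<^sup>2)) \<partial>lborel)"
proof -
  let ?g = "\<lambda>p::real \<times> real. C * (case p of (x, y) \<Rightarrow> inverse ((1 + x\<^sup>2) * (1 + y\<^sup>2)))"
  have g: "integrable lborel ?g"
    by (intro integrable_mult_right integrable_inverse_squares)
  have le: "cmod (f p) \<le> ?g p" for p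
  proof -
    have "0 < (1 + (fst p)\<^sup>2) * (1 + (snd p)\<^sup>2)"
      by (intro mult_pos_pos one_plus_square_pos)
    with C[of "fst p" "snd p"] show ?thesis
      by (simp add: split_def divide_inverse[symmetric] pos_le_divide_eq)
  qed
  show i: "integrable lborel f"
    by (rule Bochner_Integration.integrable_bound[OF g]) (use f order_trans[OF le abs_ge_self] in \<open>auto simp del: abs_mult\<close>)
  have "(\<integral>p. cmod (f p) \<partial>lborel) \<le> (\<integral>p. ?g p \<partial>lborel)"
    by (intro integral_mono g integrable_norm i le)
  then show "(\<integral>p. cmod (f p) \<partial>lborel) \<le> C * (\<integral>(x::real, y::real). inverse ((1 + x\<^sup>2) * (1 + y\<^sup>2)) \<partial>lborel)"
    by simp
qed

lemma decaying_borel: "decaying f \<Longrightarrow> f \<in> borel_measurable borel"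
  by (auto simp: decaying_def intro: borel_measurable_continuous_onI)

lemma decaying_integrable: "decaying f \<Longrightarrow> integrable lborel f"
  using integrable_of_decay(1) decaying_borel unfolding decaying_def by blast

lemma schwartz_differentiable: "f \<in> schwartz \<Longrightarrow> dxy c d f differentiable (at p)"
  unfolding schwartz_def by blast

lemma dxy_0_0 [simp]: "dxy 0 0 f = f"
  by (simp add: dxy_def)

lemma dxy_Suc_0: "dxy (Suc c) 0 f = dx (dxy c 0 f)"
  by (simp add: dxy_def)

lemma dxy_Suc: "dxy c (Suc d) f = dy (dxy c d f)"
  by (simp add: dxy_def)

lemma schwartz_seminorm_upper:
  assumes "f \<in> schwartz"
  shows "\<bar>x\<bar> ^ a * \<bar>y\<bar> ^ b * cmod (dxy c d f (x, y)) \<le> schwartz_seminorm a b c d f"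
proof -
  have "bounded (range (\<lambda>(x, y). of_real (x ^ a * y ^ b) * dxy c d f (x, y)))"
    using assms by (auto simp: schwartz_def)
  then have "bdd_above (range (\<lambda>(x, y). cmod (of_real (x ^ a * y ^ b) * dxy c d f (x, y))))"
    by (auto simp: bounded_iff bdd_above_def)
  from cSUP_upper[OF UNIV_I this, of "(x, y)"] show ?thesis
    by (simp add: schwartz_seminorm_def norm_mult norm_power abs_mult power_abs)
qed

lemma schwartz_weighted_bound:
  assumes f: "f \<in> schwartz"
  shows "\<exists>C. \<forall>x y. cmod (of_real (x ^ a * y ^ b) * dxy c d f (x, y)) * ((1 + x\<^sup>2) * (1 + y\<^sup>2)) \<le> C"
proof (intro exI allI)
  fix x y :: real
  have sq: "x\<^sup>2 = \<bar>x\<bar>\<^sup>2" "y\<^sup>2 = \<bar>y\<bar>\<^sup>2" by simp_all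
  have "cmod (of_real (x ^ a * y ^ b) * dxy c d f (x, y)) * ((1 + x\<^sup>2) * (1 + y\<^sup>2))
    = \<bar>x\<bar> ^ a * \<bar>y\<bar> ^ b * cmod (dxy c d f (x, y)) + \<bar>x\<bar> ^ (a + 2) * \<bar>y\<bar> ^ b * cmod (dxy c d f (x, y))
    + \<bar>x\<bar> ^ a * \<bar>y\<bar> ^ (b + 2) * cmod (dxy c d f (x, y)) + \<bar>x\<bar> ^ (a + 2) * \<bar>y\<bar> ^ (b + 2) * cmod (dxy c d f (x, y))"
    by (simp only: sq norm_mult norm_of_real abs_mult power_abs power_add)
       (simp only: ring_distribs mult_1_left mult_1_right mult_ac add_ac)
  also have "\<dots> \<le> schwartz_seminorm a b c d f + schwartz_seminorm (a + 2) b c d f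
     + schwartz_seminorm a (b + 2) c d f + schwartz_seminorm (a + 2) (b + 2) c d f"
    by (intro add_mono schwartz_seminorm_upper f)
  finally show "cmod (of_real (x ^ a * y ^ b) * dxy c d f (x, y)) * ((1 + x\<^sup>2) * (1 + y\<^sup>2)) \<le>
     schwartz_seminorm a b c d f + schwartz_seminorm (a + 2) b c d f
     + schwartz_seminorm a (b + 2) c d f + schwartz_seminorm (a + 2) (b + 2) c d f" .
qed

lemma schwartz_decaying: "f \<in> schwartz \<Longrightarrow> decaying (dxy c d f)"
  using schwartz_weighted_bound[of f 0 0 c d] schwartz_differentiable[of f c d]
  by (auto simp: decaying_def intro!: differentiable_imp_continuous_on
      simp: differentiable_on_def differentiable_at_withinI)

lemma schwartz_integrable: "f \<in> schwartz \<Longrightarrow> integrable lborel f"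
  using decaying_integrable[OF schwartz_decaying[of f 0 0]] by simp

lemma schwartz_borel: "f \<in> schwartz \<Longrightarrow> f \<in> borel_measurable borel"
  using decaying_borel[OF schwartz_decaying[of f 0 0]] by simp

text \<open>Expanding the weight gives four monomials with exponents 0 or 2, hence seminorms of
  order at most 2.\<close>

lemma schwartz_decay_norm:
  assumes f: "f \<in> schwartz"
  shows "cmod (f (x, y)) * ((1 + x\<^sup>2) * (1 + y\<^sup>2)) \<le> schwartz_norm 2 f"
proof -
  let ?S = "\<lambda>(a, b, c, d). schwartz_seminorm a b c d f"
  let ?A = "{(0, 0, 0, 0), (2, 0, 0, 0), (0, 2, 0, 0), (2, 2, 0, 0)} :: (nat \<times> nat \<times> nat \<times> nat) set"
  have "cmod (f (x, y)) * ((1 + x\<^sup>2) * (1 + y\<^sup>2))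
    = \<bar>x\<bar> ^ 0 * \<bar>y\<bar> ^ 0 * cmod (dxy 0 0 f (x, y)) + \<bar>x\<bar> ^ 2 * \<bar>y\<bar> ^ 0 * cmod (dxy 0 0 f (x, y))
    + \<bar>x\<bar> ^ 0 * \<bar>y\<bar> ^ 2 * cmod (dxy 0 0 f (x, y)) + \<bar>x\<bar> ^ 2 * \<bar>y\<bar> ^ 2 * cmod (dxy 0 0 f (x, y))"
    by (simp add: algebra_simps)
  also have "\<dots> \<le> schwartz_seminorm 0 0 0 0 f + schwartz_seminorm 2 0 0 0 f
     + schwartz_seminorm 0 2 0 0 f + schwartz_seminorm 2 2 0 0 f"
    by (intro add_mono schwartz_seminorm_upper f)
  also have "\<dots> = sum ?S ?A" by simp
  also have "\<dots> \<le> sum ?S ({..2} \<times> {..2} \<times> {..2} \<times> {..2})"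
    using f by (intro sum_mono2) (auto intro: schwartz_seminorm_nonneg)
  also have "\<dots> = schwartz_norm 2 f"
    unfolding schwartz_norm_def by (simp add: sum.cartesian_product split_def)
  finally show ?thesis .
qed

lemma has_dx:
  assumes "f differentiable (at (x, y))"
  shows "((\<lambda>s. f (s, y)) has_vector_derivative dx f (x, y)) (at x)"
  unfolding dx_def using slice_x_differentiable[OF assms] by (auto simp: vector_derivative_works)

lemma has_dy:
  assumes "f differentiable (at (x, y))"
  shows "((\<lambda>s. f (x, s)) has_vector_derivative dy f (x, y)) (at y)"
  unfolding dy_def using slice_y_differentiable[OF assms] by (auto simp: vector_derivative_works)

section \<open>Multiplication by the coordinates\<close>

definition mulx :: "(real \<times> real \<Rightarrow> complex) \<Rightarrow> real \<times> real \<Rightarrow> complex" where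
  "mulx f = (\<lambda>p. of_real (fst p) * f p)"

definition muly :: "(real \<times> real \<Rightarrow> complex) \<Rightarrow> real \<times> real \<Rightarrow> complex" where
  "muly f = (\<lambda>p. of_real (snd p) * f p)"

lemma mulx_differentiable: "f differentiable (at p) \<Longrightarrow> mulx f differentiable (at p)"
  and muly_differentiable: "f differentiable (at p) \<Longrightarrow> muly f differentiable (at p)"
proof -
  have "(\<lambda>p::real\<times>real. of_real (fst p) :: complex) differentiable (at p)"
       "(\<lambda>p::real\<times>real. of_real (snd p) :: complex) differentiable (at p)"
    by (auto intro!: bounded_linear_imp_differentiable bounded_linear_compose[OF bounded_linear_of_real] bounded_linear_fst bounded_linear_snd)
  then show "f differentiable (at p) \<Longrightarrow> mulx f differentiable (at p)"
    "f differentiable (at p) \<Longrightarrow> muly f differentiable (at p)"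
    unfolding mulx_def muly_def by (auto intro: differentiable_mult)
qed

lemma dx_mulx: "(\<And>p. f differentiable (at p)) \<Longrightarrow> dx (mulx f) = (\<lambda>p. mulx (dx f) p + f p)"
  and dy_mulx: "(\<And>p. f differentiable (at p)) \<Longrightarrow> dy (mulx f) = mulx (dy f)"
  and dx_muly: "(\<And>p. f differentiable (at p)) \<Longrightarrow> dx (muly f) = muly (dx f)"
  and dy_muly: "(\<And>p. f differentiable (at p)) \<Longrightarrow> dy (muly f) = (\<lambda>p. muly (dy f) p + f p)"
proof -
  assume f: "\<And>p. f differentiable (at p)"
  have id: "((\<lambda>s. of_real s :: complex) has_vector_derivative 1) (at x)" for x :: real
    using has_vector_derivative_of_real[OF DERIV_ident] by simp
  have "((\<lambda>s. mulx f (s, y)) has_vector_derivative mulx (dx f) (x, y) + f (x, y)) (at x)"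
       "((\<lambda>s. muly f (x, s)) has_vector_derivative muly (dy f) (x, y) + f (x, y)) (at y)"
       "((\<lambda>s. mulx f (x, s)) has_vector_derivative mulx (dy f) (x, y)) (at y)"
       "((\<lambda>s. muly f (s, y)) has_vector_derivative muly (dx f) (x, y)) (at x)" for x y
    unfolding mulx_def muly_def
    using has_vector_derivative_mult[OF id has_dx[OF f, where x=x and y=y]]
          has_vector_derivative_mult[OF id has_dy[OF f, where x=x and y=y]]
          has_vector_derivative_mult_right[OF has_dx[OF f, where x=x and y=y], of "of_real y"]
          has_vector_derivative_mult_right[OF has_dy[OF f, where x=x and y=y], of "of_real x"]
    by (simp_all add: add.commute)
  note this[THEN vector_derivative_at]
  then show "dx (mulx f) = (\<lambda>p. mulx (dx f) p + f p)" "dy (mulx f) = mulx (dy f)"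
     "dx (muly f) = muly (dx f)" "dy (muly f) = (\<lambda>p. muly (dy f) p + f p)"
    by (auto simp: fun_eq_iff dx_def dy_def)
qed

text \<open>Leibniz rule: commuting c derivatives in x past the factor x leaves c times a derivative
  of order c - 1. For c = 0 the truncated \<open>c - 1\<close> has coefficient 0.\<close>

lemma dxy_mulx:
  assumes "\<And>c d p. dxy c d f differentiable (at p)"
  shows "dxy c d (mulx f) = (\<lambda>p. of_nat c * dxy (c - 1) d f p + mulx (dxy c d f) p)"
proof (induction d)
  case 0
  show ?case
  proof (induction c)
    case (Suc c)
    have "dxy (Suc c) 0 (mulx f) = (\<lambda>p. of_nat c * dx (dxy (c - 1) 0 f) p + dx (mulx (dxy c 0 f)) p)"
      unfolding dxy_Suc_0 Suc by (rule dx_lincomb) (auto intro: assms mulx_differentiable)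
    also have "\<dots> = (\<lambda>p. of_nat (Suc c) * dxy c 0 f p + mulx (dxy (Suc c) 0 f) p)"
    proof (cases c)
      case 0
      then show ?thesis using dx_mulx[OF assms[of 0 0]] by (simp add: dxy_Suc_0 add.commute)
    qed (auto simp: dx_mulx[OF assms] dxy_Suc_0[symmetric] algebra_simps)
    finally show ?case by simp
  qed simp
next
  case (Suc d)
  show ?case unfolding dxy_Suc Suc
    by (subst dy_lincomb) (auto simp: dy_mulx assms intro: assms mulx_differentiable)
qed

lemma dxy_muly:
  assumes "\<And>c d p. dxy c d f differentiable (at p)"
  shows "dxy c d (muly f) = (\<lambda>p. of_nat d * dxy c (d - 1) f p + muly (dxy c d f) p)"
proof (induction d)
  case 0
  show ?case
  proof (induction c)
    case (Suc c)
    then show ?case by (simp add: dxy_Suc_0 dx_muly assms)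
  qed simp
next
  case (Suc d)
  have "dxy c (Suc d) (muly f) = (\<lambda>p. of_nat d * dy (dxy c (d - 1) f) p + dy (muly (dxy c d f)) p)"
    unfolding dxy_Suc Suc by (rule dy_lincomb) (auto intro: assms muly_differentiable)
  also have "\<dots> = (\<lambda>p. of_nat (Suc d) * dxy c d f p + muly (dxy c (Suc d) f) p)"
    by (cases d) (auto simp: dy_muly[OF assms] dxy_Suc[symmetric] algebra_simps)
  finally show ?case by simp
qed

lemma schwartzI:
  assumes "\<And>c d p. dxy c d f differentiable (at p)"
    and "\<And>a b c d. \<exists>C. \<forall>x y. cmod (of_real (x ^ a * y ^ b) * dxy c d f (x, y)) \<le> C"
  shows "f \<in> schwartz"
  using assms by (fastforce simp: schwartz_def bounded_iff)

lemma schwartz_moment_bound: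
  assumes "f \<in> schwartz"
  shows "\<exists>C. \<forall>x y. cmod (of_real (x ^ a * y ^ b) * dxy c d f (x, y)) \<le> C"
  using schwartz_seminorm_upper[OF assms, of _ a _ b c d]
  by (auto simp: norm_mult norm_power intro!: exI[of _ "schwartz_seminorm a b c d f"])

lemma schwartz_mulx: assumes f: "f \<in> schwartz" shows "mulx f \<in> schwartz"
proof (rule schwartzI)
  note d = schwartz_differentiable[OF f]
  show "dxy c d (mulx f) differentiable (at p)" for c d p
    unfolding dxy_mulx[OF d] by (intro differentiable_add differentiable_mult differentiable_const mulx_differentiable d)
  fix a b c d
  obtain C D where C: "\<And>x y. cmod (of_real (x ^ a * y ^ b) * dxy (c - 1) d f (x, y)) \<le> C"
    and D: "\<And>x y. cmod (of_real (x ^ Suc a * y ^ b) * dxy c d f (x, y)) \<le> D"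
    using schwartz_moment_bound[OF f] by meson
  have "cmod (of_real (x ^ a * y ^ b) * dxy c d (mulx f) (x, y)) \<le> of_nat c * C + D" for x y
  proof -
    have "of_real (x ^ a * y ^ b) * dxy c d (mulx f) (x, y) =
        of_nat c * (of_real (x ^ a * y ^ b) * dxy (c - 1) d f (x, y)) + of_real (x ^ Suc a * y ^ b) * dxy c d f (x, y)"
      by (simp add: dxy_mulx[OF d]) (simp add: mulx_def algebra_simps)
    also have "cmod \<dots> \<le> cmod (of_nat c * (of_real (x ^ a * y ^ b) * dxy (c - 1) d f (x, y))) + cmod (of_real (x ^ Suc a * y ^ b) * dxy c d f (x, y))"
      by (rule norm_triangle_ineq)
    also have "\<dots> \<le> of_nat c * C + D"
      unfolding norm_mult[of "of_nat c"] norm_of_nat by (intro add_mono mult_left_mono C D) simp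
    finally show ?thesis .
  qed
  then show "\<exists>C. \<forall>x y. cmod (of_real (x ^ a * y ^ b) * dxy c d (mulx f) (x, y)) \<le> C" by blast
qed

lemma schwartz_muly: assumes f: "f \<in> schwartz" shows "muly f \<in> schwartz"
proof (rule schwartzI)
  note d = schwartz_differentiable[OF f]
  show "dxy c d (muly f) differentiable (at p)" for c d p
    unfolding dxy_muly[OF d] by (intro differentiable_add differentiable_mult differentiable_const muly_differentiable d)
  fix a b c d
  obtain C D where C: "\<And>x y. cmod (of_real (x ^ a * y ^ b) * dxy c (d - 1) f (x, y)) \<le> C"
    and D: "\<And>x y. cmod (of_real (x ^ a * y ^ Suc b) * dxy c d f (x, y)) \<le> D"
    using schwartz_moment_bound[OF f] by meson
  have "cmod (of_real (x ^ a * y ^ b) * dxy c d (muly f) (x, y)) \<le> of_nat d * C + D" for x y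
  proof -
    have "of_real (x ^ a * y ^ b) * dxy c d (muly f) (x, y) =
        of_nat d * (of_real (x ^ a * y ^ b) * dxy c (d - 1) f (x, y)) + of_real (x ^ a * y ^ Suc b) * dxy c d f (x, y)"
      by (simp add: dxy_muly[OF d]) (simp add: muly_def algebra_simps)
    also have "cmod \<dots> \<le> cmod (of_nat d * (of_real (x ^ a * y ^ b) * dxy c (d - 1) f (x, y))) + cmod (of_real (x ^ a * y ^ Suc b) * dxy c d f (x, y))"
      by (rule norm_triangle_ineq)
    also have "\<dots> \<le> of_nat d * C + D"
      unfolding norm_mult[of "of_nat d"] norm_of_nat by (intro add_mono mult_left_mono C D) simp
    finally show ?thesis .
  qed
  then show "\<exists>C. \<forall>x y. cmod (of_real (x ^ a * y ^ b) * dxy c d (muly f) (x, y)) \<le> C" by blast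
qed

section \<open>The Fourier transform on Schwartz functions\<close>

text \<open>Fundamental theorem of calculus on the whole line: the decay of \<open>F\<close> makes
  both boundary values vanish.\<close>

lemma integral_deriv_eq_0:
  fixes F F' :: "real \<Rightarrow> complex"
  assumes d: "\<And>x. (F has_vector_derivative F' x) (at x)"
    and c: "continuous_on UNIV F'" and i: "integrable lborel F'"
    and b: "\<And>x. cmod (F x) * (1 + x\<^sup>2) \<le> C"
  shows "(\<integral>x. F' x \<partial>lborel) = 0"
proof -
  have le: "cmod (F x) \<le> C / (1 + x\<^sup>2)" for x
    using b[of x] one_plus_square_pos[of x] by (simp add: pos_le_divide_eq)
  have t: "((\<lambda>x. C / (1 + x\<^sup>2)) \<longlongrightarrow> 0) at_top" "((\<lambda>x. C / (1 + x\<^sup>2)) \<longlongrightarrow> 0) at_bot" by real_asymp+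
  have top: "(F \<longlongrightarrow> 0) at_top" by (rule Lim_null_comparison[OF always_eventually t(1)]) (use le in auto)
  have bot: "(F \<longlongrightarrow> 0) at_bot" by (rule Lim_null_comparison[OF always_eventually t(2)]) (use le in auto)
  have "(LBINT x=-\<infinity>..\<infinity>. F' x) = 0 - 0"
  proof (rule interval_integral_FTC_integrable)
    show "((F \<circ> real_of_ereal) \<longlongrightarrow> 0) (at_right (-\<infinity>))" "((F \<circ> real_of_ereal) \<longlongrightarrow> 0) (at_left \<infinity>)"
      using top bot by (simp_all add: ereal_tendsto_simps)
    show "set_integrable lborel (einterval (-\<infinity>) \<infinity>) F'" using i by (simp add: set_integrable_def)
    show "isCont F' x" for x using c by (simp add: continuous_on_eq_continuous_at)
  qed (use d in auto)
  then show ?thesis by (simp add: interval_lebesgue_integral_def set_lebesgue_integral_def)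
qed

lemma decaying_slice_integrable:
  assumes "decaying f"
  shows "integrable lborel (\<lambda>x. f (x, y))" "integrable lborel (\<lambda>x. f (y, x))"
    "continuous_on UNIV (\<lambda>x. f (x, y))" "continuous_on UNIV (\<lambda>x. f (y, x))"
    "\<exists>C. \<forall>x. cmod (f (x, y)) * (1 + x\<^sup>2) \<le> C" "\<exists>C. \<forall>x. cmod (f (y, x)) * (1 + x\<^sup>2) \<le> C"
proof -
  obtain C where C: "\<And>x y. cmod (f (x, y)) * ((1 + x\<^sup>2) * (1 + y\<^sup>2)) \<le> C"
    using assms by (auto simp: decaying_def)
  have f: "continuous_on UNIV f" using assms by (simp add: decaying_def)
  show c: "continuous_on UNIV (\<lambda>x. f (x, y))" "continuous_on UNIV (\<lambda>x. f (y, x))"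
    by (rule continuous_on_compose2[OF f]; auto intro!: continuous_intros)+
  have l: "cmod (f (x, y)) * (1 + x\<^sup>2) \<le> C" "cmod (f (y, x)) * (1 + x\<^sup>2) \<le> C" for x
  proof -
    have "cmod (f (x, y)) * (1 + x\<^sup>2) * 1 \<le> cmod (f (x, y)) * (1 + x\<^sup>2) * (1 + y\<^sup>2)"
         "cmod (f (y, x)) * (1 + x\<^sup>2) * 1 \<le> cmod (f (y, x)) * (1 + x\<^sup>2) * (1 + y\<^sup>2)"
      by (intro mult_left_mono mult_nonneg_nonneg; simp)+
    with C[of x y] C[of y x] show "cmod (f (x, y)) * (1 + x\<^sup>2) \<le> C" "cmod (f (y, x)) * (1 + x\<^sup>2) \<le> C"
      by (simp_all add: mult_ac)
  qed
  then show "\<exists>C. \<forall>x. cmod (f (x, y)) * (1 + x\<^sup>2) \<le> C" "\<exists>C. \<forall>x. cmod (f (y, x)) * (1 + x\<^sup>2) \<le> C" by blast+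
  have i: "integrable lborel (\<lambda>x. C * inverse (1 + x\<^sup>2))"
    by (intro integrable_mult_right integrable_inverse_square)
  have le: "cmod (f (x, y)) \<le> C * inverse (1 + x\<^sup>2)" "cmod (f (y, x)) \<le> C * inverse (1 + x\<^sup>2)" for x
    using l[of x] one_plus_square_pos[of x] by (simp_all add: pos_le_divide_eq divide_inverse[symmetric])
  have "integrable lborel g" if g: "continuous_on UNIV g" "\<And>x. cmod (g x) \<le> C * inverse (1 + x\<^sup>2)" for g :: "real \<Rightarrow> complex"
  proof (rule Bochner_Integration.integrable_bound[OF i])
    show "g \<in> borel_measurable lborel" using g(1) by (simp add: borel_measurable_continuous_onI)
    show "AE x in lborel. norm (g x) \<le> norm (C * inverse (1 + x\<^sup>2))"
      unfolding real_norm_def by (intro always_eventually allI order_trans[OF g(2) abs_ge_self])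
  qed
  from this[OF c(1) le(1)] this[OF c(2) le(2)]
  show "integrable lborel (\<lambda>x. f (x, y))" "integrable lborel (\<lambda>x. f (y, x))" .
qed

section \<open>Differentiation and multiplication exchanged by the Fourier transform\<close>

lemma cis_mult_decaying:
  assumes "decaying f" shows "decaying (\<lambda>p. cis (- (p \<bullet> \<zeta>)) * f p)"
  using assms unfolding decaying_def by (auto simp: norm_mult intro!: continuous_intros)

lemma has_vector_derivative_cis: "((\<lambda>s. cis (- (s * a + b))) has_vector_derivative - \<i> * of_real a * cis (- (x * a + b))) (at x)"
proof -
  have "((\<lambda>z. exp (- \<i> * (z * of_real a + of_real b))) has_field_derivative
      - \<i> * of_real a * exp (- \<i> * (of_real x * of_real a + of_real b))) (at (of_real x))"
    by (auto intro!: derivative_eq_intros)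
  from has_vector_derivative_real_field[OF this] show ?thesis
    by (simp add: cis_conv_exp algebra_simps)
qed

text \<open>The function \<open>?k\<close> is the x-derivative of the decaying function
  \<open>?g\<close>, so its integral over each horizontal line is 0, and by Fubini so is its
  integral over the plane.\<close>

lemma fourier_dx:
  assumes d: "\<And>p. f differentiable (at p)" and f: "decaying f" and f': "decaying (dx f)"
  shows "fourier (dx f) \<zeta> = \<i> * of_real (fst \<zeta>) * fourier f \<zeta>"
proof -
  let ?g = "\<lambda>p. cis (- (p \<bullet> \<zeta>)) * f p" and ?h = "\<lambda>p. cis (- (p \<bullet> \<zeta>)) * dx f p"
  let ?k = "\<lambda>p. ?h p - \<i> * of_real (fst \<zeta>) * ?g p"
  have g: "decaying ?g" and h: "decaying ?h" by (intro cis_mult_decaying f f')+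
  have i: "integrable lborel ?g" "integrable lborel ?h" using g h by (auto intro: decaying_integrable)
  have k: "integrable lborel ?k" by (intro Bochner_Integration.integrable_diff integrable_mult_right i)
  have z: "(\<integral>x. ?k (x, y) \<partial>lborel) = 0" for y
  proof -
    obtain C where C: "\<And>x. cmod (?g (x, y)) * (1 + x\<^sup>2) \<le> C"
      using decaying_slice_integrable(5)[OF g] by blast
    show ?thesis
    proof (rule integral_deriv_eq_0[OF _ _ _ C])
      show "((\<lambda>x. ?g (x, y)) has_vector_derivative ?k (x, y)) (at x)" for x
        using has_vector_derivative_mult[OF has_vector_derivative_cis[of "fst \<zeta>" "y * snd \<zeta>" x] has_dx[OF d, where x=x and y=y]]
        by (simp add: inner_prod_def algebra_simps)
      show "continuous_on UNIV (\<lambda>x. ?k (x, y))" "integrable lborel (\<lambda>x. ?k (x, y))"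
        by (intro continuous_intros Bochner_Integration.integrable_diff integrable_mult_right
             decaying_slice_integrable(1)[OF g] decaying_slice_integrable(3)[OF g]
             decaying_slice_integrable(1)[OF h] decaying_slice_integrable(3)[OF h])+
    qed
  qed
  have "0 = (\<integral>p. ?k p \<partial>lborel)"
    using lborel_pair.integral_snd[of "\<lambda>x y. ?k (x, y)"] k by (simp only: z) (simp add: lborel_prod split_beta')
  also have "\<dots> = fourier (dx f) \<zeta> - \<i> * of_real (fst \<zeta>) * fourier f \<zeta>"
    using i by (simp add: fourier_def)
  finally show ?thesis by simp
qed

lemma fourier_dy:
  assumes d: "\<And>p. f differentiable (at p)" and f: "decaying f" and f': "decaying (dy f)"
  shows "fourier (dy f) \<zeta> = \<i> * of_real (snd \<zeta>) * fourier f \<zeta>"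
proof -
  let ?g = "\<lambda>p. cis (- (p \<bullet> \<zeta>)) * f p" and ?h = "\<lambda>p. cis (- (p \<bullet> \<zeta>)) * dy f p"
  let ?k = "\<lambda>p. ?h p - \<i> * of_real (snd \<zeta>) * ?g p"
  have g: "decaying ?g" and h: "decaying ?h" by (intro cis_mult_decaying f f')+
  have i: "integrable lborel ?g" "integrable lborel ?h" using g h by (auto intro: decaying_integrable)
  have k: "integrable lborel ?k" by (intro Bochner_Integration.integrable_diff integrable_mult_right i)
  have z: "(\<integral>y. ?k (x, y) \<partial>lborel) = 0" for x
  proof -
    obtain C where C: "\<And>y. cmod (?g (x, y)) * (1 + y\<^sup>2) \<le> C"
      using decaying_slice_integrable(6)[OF g] by blast
    show ?thesis
    proof (rule integral_deriv_eq_0[OF _ _ _ C])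
      show "((\<lambda>y. ?g (x, y)) has_vector_derivative ?k (x, y)) (at y)" for y
        using has_vector_derivative_mult[OF has_vector_derivative_cis[of "snd \<zeta>" "x * fst \<zeta>" y] has_dy[OF d, where x=x and y=y]]
        by (simp add: inner_prod_def algebra_simps)
      show "continuous_on UNIV (\<lambda>y. ?k (x, y))" "integrable lborel (\<lambda>y. ?k (x, y))"
        by (intro continuous_intros Bochner_Integration.integrable_diff integrable_mult_right
             decaying_slice_integrable(2)[OF g] decaying_slice_integrable(4)[OF g]
             decaying_slice_integrable(2)[OF h] decaying_slice_integrable(4)[OF h])+
    qed
  qed
  have "0 = (\<integral>p. ?k p \<partial>lborel)"
    using lborel_pair.integral_fst[of "\<lambda>x y. ?k (x, y)"] k by (simp only: z) (simp add: lborel_prod split_beta')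
  also have "\<dots> = fourier (dy f) \<zeta> - \<i> * of_real (snd \<zeta>) * fourier f \<zeta>"
    using i by (simp add: fourier_def)
  finally show ?thesis by simp
qed

lemma fourier_dxy:
  assumes f: "f \<in> schwartz"
  shows "fourier (dxy a b f) \<zeta> = (\<i> * of_real (fst \<zeta>)) ^ a * (\<i> * of_real (snd \<zeta>)) ^ b * fourier f \<zeta>"
proof (induction b)
  case 0
  show ?case
  proof (induction a)
    case (Suc a)
    show ?case unfolding dxy_Suc_0
      by (subst fourier_dx)
         (use Suc schwartz_differentiable[OF f] schwartz_decaying[OF f] in \<open>auto simp: dxy_Suc_0[symmetric]\<close>)
  qed simp
next
  case (Suc b)
  show ?case unfolding dxy_Suc
    by (subst fourier_dy)
       (use Suc schwartz_differentiable[OF f] schwartz_decaying[OF f] in \<open>auto simp: dxy_Suc[symmetric]\<close>)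
qed

lemma cmod_fourier_le: "cmod (fourier f \<zeta>) \<le> (\<integral>p. cmod (f p) \<partial>lborel)"
  unfolding fourier_def by (rule order_trans[OF integral_norm_bound]) (simp add: norm_mult)

lemma fourier_scale: "fourier (\<lambda>p. k * f p) = (\<lambda>\<zeta>. k * fourier f \<zeta>)"
  by (simp add: fourier_def fun_eq_iff mult.left_commute)

lemma integrable_cis_mult:
  assumes "integrable lborel f" "g \<in> borel_measurable borel"
  shows "integrable lborel (\<lambda>p. cis (g p) * f p)"
proof -
  have "(\<lambda>p. cis (g p)) \<in> borel_measurable borel"
    by (rule measurable_compose[OF assms(2)]) (intro borel_measurable_continuous_onI continuous_intros)
  then show ?thesis
    by (intro Bochner_Integration.integrable_bound[OF assms(1)]) (use assms in \<open>auto simp: norm_mult\<close>)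
qed

lemma fourier_add:
  assumes "integrable lborel f" "integrable lborel g"
  shows "fourier (\<lambda>p. f p + g p) \<zeta> = fourier f \<zeta> + fourier g \<zeta>"
  unfolding fourier_def using assms by (simp add: integrable_cis_mult distrib_left)

lemma cis_linear_approx: "cmod (cis x - 1 - \<i> * of_real x) \<le> x\<^sup>2 / 2"
  using iexp_approx1[of x 1] by (simp add: cis_conv_exp algebra_simps power2_eq_square)

text \<open>The second-order Taylor remainder of the oscillating factor is at most half of (p
  \<bullet> h)^2, so the error is at most \<open>(norm h)\<^sup>2 / 2\<close> times the second
  moment of |f|. That moment is written as \<open>?m\<close> to get its integrability from
  \<open>mulx\<close> and \<open>muly\<close>. Partial derivatives alone would not do, because
  \<open>schwartz\<close> demands Frechet differentiability.\<close>

lemma fourier_has_derivative: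
  assumes f: "f \<in> schwartz"
  shows "(fourier f has_derivative
    (\<lambda>h. of_real (fst h) * fourier (\<lambda>p. - \<i> * mulx f p) \<zeta> + of_real (snd h) * fourier (\<lambda>p. - \<i> * muly f p) \<zeta>)) (at \<zeta>)"
    (is "(_ has_derivative ?D) _")
proof -
  let ?m = "\<lambda>p. cmod (mulx (mulx f) p) + cmod (muly (muly f) p)"
  define K where "K = (\<integral>p. ?m p \<partial>lborel)"
  have int: "integrable lborel f" "integrable lborel (mulx f)" "integrable lborel (muly f)" "integrable lborel ?m"
    using f by (auto intro!: schwartz_integrable schwartz_mulx schwartz_muly)
  have K: "0 \<le> K" unfolding K_def by (rule Bochner_Integration.integral_nonneg) simp
  have bound: "cmod (fourier f z - fourier f \<zeta> - ?D (z - \<zeta>)) \<le> K / 2 * (norm (z - \<zeta>))\<^sup>2" for z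
  proof -
    define h where "h = z - \<zeta>"
    let ?r = "\<lambda>p. cis (- (p \<bullet> \<zeta>)) * (cis (- (p \<bullet> h)) - 1 - \<i> * of_real (- (p \<bullet> h))) * f p"
    have "fourier f z - fourier f \<zeta> - ?D h =
       (\<integral>p. cis (- (p \<bullet> z)) * f p - cis (- (p \<bullet> \<zeta>)) * f p - (of_real (fst h) * (cis (- (p \<bullet> \<zeta>)) * (- \<i> * mulx f p)) + of_real (snd h) * (cis (- (p \<bullet> \<zeta>)) * (- \<i> * muly f p))) \<partial>lborel)"
    proof (rule has_bochner_integral_integral_eq[symmetric])
      have hb: "has_bochner_integral lborel (\<lambda>p. cis (- (p \<bullet> w)) * g p) (fourier g w)" if "integrable lborel g" for g w
        unfolding fourier_def by (rule has_bochner_integral_integrable, rule integrable_cis_mult[OF that]) simp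
      show "has_bochner_integral lborel (\<lambda>p. cis (- (p \<bullet> z)) * f p - cis (- (p \<bullet> \<zeta>)) * f p - (of_real (fst h) * (cis (- (p \<bullet> \<zeta>)) * (- \<i> * mulx f p)) + of_real (snd h) * (cis (- (p \<bullet> \<zeta>)) * (- \<i> * muly f p))))
         (fourier f z - fourier f \<zeta> - ?D h)"
        by (rule has_bochner_integral_diff[OF has_bochner_integral_diff[OF hb hb]
              has_bochner_integral_add[OF has_bochner_integral_mult_right[OF hb] has_bochner_integral_mult_right[OF hb]]])
           (rule int integrable_mult_right)+
    qed
    also have "\<dots> = (\<integral>p. ?r p \<partial>lborel)"
    proof (rule Bochner_Integration.integral_cong)
      fix p :: "real \<times> real"
      have "cis (- (p \<bullet> z)) = cis (- (p \<bullet> \<zeta>)) * cis (- (p \<bullet> h))"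
        by (simp add: h_def cis_mult inner_diff_right)
      moreover have "of_real (- (p \<bullet> h)) = - (of_real (fst h) * of_real (fst p) + of_real (snd h) * of_real (snd p) :: complex)"
        by (simp add: inner_prod_def mult.commute)
      ultimately show "cis (- (p \<bullet> z)) * f p - cis (- (p \<bullet> \<zeta>)) * f p - (of_real (fst h) * (cis (- (p \<bullet> \<zeta>)) * (- \<i> * mulx f p)) + of_real (snd h) * (cis (- (p \<bullet> \<zeta>)) * (- \<i> * muly f p))) = ?r p"
        unfolding mulx_def muly_def by (simp only:) (simp only: ring_distribs mult_minus_left mult_minus_right mult_ac minus_minus mult_1_left mult_1_right, simp)
    qed simp
    also have "cmod \<dots> \<le> (\<integral>p. (norm h)\<^sup>2 / 2 * ?m p \<partial>lborel)"
    proof (rule Bochner_Integration.integral_norm_bound_integral)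
      show "integrable lborel (\<lambda>p. (norm h)\<^sup>2 / 2 * ?m p)" by (intro integrable_mult_right int)
      show le: "cmod (?r p) \<le> (norm h)\<^sup>2 / 2 * ?m p" for p
      proof -
        have "(p \<bullet> h)\<^sup>2 \<le> (norm p)\<^sup>2 * (norm h)\<^sup>2"
          using Cauchy_Schwarz_ineq[of p h] by (simp add: power2_norm_eq_inner)
        then have "cmod (cis (- (p \<bullet> h)) - 1 - \<i> * of_real (- (p \<bullet> h))) \<le> (norm p)\<^sup>2 * (norm h)\<^sup>2 / 2"
          using cis_linear_approx[of "- (p \<bullet> h)"] by simp
        then have "cmod (?r p) \<le> (norm p)\<^sup>2 * (norm h)\<^sup>2 / 2 * cmod (f p)"
          unfolding norm_mult norm_cis mult_1_left by (rule mult_right_mono) simp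
        also have "\<dots> = (norm h)\<^sup>2 / 2 * ?m p"
          by (cases p) (simp add: norm_Pair mulx_def muly_def norm_mult field_simps power2_eq_square)
        finally show ?thesis .
      qed
      show "integrable lborel ?r"
      proof (rule Bochner_Integration.integrable_bound)
        show "integrable lborel (\<lambda>p. (norm h)\<^sup>2 / 2 * ?m p)" by (intro integrable_mult_right int)
        have "(\<lambda>p. cis (- (p \<bullet> q))) \<in> borel_measurable borel" for q :: "real \<times> real"
          by (intro borel_measurable_continuous_onI continuous_intros)
        then show "?r \<in> borel_measurable lborel"
          using borel_measurable_integrable[OF int(1)] by auto
        show "AE p in lborel. norm (?r p) \<le> norm ((norm h)\<^sup>2 / 2 * ?m p)"
          unfolding real_norm_def by (intro always_eventually allI order_trans[OF le abs_ge_self])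
      qed
    qed
    finally show ?thesis by (simp add: h_def K_def mult_ac)
  qed
  show ?thesis
  proof (rule has_derivativeI_sandwich[of 1])
    show "bounded_linear ?D"
      by (intro bounded_linear_add bounded_linear_mult_const
           bounded_linear_compose[OF bounded_linear_of_real bounded_linear_fst]
           bounded_linear_compose[OF bounded_linear_of_real bounded_linear_snd])
    fix z assume "z \<noteq> \<zeta>"
    then have "0 < norm (z - \<zeta>)" by simp
    then show "norm (fourier f z - fourier f \<zeta> - ?D (z - \<zeta>)) / norm (z - \<zeta>) \<le> K / 2 * norm (z - \<zeta>)"
      using bound[of z] by (simp add: field_simps power2_eq_square)
  next
    show "((\<lambda>z. K / 2 * norm (z - \<zeta>)) \<longlongrightarrow> 0) (at \<zeta>)"
    proof -
      have "isCont (\<lambda>z. K / 2 * norm (z - \<zeta>)) \<zeta>" by (intro continuous_intros)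
      then show ?thesis by (simp add: isCont_def)
    qed
  qed auto
qed

lemma dx_fourier: "f \<in> schwartz \<Longrightarrow> dx (fourier f) = fourier (\<lambda>p. - \<i> * mulx f p)"
  and dy_fourier: "f \<in> schwartz \<Longrightarrow> dy (fourier f) = fourier (\<lambda>p. - \<i> * muly f p)"
proof -
  assume f: "f \<in> schwartz"
  have "((\<lambda>s. fourier f (s, y)) has_vector_derivative fourier (\<lambda>p. - \<i> * mulx f p) (x, y)) (at x)"
    "((\<lambda>s. fourier f (x, s)) has_vector_derivative fourier (\<lambda>p. - \<i> * muly f p) (x, y)) (at y)" for x y
  proof -
    have "((\<lambda>s. (s, y)) has_derivative (\<lambda>h. (h, 0))) (at x)" "((\<lambda>s. (x, s)) has_derivative (\<lambda>h. (0, h))) (at y)"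
      by (auto intro!: derivative_eq_intros)
    from has_derivative_compose[OF this(1) fourier_has_derivative[OF f]]
         has_derivative_compose[OF this(2) fourier_has_derivative[OF f]]
    show "((\<lambda>s. fourier f (s, y)) has_vector_derivative fourier (\<lambda>p. - \<i> * mulx f p) (x, y)) (at x)"
      "((\<lambda>s. fourier f (x, s)) has_vector_derivative fourier (\<lambda>p. - \<i> * muly f p) (x, y)) (at y)"
      by (simp_all add: has_vector_derivative_def scaleR_conv_of_real)
  qed
  note this[THEN vector_derivative_at]
  then show "dx (fourier f) = fourier (\<lambda>p. - \<i> * mulx f p)" "dy (fourier f) = fourier (\<lambda>p. - \<i> * muly f p)"
    by (auto simp: fun_eq_iff dx_def dy_def)
qed

text \<open>Reduces all smoothness and decay questions about derivatives of \<open>fourier f\<close>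
  to those about \<open>fourier g\<close> itself.\<close>

lemma dxy_fourier: "f \<in> schwartz \<Longrightarrow> \<exists>g\<in>schwartz. dxy c d (fourier f) = fourier g"
proof (induction d)
  case 0
  then show ?case
  proof (induction c)
    case (Suc c)
    then obtain g where g: "g \<in> schwartz" "dxy c 0 (fourier f) = fourier g" by blast
    show ?case
      by (rule bexI[of _ "\<lambda>p. - \<i> * mulx g p"])
         (use g in \<open>auto simp only: dxy_Suc_0 dx_fourier intro!: schwartz_scale schwartz_mulx\<close>)
  qed auto
next
  case (Suc d)
  then obtain g where g: "g \<in> schwartz" "dxy c d (fourier f) = fourier g" by blast
  show ?case
    by (rule bexI[of _ "\<lambda>p. - \<i> * muly g p"])
       (use g in \<open>auto simp only: dxy_Suc dy_fourier intro!: schwartz_scale schwartz_muly\<close>)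
qed

text \<open>A monomial times \<open>fourier g\<close> is, up to a unimodular constant, the transform
  of a derivative of \<open>g\<close>, which is bounded by an L^1 norm.\<close>

lemma schwartz_fourier: assumes f: "f \<in> schwartz" shows "fourier f \<in> schwartz"
proof (rule schwartzI)
  show "dxy c d (fourier f) differentiable (at p)" for c d p
  proof -
    obtain g where "g \<in> schwartz" "dxy c d (fourier f) = fourier g" using dxy_fourier[OF f] by blast
    with fourier_has_derivative[of g p] show ?thesis by (auto simp: differentiable_def)
  qed
  fix a b c d
  obtain g where g: "g \<in> schwartz" "dxy c d (fourier f) = fourier g" using dxy_fourier[OF f] by blast
  have "cmod (of_real (x ^ a * y ^ b) * dxy c d (fourier f) (x, y)) = cmod (fourier (dxy a b g) (x, y))" for x y
    unfolding g(2) fourier_dxy[OF g(1)] by (simp add: norm_mult norm_power)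
  then show "\<exists>C. \<forall>x y. cmod (of_real (x ^ a * y ^ b) * dxy c d (fourier f) (x, y)) \<le> C"
    using cmod_fourier_le by metis
qed

section \<open>Fourier inversion\<close>

lemma lborel_integral_affine:
  fixes f :: "'a::euclidean_space \<Rightarrow> 'b::{banach, second_countable_topology}"
  assumes c: "c \<noteq> 0" and [measurable]: "f \<in> borel_measurable borel"
  shows "(\<integral>x. f x \<partial>lborel) = \<bar>c\<bar> ^ DIM('a) *\<^sub>R (\<integral>x. f (t + c *\<^sub>R x) \<partial>lborel)"
proof -
  have "(\<integral>x. f x \<partial>lborel) = (\<integral>x. f x \<partial>density (distr lborel borel (\<lambda>x. t + c *\<^sub>R x)) (\<lambda>_. ennreal (\<bar>c\<bar> ^ DIM('a))))"
    using lborel_affine[OF c, of t] by simp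
  also have "\<dots> = (\<integral>x. \<bar>c\<bar> ^ DIM('a) *\<^sub>R f x \<partial>distr lborel borel (\<lambda>x. t + c *\<^sub>R x))"
    by (rule integral_density) auto
  also have "\<dots> = (\<integral>x. \<bar>c\<bar> ^ DIM('a) *\<^sub>R f (t + c *\<^sub>R x) \<partial>lborel)"
    by (rule integral_distr) auto
  finally show ?thesis by simp
qed

definition gauss :: "real \<times> real \<Rightarrow> real" where
  "gauss p = exp (- (norm p)\<^sup>2 / 2)"

lemma integrable_gauss_1d:
  assumes "0 < \<epsilon>"
  shows "integrable lborel (\<lambda>x::real. exp (- (\<epsilon> * x)\<^sup>2 / 2))"
proof -
  have "integrable lborel (\<lambda>x. sqrt (2 * pi) * std_normal_density x)"
    by (intro integrable_mult_right) simp
  then have "integrable lborel (\<lambda>x::real. exp (- x\<^sup>2 / 2))"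
    by (simp add: std_normal_density_def)
  from lborel_integrable_real_affine[OF this, of \<epsilon> 0] assms show ?thesis by simp
qed

text \<open>The characteristic function of the standard normal distribution at - b / \<epsilon>,
  after rescaling the variable by \<epsilon>.\<close>

lemma fourier_gauss_1d:
  assumes "0 < \<epsilon>"
  shows "(\<integral>x. cis (- (x * b)) * of_real (exp (- (\<epsilon> * x)\<^sup>2 / 2)) \<partial>lborel)
    = of_real (sqrt (2 * pi) / \<epsilon> * exp (- (b / \<epsilon>)\<^sup>2 / 2))"
proof -
  let ?t = "- b / \<epsilon>"
  have "of_real (exp (- ?t\<^sup>2 / 2)) = char std_normal_distribution ?t"
    by (simp add: char_std_normal_distribution)
  also have "\<dots> = (\<integral>x. std_normal_density x *\<^sub>R iexp (?t * x) \<partial>lborel)"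
    unfolding char_def by (subst integral_density) auto
  also have "\<dots> = (\<integral>x. of_real (1 / sqrt (2 * pi)) * (cis (x * ?t) * of_real (exp (- x\<^sup>2 / 2))) \<partial>lborel)"
    by (simp add: std_normal_density_def cis_conv_exp scaleR_conv_of_real mult_ac)
  also have "\<dots> = of_real (1 / sqrt (2 * pi)) * (\<integral>x. cis (x * ?t) * of_real (exp (- x\<^sup>2 / 2)) \<partial>lborel)"
    by (rule integral_mult_right_zero)
  also have "(\<integral>x. cis (x * ?t) * of_real (exp (- x\<^sup>2 / 2)) \<partial>lborel)
      = \<epsilon> *\<^sub>R (\<integral>x. cis (- (x * b)) * of_real (exp (- (\<epsilon> * x)\<^sup>2 / 2)) \<partial>lborel)"
    using lborel_integral_real_affine[of \<epsilon> "\<lambda>x. cis (x * ?t) * of_real (exp (- x\<^sup>2 / 2))" 0] assms by simp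
  finally have e: "of_real (exp (- ?t\<^sup>2 / 2)) = of_real (1 / sqrt (2 * pi)) *
      (\<epsilon> *\<^sub>R (\<integral>x. cis (- (x * b)) * of_real (exp (- (\<epsilon> * x)\<^sup>2 / 2)) \<partial>lborel))" (is "_ = _ * (_ *\<^sub>R ?I)") .
  have "of_real (sqrt (2 * pi) / \<epsilon>) * of_real (exp (- ?t\<^sup>2 / 2)) = of_real (sqrt (2 * pi) / \<epsilon> * (1 / sqrt (2 * pi)) * \<epsilon>) * ?I"
    by (simp only: e scaleR_conv_of_real of_real_mult mult.assoc)
  also have "sqrt (2 * pi) / \<epsilon> * (1 / sqrt (2 * pi)) * \<epsilon> = 1" using assms by simp
  finally show ?thesis by simp
qed

lemma integrable_gauss: "0 < \<epsilon> \<Longrightarrow> integrable lborel (\<lambda>p. gauss (\<epsilon> *\<^sub>R p))"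
  and fourier_gauss: "0 < \<epsilon> \<Longrightarrow> fourier (\<lambda>p. of_real (gauss (\<epsilon> *\<^sub>R p))) q = of_real (2 * pi / \<epsilon>\<^sup>2 * gauss (q /\<^sub>R \<epsilon>))"
proof -
  assume e: "0 < \<epsilon>"
  have g: "gauss (c *\<^sub>R p) = exp (- (c * fst p)\<^sup>2 / 2) * exp (- (c * snd p)\<^sup>2 / 2)" for p c
    by (cases p) (simp add: gauss_def norm_Pair power_mult_distrib field_simps flip: exp_add)
  show "integrable lborel (\<lambda>p. gauss (\<epsilon> *\<^sub>R p))"
    using lborel_tensor(1)[OF integrable_gauss_1d[OF e] integrable_gauss_1d[OF e]]
    by (simp add: g split_beta')
  let ?f = "\<lambda>b x. cis (- (x * b)) * of_real (exp (- (\<epsilon> * x)\<^sup>2 / 2))"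
  have i: "integrable lborel (?f b)" for b
    by (rule integrable_cis_mult) (auto intro: integrable_of_real integrable_gauss_1d[OF e, simplified])
  have "fourier (\<lambda>p. of_real (gauss (\<epsilon> *\<^sub>R p))) q = (\<integral>(x, y). ?f (fst q) x * ?f (snd q) y \<partial>lborel)"
    unfolding fourier_def
  proof (rule Bochner_Integration.integral_cong)
    fix p :: "real \<times> real"
    have "cis (- (p \<bullet> q)) = cis (- (fst p * fst q)) * cis (- (snd p * snd q))"
      by (simp add: cis_mult inner_prod_def)
    then show "cis (- (p \<bullet> q)) * of_real (gauss (\<epsilon> *\<^sub>R p)) = (case p of (x, y) \<Rightarrow> ?f (fst q) x * ?f (snd q) y)"
      by (simp only: g split_beta of_real_mult mult_ac)
  qed simp
  also have "\<dots> = of_real (2 * pi / \<epsilon>\<^sup>2 * gauss (q /\<^sub>R \<epsilon>))"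
    unfolding lborel_tensor(2)[OF i i] fourier_gauss_1d[OF e] g using e
    by (simp add: power2_eq_square field_simps flip: of_real_mult)
  finally show "fourier (\<lambda>p. of_real (gauss (\<epsilon> *\<^sub>R p))) q = of_real (2 * pi / \<epsilon>\<^sup>2 * gauss (q /\<^sub>R \<epsilon>))" .
qed

lemma gauss_le_1: "gauss p \<le> 1" and gauss_pos: "0 < gauss p"
  by (simp_all add: gauss_def)

lemma borel_measurable_gauss [measurable]: "gauss \<in> borel_measurable borel"
  unfolding gauss_def by (intro borel_measurable_continuous_onI continuous_intros) auto

lemma borel_measurable_cis_inner [measurable]:
  fixes f g :: "'a \<Rightarrow> real \<times> real"
  assumes [measurable]: "f \<in> borel_measurable M" "g \<in> borel_measurable M"
  shows "(\<lambda>x. cis (- (f x \<bullet> g x))) \<in> borel_measurable M"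
proof -
  have c: "cis \<in> borel_measurable borel" by (intro borel_measurable_continuous_onI continuous_intros)
  show ?thesis by (rule measurable_compose[OF _ c]) measurable
qed

text \<open>The multiplication formula with a Gaussian regularisation, whose width tends to zero.\<close>

theorem fourier_fourier:
  assumes f: "f \<in> schwartz"
  shows "fourier (fourier f) x = of_real ((2 * pi)\<^sup>2) * f (- x)"
proof -
  have fb [measurable]: "f \<in> borel_measurable borel" by (rule schwartz_borel[OF f])
  have fi: "integrable lborel f" by (rule schwartz_integrable[OF f])
  have gi: "integrable lborel (fourier f)" by (intro schwartz_integrable schwartz_fourier f)
  have gb [measurable]: "fourier f \<in> borel_measurable borel" by (intro schwartz_borel schwartz_fourier f)
  \<comment> \<open>Inserting the definition of \<open>fourier f\<close> and exchanging the
    integrals leaves the transform of a Gaussian at x + p; the substitution p = \<epsilon> z - x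
    then moves \<epsilon> from the Gaussian into the argument of f.\<close>
  have reg: "(\<integral>\<zeta>. cis (- (\<zeta> \<bullet> x)) * fourier f \<zeta> * of_real (gauss (\<epsilon> *\<^sub>R \<zeta>)) \<partial>lborel)
      = of_real (2 * pi) * (\<integral>z. f (\<epsilon> *\<^sub>R z - x) * of_real (gauss z) \<partial>lborel)" if e: "0 < \<epsilon>" for \<epsilon>
  proof -
    let ?F = "\<lambda>\<zeta> p. cis (- (\<zeta> \<bullet> x)) * (cis (- (p \<bullet> \<zeta>)) * f p) * of_real (gauss (\<epsilon> *\<^sub>R \<zeta>))"
    have m: "case_prod ?F \<in> borel_measurable (lborel \<Otimes>\<^sub>M lborel)" by measurable
    have F: "integrable (lborel \<Otimes>\<^sub>M lborel) (case_prod ?F)"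
    proof (rule lborel_pair.Fubini_integrable[OF m])
      have "integrable lborel (\<lambda>\<zeta>. gauss (\<epsilon> *\<^sub>R \<zeta>) * (\<integral>p. cmod (f p) \<partial>lborel))"
        by (intro integrable_mult_left integrable_gauss e)
      then show "integrable lborel (\<lambda>\<zeta>. \<integral>p. norm (case_prod ?F (\<zeta>, p)) \<partial>lborel)"
        by (simp add: norm_mult less_imp_le[OF gauss_pos] mult.commute)
      show "AE \<zeta> in lborel. integrable lborel (\<lambda>p. case_prod ?F (\<zeta>, p))"
        by (auto intro!: integrable_mult_right integrable_mult_left integrable_cis_mult fi)
    qed
    have "(\<integral>\<zeta>. cis (- (\<zeta> \<bullet> x)) * fourier f \<zeta> * of_real (gauss (\<epsilon> *\<^sub>R \<zeta>)) \<partial>lborel) = (\<integral>\<zeta>. \<integral>p. ?F \<zeta> p \<partial>lborel \<partial>lborel)"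
      by (simp add: fourier_def)
    also have "\<dots> = (\<integral>p. \<integral>\<zeta>. ?F \<zeta> p \<partial>lborel \<partial>lborel)"
      using lborel_pair.Fubini_integral[OF F] by simp
    also have "\<dots> = (\<integral>p. f p * of_real (2 * pi / \<epsilon>\<^sup>2 * gauss ((x + p) /\<^sub>R \<epsilon>)) \<partial>lborel)"
    proof (rule Bochner_Integration.integral_cong)
      fix p
      have "(\<integral>\<zeta>. ?F \<zeta> p \<partial>lborel) = (\<integral>\<zeta>. f p * (cis (- (\<zeta> \<bullet> (x + p))) * of_real (gauss (\<epsilon> *\<^sub>R \<zeta>))) \<partial>lborel)"
      proof (rule Bochner_Integration.integral_cong)
        fix \<zeta>
        have "cis (- (\<zeta> \<bullet> (x + p))) = cis (- (\<zeta> \<bullet> x)) * cis (- (p \<bullet> \<zeta>))"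
          by (simp add: cis_mult inner_add_right inner_commute)
        then show "?F \<zeta> p = f p * (cis (- (\<zeta> \<bullet> (x + p))) * of_real (gauss (\<epsilon> *\<^sub>R \<zeta>)))"
          by (simp only: mult_ac)
      qed simp
      then show "(\<integral>\<zeta>. ?F \<zeta> p \<partial>lborel) = f p * of_real (2 * pi / \<epsilon>\<^sup>2 * gauss ((x + p) /\<^sub>R \<epsilon>))"
        using fourier_gauss[OF e, of "x + p"] by (simp add: fourier_def)
    qed simp
    also have "\<dots> = \<epsilon>\<^sup>2 *\<^sub>R (\<integral>z. f (- x + \<epsilon> *\<^sub>R z) * of_real (2 * pi / \<epsilon>\<^sup>2 * gauss ((x + (- x + \<epsilon> *\<^sub>R z)) /\<^sub>R \<epsilon>)) \<partial>lborel)"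
      using e by (subst lborel_integral_affine[of \<epsilon> _ "- x"]) (auto simp: power2_eq_square)
    also have "\<dots> = \<epsilon>\<^sup>2 *\<^sub>R (\<integral>z. of_real (2 * pi / \<epsilon>\<^sup>2) * (f (\<epsilon> *\<^sub>R z - x) * of_real (gauss z)) \<partial>lborel)"
      using e by (simp add: mult_ac)
    also have "\<dots> = of_real (2 * pi) * (\<integral>z. f (\<epsilon> *\<^sub>R z - x) * of_real (gauss z) \<partial>lborel)"
      using e by (simp only: integral_mult_right_zero) (simp add: scaleR_conv_of_real)
    finally show ?thesis .
  qed
  let ?e = "\<lambda>n. inverse (real (Suc n))"
  have e0: "?e \<longlonglongrightarrow> 0" by (rule LIMSEQ_inverse_real_of_nat)
  have "isCont gauss 0" unfolding gauss_def by (intro continuous_intros) auto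
  have l1: "(\<lambda>n. \<integral>\<zeta>. cis (- (\<zeta> \<bullet> x)) * fourier f \<zeta> * of_real (gauss (?e n *\<^sub>R \<zeta>)) \<partial>lborel)
      \<longlonglongrightarrow> (\<integral>\<zeta>. cis (- (\<zeta> \<bullet> x)) * fourier f \<zeta> \<partial>lborel)"
  proof (rule integral_dominated_convergence)
    show "integrable lborel (\<lambda>\<zeta>. cmod (fourier f \<zeta>))" using gi by simp
    show "AE \<zeta> in lborel. (\<lambda>n. cis (- (\<zeta> \<bullet> x)) * fourier f \<zeta> * of_real (gauss (?e n *\<^sub>R \<zeta>))) \<longlonglongrightarrow> cis (- (\<zeta> \<bullet> x)) * fourier f \<zeta>"
    proof (intro always_eventually allI)
      fix \<zeta> :: "real \<times> real"
      have "(\<lambda>n. ?e n *\<^sub>R \<zeta>) \<longlonglongrightarrow> 0 *\<^sub>R \<zeta>" by (intro tendsto_intros e0)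
      from isCont_tendsto_compose[OF _ this, of gauss] \<open>isCont gauss 0\<close>
      have "(\<lambda>n. gauss (?e n *\<^sub>R \<zeta>)) \<longlonglongrightarrow> 1" by (simp add: gauss_def)
      from tendsto_mult[OF tendsto_const tendsto_of_real[OF this], of "cis (- (\<zeta> \<bullet> x)) * fourier f \<zeta>"]
      show "(\<lambda>n. cis (- (\<zeta> \<bullet> x)) * fourier f \<zeta> * of_real (gauss (?e n *\<^sub>R \<zeta>))) \<longlonglongrightarrow> cis (- (\<zeta> \<bullet> x)) * fourier f \<zeta>"
        by simp
    qed
    show "AE \<zeta> in lborel. norm (cis (- (\<zeta> \<bullet> x)) * fourier f \<zeta> * of_real (gauss (?e n *\<^sub>R \<zeta>))) \<le> cmod (fourier f \<zeta>)" for n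
      using gauss_le_1 by (auto simp: norm_mult less_imp_le[OF gauss_pos] intro!: mult_left_le)
  qed auto
  obtain B where B: "cmod (f p) \<le> B" for p
    using schwartz_moment_bound[OF f, of 0 0 0 0] by (metis dxy_0_0 mult_1_left of_real_1 power_0 mult_1_right surj_pair)
  have l2: "(\<lambda>n. \<integral>z. f (?e n *\<^sub>R z - x) * of_real (gauss z) \<partial>lborel) \<longlonglongrightarrow> (\<integral>z. f (- x) * of_real (gauss z) \<partial>lborel)"
  proof (rule integral_dominated_convergence)
    show "integrable lborel (\<lambda>z. B * gauss z)" using integrable_gauss[of 1] by simp
    show "AE z in lborel. (\<lambda>n. f (?e n *\<^sub>R z - x) * of_real (gauss z)) \<longlonglongrightarrow> f (- x) * of_real (gauss z)"
    proof (intro always_eventually allI)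
      fix z :: "real \<times> real"
      have "(\<lambda>n. ?e n *\<^sub>R z - x) \<longlonglongrightarrow> 0 *\<^sub>R z - x" by (intro tendsto_intros e0)
      moreover have "isCont f (- x)"
        using schwartz_differentiable[OF f, of 0 0] by (simp add: differentiable_imp_continuous_within)
      ultimately have "(\<lambda>n. f (?e n *\<^sub>R z - x)) \<longlonglongrightarrow> f (- x)"
        by (intro isCont_tendsto_compose[of _ f]) auto
      then show "(\<lambda>n. f (?e n *\<^sub>R z - x) * of_real (gauss z)) \<longlonglongrightarrow> f (- x) * of_real (gauss z)"
        by (intro tendsto_intros)
    qed
    show "AE z in lborel. norm (f (?e n *\<^sub>R z - x) * of_real (gauss z)) \<le> B * gauss z" for n
      using mult_right_mono[OF B less_imp_le[OF gauss_pos]]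
      by (intro always_eventually allI) (simp only: norm_mult norm_of_real abs_of_pos[OF gauss_pos])
  qed auto
  \<comment> \<open>The total mass of the Gaussian supplies the second factor 2 pi of the inversion
    constant.\<close>
  have g1: "(\<integral>z. of_real (gauss z) \<partial>lborel) = (of_real (2 * pi) :: complex)"
    using fourier_gauss[of 1 0] by (simp add: fourier_def gauss_def)
  have "(\<lambda>n. of_real (2 * pi) * (\<integral>z. f (?e n *\<^sub>R z - x) * of_real (gauss z) \<partial>lborel)) \<longlonglongrightarrow> fourier (fourier f) x"
    using l1 by (simp add: reg fourier_def[of "fourier f"])
  moreover have "(\<lambda>n. of_real (2 * pi) * (\<integral>z. f (?e n *\<^sub>R z - x) * of_real (gauss z) \<partial>lborel))
      \<longlonglongrightarrow> of_real (2 * pi) * (f (- x) * of_real (2 * pi))"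
    using tendsto_mult[OF tendsto_const l2, of "of_real (2 * pi)"] by (simp only: integral_mult_right_zero g1)
  ultimately show ?thesis
    by (auto dest: LIMSEQ_unique simp: power2_eq_square)
qed

text \<open>By inversion the fourth power of the transform is the scalar \<open>c\<^sup>2\<close>,
  so a preimage is the third power divided by it.\<close>

lemma fourier_surj:
  assumes f: "f \<in> schwartz"
  obtains g where "g \<in> schwartz" "fourier g = f"
proof
  define c where "c = (of_real ((2 * pi) ^ 2) :: complex)"
  have c: "c \<noteq> 0" by (simp add: c_def)
  let ?g = "\<lambda>p. inverse (c\<^sup>2) * fourier (fourier (fourier f)) p"
  show "?g \<in> schwartz" by (intro schwartz_scale schwartz_fourier f)
  show "fourier ?g = f"
  proof
    fix x
    have "fourier ?g x = inverse (c\<^sup>2) * (c * (c * f (- (- x))))"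
      using fourier_fourier[OF schwartz_fourier[OF schwartz_fourier[OF f]], of x] fourier_fourier[OF f, of "- x"]
      unfolding fourier_scale c_def by simp
    also have "\<dots> = f x" using c by (simp add: power2_eq_square field_simps)
    finally show "fourier ?g x = f x" .
  qed
qed

section \<open>Distributions and their Fourier transforms\<close>

lemma pairing_not_schwartz: "f \<notin> schwartz \<Longrightarrow> pairing L f = 0"
  using pairing[of L] by (simp add: tempered_def)

text \<open>The transform is onto the Schwartz functions, so the values at all
  \<open>fourier h\<close> determine the functional; elsewhere it is 0 by convention. This makes the
  description in \<open>of_hat\<close> unique.\<close>

lemma has_fourier_inj: assumes "has_fourier L g" "has_fourier M g" shows "L = M"
proof -
  have "pairing L f = pairing M f" for f
  proof (cases "f \<in> schwartz")
    case True
    then obtain h where "h \<in> schwartz" "fourier h = f" by (rule fourier_surj)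
    with assms show ?thesis by (auto simp: has_fourier_def)
  qed (simp add: pairing_not_schwartz)
  then show ?thesis by (simp add: pairing_inject[symmetric] fun_eq_iff)
qed

lemma of_hat_eq: "has_fourier L g \<Longrightarrow> of_hat g = L"
  unfolding of_hat_def by (blast intro: the_equality has_fourier_inj)

text \<open>Inverse Fourier transform in weak form: by the inversion formula, f is the transform of
  the function of \<zeta> that is paired here with \<open>g\<close>.\<close>

definition dist_of :: "(real \<times> real \<Rightarrow> complex) \<Rightarrow> tdist" where
  "dist_of g = Abs_tdist (\<lambda>f. if f \<in> schwartz then \<integral>\<zeta>. g \<zeta> * (fourier f (- \<zeta>) / of_real ((2 * pi)\<^sup>2)) \<partial>lborel else 0)"

lemma has_fourier_dist_of:
  assumes g: "integrable lborel g"
  shows "has_fourier (dist_of g) g"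
proof -
  have gb [measurable]: "g \<in> borel_measurable borel" using g by auto
  let ?c = "of_real ((2 * pi)\<^sup>2) :: complex"
  let ?L = "\<lambda>f. if f \<in> schwartz then \<integral>\<zeta>. g \<zeta> * (fourier f (- \<zeta>) / ?c) \<partial>lborel else 0"
  let ?I = "\<integral>(x::real, y::real). inverse ((1 + x\<^sup>2) * (1 + y\<^sup>2)) \<partial>lborel"
  let ?G = "\<integral>p. cmod (g p) \<partial>lborel"
  have bound: "integrable lborel (\<lambda>\<zeta>. g \<zeta> * h \<zeta>)" "cmod (\<integral>\<zeta>. g \<zeta> * h \<zeta> \<partial>lborel) \<le> ?G * B"
    if h: "h \<in> borel_measurable borel" "\<And>\<zeta>. cmod (h \<zeta>) \<le> B" for h B
  proof -
    have iB: "integrable lborel (\<lambda>\<zeta>. cmod (g \<zeta>) * B)" by (intro integrable_mult_left integrable_norm g)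
    have le: "cmod (g \<zeta> * h \<zeta>) \<le> cmod (g \<zeta>) * B" for \<zeta>
      unfolding norm_mult by (intro mult_left_mono h) simp
    show i: "integrable lborel (\<lambda>\<zeta>. g \<zeta> * h \<zeta>)"
    proof (rule Bochner_Integration.integrable_bound[OF iB])
      show "(\<lambda>\<zeta>. g \<zeta> * h \<zeta>) \<in> borel_measurable lborel" using h(1) by measurable
      show "AE \<zeta> in lborel. norm (g \<zeta> * h \<zeta>) \<le> norm (cmod (g \<zeta>) * B)"
        unfolding real_norm_def by (intro always_eventually allI order_trans[OF le abs_ge_self])
    qed
    have "cmod (\<integral>\<zeta>. g \<zeta> * h \<zeta> \<partial>lborel) \<le> (\<integral>\<zeta>. cmod (g \<zeta>) * B \<partial>lborel)"
      by (rule Bochner_Integration.integral_norm_bound_integral[OF i iB]) (rule le)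
    then show "cmod (\<integral>\<zeta>. g \<zeta> * h \<zeta> \<partial>lborel) \<le> ?G * B" by simp
  qed
  have m: "(\<lambda>\<zeta>. fourier f (- \<zeta>) / ?c) \<in> borel_measurable borel" if "f \<in> schwartz" for f
    using schwartz_borel[OF schwartz_fourier[OF that]] by measurable
  have le: "cmod (fourier f (- \<zeta>) / ?c) \<le> (schwartz_norm 2 f * ?I) / (2 * pi)\<^sup>2" if f: "f \<in> schwartz" for f \<zeta>
  proof -
    have "cmod (fourier f (- \<zeta>)) \<le> schwartz_norm 2 f * ?I"
      by (rule order_trans[OF cmod_fourier_le integrable_of_decay(2)[OF schwartz_borel[OF f] schwartz_decay_norm[OF f]]])
    then show ?thesis
      by (simp only: norm_divide norm_of_real abs_power2) (simp add: divide_right_mono)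
  qed
  have i: "integrable lborel (\<lambda>\<zeta>. g \<zeta> * (fourier f (- \<zeta>) / ?c))" if f: "f \<in> schwartz" for f
    by (rule bound(1)[OF m[OF f] le[OF f]])
  have "tempered ?L"
    unfolding tempered_def
  proof (intro conjI ballI allI impI)
    fix f h assume f: "f \<in> schwartz" and h: "h \<in> schwartz"
    have "(\<integral>\<zeta>. g \<zeta> * (fourier (\<lambda>p. f p + h p) (- \<zeta>) / ?c) \<partial>lborel)
      = (\<integral>\<zeta>. g \<zeta> * (fourier f (- \<zeta>) / ?c) + g \<zeta> * (fourier h (- \<zeta>) / ?c) \<partial>lborel)"
      by (intro Bochner_Integration.integral_cong)
         (simp_all add: fourier_add schwartz_integrable f h add_divide_distrib distrib_left)
    then show "?L (\<lambda>p. f p + h p) = ?L f + ?L h"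
      using i[OF f] i[OF h] f h by (simp add: schwartz_add)
  next
    fix f k assume f: "f \<in> schwartz"
    have "(\<integral>\<zeta>. g \<zeta> * (fourier (\<lambda>p. k * f p) (- \<zeta>) / ?c) \<partial>lborel)
      = (\<integral>\<zeta>. k * (g \<zeta> * (fourier f (- \<zeta>) / ?c)) \<partial>lborel)"
      by (intro Bochner_Integration.integral_cong) (simp_all add: fourier_scale)
    then show "?L (\<lambda>p. k * f p) = k * ?L f"
      using f by (simp add: schwartz_scale)
  next
    have "cmod (?L f) \<le> (?G * ?I / (2 * pi)\<^sup>2) * schwartz_norm 2 f" if f: "f \<in> schwartz" for f
      using bound(2)[OF m[OF f] le[OF f]] f by (simp add: mult_ac)
    then show "\<exists>n C. \<forall>f\<in>schwartz. cmod (?L f) \<le> C * schwartz_norm n f" by blast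
  qed simp
  then have pair: "pairing (dist_of g) = ?L"
    unfolding dist_of_def by (simp add: Abs_tdist_inverse)
  show ?thesis
    unfolding has_fourier_def pair
  proof (intro conjI ballI gb)
    fix \<psi> assume p: "\<psi> \<in> schwartz"
    obtain B where B: "cmod (\<psi> q) \<le> B" for q
      using schwartz_moment_bound[OF p, of 0 0 0 0] by (metis dxy_0_0 mult_1_left of_real_1 power_0 mult_1_right surj_pair)
    show "integrable lborel (\<lambda>\<zeta>. g \<zeta> * \<psi> \<zeta>)" by (rule bound(1)[OF schwartz_borel[OF p] B])
    show "?L (fourier \<psi>) = (\<integral>\<zeta>. g \<zeta> * \<psi> \<zeta> \<partial>lborel)"
      using p by (simp add: schwartz_fourier fourier_fourier)
  qed
qed

section \<open>Uniqueness of Fourier transforms\<close>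

text \<open>Differentiation changes only the polynomial factor \<open>q\<close>, so all derivatives
  stay in this class and the Schwartz property reduces to boundedness of its members.\<close>

definition poly_exp :: "real poly \<Rightarrow> real poly \<Rightarrow> real \<Rightarrow> real" where
  "poly_exp q Q x = poly q x * exp (poly Q x)"

definition poly_exp2 :: "real poly \<Rightarrow> real poly \<Rightarrow> real poly \<Rightarrow> real poly \<Rightarrow> real \<times> real \<Rightarrow> complex" where
  "poly_exp2 q Q r R = (\<lambda>(x, y). of_real (poly_exp q Q x * poly_exp r R y))"

lemma poly_exp_deriv: "(poly_exp q Q has_real_derivative poly_exp (pderiv q + q * pderiv Q) Q x) (at x)"
  unfolding poly_exp_def by (auto intro!: derivative_eq_intros simp: algebra_simps)

lemma dx_poly_exp2: "dx (poly_exp2 q Q r R) = poly_exp2 (pderiv q + q * pderiv Q) Q r R"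
  and dy_poly_exp2: "dy (poly_exp2 q Q r R) = poly_exp2 q Q (pderiv r + r * pderiv R) R"
proof -
  have "((\<lambda>s. poly_exp2 q Q r R (s, y)) has_vector_derivative poly_exp2 (pderiv q + q * pderiv Q) Q r R (x, y)) (at x)"
    "((\<lambda>s. poly_exp2 q Q r R (x, s)) has_vector_derivative poly_exp2 q Q (pderiv r + r * pderiv R) R (x, y)) (at y)" for x y
    unfolding poly_exp2_def prod.case
    by (rule has_vector_derivative_of_real; rule DERIV_cmult_right DERIV_cmult, rule poly_exp_deriv)+
  note this[THEN vector_derivative_at]
  then show "dx (poly_exp2 q Q r R) = poly_exp2 (pderiv q + q * pderiv Q) Q r R"
    "dy (poly_exp2 q Q r R) = poly_exp2 q Q (pderiv r + r * pderiv R) R"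
    by (auto simp: fun_eq_iff dx_def dy_def)
qed

lemma poly_exp2_differentiable: "poly_exp2 q Q r R differentiable (at p)"
proof -
  have d: "poly_exp q Q differentiable (at x)" for q Q x
    using poly_exp_deriv real_differentiable_def by blast
  have "(\<lambda>p. poly_exp q Q (fst p)) differentiable (at p)" "(\<lambda>p. poly_exp r R (snd p)) differentiable (at p)"
    using differentiable_chain_at[of fst p "poly_exp q Q"] differentiable_chain_at[of snd p "poly_exp r R"] d
    by (auto simp: o_def intro: bounded_linear_imp_differentiable bounded_linear_fst bounded_linear_snd)
  then have "(\<lambda>p. poly_exp q Q (fst p) * poly_exp r R (snd p)) differentiable (at p)"
    by (rule differentiable_mult)
  from differentiable_chain_at[OF this bounded_linear_imp_differentiable[OF bounded_linear_of_real]]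
  show ?thesis by (simp add: poly_exp2_def o_def split_beta')
qed

lemma dxy_poly_exp2: "\<exists>q' r'. dxy c d (poly_exp2 q Q r R) = poly_exp2 q' Q r' R"
proof (induction d)
  case 0
  show ?case
  proof (induction c)
    case (Suc c)
    then show ?case by (metis dxy_Suc_0 dx_poly_exp2)
  qed auto
next
  case (Suc d)
  then show ?case by (metis dxy_Suc dy_poly_exp2)
qed

text \<open>Each power of |x| divided by its factorial is a single term of the exponential
  series.\<close>

lemma poly_le_exp: "\<exists>C. \<forall>x. \<bar>poly p x\<bar> \<le> C * exp \<bar>x\<bar>" for p :: "real poly"
proof (intro exI allI)
  fix x :: real
  have "\<bar>poly p x\<bar> \<le> (\<Sum>i\<le>degree p. \<bar>coeff p i * x ^ i\<bar>)"
    unfolding poly_altdef by (rule sum_abs)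
  also have "\<dots> \<le> (\<Sum>i\<le>degree p. \<bar>coeff p i\<bar> * (fact i * exp \<bar>x\<bar>))"
  proof (rule sum_mono)
    fix i
    have "\<bar>x\<bar> ^ i / fact i \<le> exp \<bar>x\<bar>"
    proof -
      have "(\<Sum>n\<in>{i}. \<bar>x\<bar> ^ n /\<^sub>R fact n) \<le> (\<Sum>n. \<bar>x\<bar> ^ n /\<^sub>R fact n)"
        by (rule sum_le_suminf[OF summable_exp_generic]) auto
      then have "\<bar>x\<bar> ^ i /\<^sub>R fact i \<le> exp \<bar>x\<bar>" by (simp add: exp_def)
      then show ?thesis by (simp add: divide_inverse mult.commute)
    qed
    then have "\<bar>x\<bar> ^ i \<le> fact i * exp \<bar>x\<bar>" by (simp add: field_simps)
    then show "\<bar>coeff p i * x ^ i\<bar> \<le> \<bar>coeff p i\<bar> * (fact i * exp \<bar>x\<bar>)"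
      by (simp add: abs_mult power_abs mult_left_mono)
  qed
  also have "\<dots> = (\<Sum>i\<le>degree p. \<bar>coeff p i\<bar> * fact i) * exp \<bar>x\<bar>"
    by (simp add: sum_distrib_right mult.assoc)
  finally show "\<bar>poly p x\<bar> \<le> (\<Sum>i\<le>degree p. \<bar>coeff p i\<bar> * fact i) * exp \<bar>x\<bar>" .
qed

lemma poly_exp_bounded:
  assumes "\<And>x. poly Q x \<le> - x\<^sup>2"
  shows "\<exists>C. \<forall>x. \<bar>poly_exp q Q x\<bar> \<le> C"
proof -
  obtain C where C: "\<And>x. \<bar>poly q x\<bar> \<le> C * exp \<bar>x\<bar>" using poly_le_exp[of q] by blast
  have C0: "0 \<le> C" using C[of 0] abs_ge_zero[of "poly q 0"] by simp
  have "\<bar>poly_exp q Q x\<bar> \<le> C * exp 1" for x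
  proof -
    have "0 \<le> (\<bar>x\<bar> - 1)\<^sup>2" by simp
    then have "\<bar>x\<bar> - x\<^sup>2 \<le> 1"
      using zero_le_power2[of x] by (simp add: power2_diff)
    then have e: "\<bar>x\<bar> + poly Q x \<le> 1" using assms[of x] by simp
    have "\<bar>poly_exp q Q x\<bar> \<le> C * exp \<bar>x\<bar> * exp (poly Q x)"
      unfolding poly_exp_def abs_mult abs_exp_cancel by (intro mult_right_mono C) simp
    also have "\<dots> = C * exp (\<bar>x\<bar> + poly Q x)" by (simp add: exp_add)
    also have "\<dots> \<le> C * exp 1" using e C0 by (intro mult_left_mono) auto
    finally show ?thesis .
  qed
  then show ?thesis by blast
qed

lemma poly_exp2_schwartz:
  assumes "\<And>x. poly Q x \<le> - x\<^sup>2" "\<And>x. poly R x \<le> - x\<^sup>2"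
  shows "poly_exp2 q Q r R \<in> schwartz"
proof (rule schwartzI)
  show "dxy c d (poly_exp2 q Q r R) differentiable (at p)" for c d p
    using dxy_poly_exp2[of c d q Q r R] poly_exp2_differentiable by metis
  fix a b c d
  obtain q' r' where e: "dxy c d (poly_exp2 q Q r R) = poly_exp2 q' Q r' R" using dxy_poly_exp2 by blast
  obtain C D where C: "\<And>x. \<bar>poly_exp (monom 1 a * q') Q x\<bar> \<le> C"
    and D: "\<And>x. \<bar>poly_exp (monom 1 b * r') R x\<bar> \<le> D"
    using poly_exp_bounded[OF assms(1), of "monom 1 a * q'"] poly_exp_bounded[OF assms(2), of "monom 1 b * r'"] by blast
  have "cmod (of_real (x ^ a * y ^ b) * dxy c d (poly_exp2 q Q r R) (x, y)) \<le> C * D" for x y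
  proof -
    have "cmod (of_real (x ^ a * y ^ b) * dxy c d (poly_exp2 q Q r R) (x, y)) =
      \<bar>poly_exp (monom 1 a * q') Q x\<bar> * \<bar>poly_exp (monom 1 b * r') R y\<bar>"
      unfolding e unfolding poly_exp2_def poly_exp_def prod.case of_real_mult[symmetric] norm_of_real
      by (simp add: poly_monom abs_mult)
    also have "\<dots> \<le> C * D"
      using C D order_trans[OF abs_ge_zero C] by (intro mult_mono) auto
    finally show ?thesis .
  qed
  then show "\<exists>C. \<forall>x y. cmod (of_real (x ^ a * y ^ b) * dxy c d (poly_exp2 q Q r R) (x, y)) \<le> C" by blast
qed

text \<open>The Borel sets over which \<open>h\<close> integrates to 0 contain the boxes, which are
  stable under intersection, and are closed under complements (by \<open>h0\<close>) and disjoint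
  unions, so they are all Borel sets. The sets where \<open>h\<close> is positive or negative are
  then null.\<close>

lemma AE_zero_of_integral_boxes:
  fixes h :: "'a::euclidean_space \<Rightarrow> real"
  assumes h: "integrable lborel h" and h0: "(\<integral>x. h x \<partial>lborel) = 0"
    and box: "\<And>a b. (\<integral>x. indicator (box a b) x * h x \<partial>lborel) = 0"
  shows "AE x in lborel. h x = 0"
proof -
  have hb [measurable]: "h \<in> borel_measurable borel" using h by auto
  have i: "integrable lborel (\<lambda>x. indicator A x * h x)" if "A \<in> sets borel" for A
    using integrable_real_mult_indicator[of A lborel h] that h by (simp add: mult.commute)
  have all: "(\<integral>x. indicator A x * h x \<partial>lborel) = 0" if "A \<in> sets borel" for A
  proof -
    let ?E = "range (\<lambda>(a, b). box a b :: 'a set)"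
    have s: "sets borel = sigma_sets UNIV ?E" by (simp add: borel_eq_box)
    have "Int_stable ?E" "?E \<subseteq> Pow UNIV" "A \<in> sigma_sets UNIV ?E"
      using that by (auto simp: s Int_stable_def box_Int_box)
    then show ?thesis
    proof (induction rule: sigma_sets_induct_disjoint)
      case (basic A)
      then show ?case using box by auto
    next
      case (compl A)
      then have A: "A \<in> sets borel" by (simp add: s)
      have "(\<integral>x. indicator (UNIV - A) x * h x \<partial>lborel) = (\<integral>x. h x - indicator A x * h x \<partial>lborel)"
        by (intro Bochner_Integration.integral_cong) (auto simp: indicator_def)
      then show ?case using compl i[OF A] h h0 by simp
    next
      case (union A)
      then have A: "A i \<in> sets borel" for i by (auto simp: s)
      then have UA: "(\<Union>i. A i) \<in> sets borel" by blast
      have "(LINT x:(\<Union>i. A i)|lborel. h x) = (\<Sum>i. (LINT x:(A i)|lborel. h x))"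
        by (rule lebesgue_integral_countable_add)
           (use A i[OF UA] union(1) in \<open>auto simp: set_integrable_def disjoint_family_on_def\<close>)
      then show ?case using union by (simp add: set_lebesgue_integral_def)
    qed simp
  qed
  have pos: "AE x in lborel. \<not> 0 < f x" if f: "integrable lborel f" and a: "\<And>A. A \<in> sets borel \<Longrightarrow> (\<integral>x. indicator A x * f x \<partial>lborel) = 0" for f :: "'a \<Rightarrow> real"
  proof -
    have [measurable]: "f \<in> borel_measurable borel" using f by auto
    let ?A = "{x. 0 < f x}"
    have A: "?A \<in> sets borel" by measurable
    have "AE x in lborel. indicator ?A x * f x = 0"
      using a[OF A] integral_nonneg_eq_0_iff_AE[of lborel "\<lambda>x. indicator ?A x * f x"]
        integrable_real_mult_indicator[of ?A lborel f] A f
      by (auto simp: indicator_def mult.commute)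
    then show ?thesis by eventually_elim auto
  qed
  have "AE x in lborel. \<not> 0 < h x" by (rule pos[OF h all])
  moreover have "AE x in lborel. \<not> 0 < - h x" by (rule pos) (use h all in auto)
  ultimately show ?thesis by eventually_elim auto
qed

lemma AE_lborel_coordinate:
  fixes b :: "'a::euclidean_space"
  assumes "b \<in> Basis"
  shows "AE x in lborel. x \<bullet> b \<noteq> k"
proof -
  have "{x. x \<bullet> b = k} \<in> null_sets lborel"
    using negligible_standard_hyperplane[OF assms, of k]
    by (subst null_sets_completion_iff[symmetric]) (auto simp: negligible_iff_null_sets)
  from AE_not_in[OF this] show ?thesis by simp
qed

text \<open>Smooth approximation of the indicator function of (-1, 1), away from its two end
  points.\<close>

lemma tendsto_exp_power:
  fixes z :: real
  assumes "\<bar>z\<bar> \<noteq> 1"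
  shows "(\<lambda>n. exp (- (z ^ (2 * n)))) \<longlonglongrightarrow> (if \<bar>z\<bar> < 1 then 1 else 0)"
proof (cases "\<bar>z\<bar> < 1")
  case True
  then have "norm (z\<^sup>2) < 1" by (simp add: abs_square_less_1)
  then have "(\<lambda>n. (z\<^sup>2) ^ n) \<longlonglongrightarrow> 0" by (rule LIMSEQ_power_zero)
  then have "(\<lambda>n. exp (- ((z\<^sup>2) ^ n))) \<longlonglongrightarrow> exp (- 0)" by (intro tendsto_exp tendsto_minus)
  then show ?thesis using True by (simp add: power_mult)
next
  case False
  then have z: "1 < z\<^sup>2" using assms one_less_power[of "\<bar>z\<bar>" 2] by simp
  have "(\<lambda>n. exp (- ((z\<^sup>2) ^ n))) \<longlonglongrightarrow> 0"
  proof (rule tendsto_sandwich[OF _ _ tendsto_const LIMSEQ_inverse_realpow_zero[OF z]])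
    have "exp (- ((z\<^sup>2) ^ n)) \<le> inverse ((z\<^sup>2) ^ n)" for n
    proof -
      have "0 < (z\<^sup>2) ^ n" using z by (intro zero_less_power less_trans[OF zero_less_one z])
      moreover have "(z\<^sup>2) ^ n \<le> exp ((z\<^sup>2) ^ n)" using exp_ge_add_one_self[of "(z\<^sup>2) ^ n"] by linarith
      ultimately show ?thesis unfolding exp_minus by (rule le_imp_inverse_le[rotated])
    qed
    then show "\<forall>\<^sub>F n in sequentially. exp (- ((z\<^sup>2) ^ n)) \<le> inverse ((z\<^sup>2) ^ n)" by simp
  qed simp
  then show ?thesis using False by (simp add: power_mult)
qed

text \<open>The Schwartz functions \<open>exp (- z ^ (2 * n) - x\<^sup>2)\<close>, with \<open>z\<close> the affine coordinate that maps an
  interval to \<open>(-1, 1)\<close>, converge to a Gaussian restricted to this interval.\<close>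

lemma mem_box_2d: "p \<in> box a b \<longleftrightarrow> fst a < fst p \<and> fst p < fst b \<and> snd a < snd p \<and> snd p < snd b"
  for a b p :: "real \<times> real"
  by (cases a; cases b; cases p) (auto simp: box_def Basis_prod_def)

text \<open>The difference \<open>f\<close> of the two transforms need not be integrable, but its
  product with the Gaussian \<gamma> is. Testing with the cutoffs \<psi> n, dominated by \<gamma>,
  and passing to the limit shows that this product integrates to 0 over every box; since \<gamma>
  has no zeros, \<open>f\<close> vanishes almost everywhere.\<close>

lemma has_fourier_unique:
  assumes g: "has_fourier L g" and h: "has_fourier L h"
  shows "AE \<zeta> in lborel. g \<zeta> = h \<zeta>"
proof -
  have [measurable]: "g \<in> borel_measurable borel" "h \<in> borel_measurable borel"
    using g h by (auto simp: has_fourier_def)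
  define f where "f = (\<lambda>\<zeta>. g \<zeta> - h \<zeta>)"
  have fb [measurable]: "f \<in> borel_measurable borel" unfolding f_def by measurable
  have f: "integrable lborel (\<lambda>\<zeta>. f \<zeta> * \<psi> \<zeta>)" "(\<integral>\<zeta>. f \<zeta> * \<psi> \<zeta> \<partial>lborel) = 0" if "\<psi> \<in> schwartz" for \<psi>
  proof -
    have "integrable lborel (\<lambda>\<zeta>. g \<zeta> * \<psi> \<zeta>)" "integrable lborel (\<lambda>\<zeta>. h \<zeta> * \<psi> \<zeta>)"
      "(\<integral>\<zeta>. g \<zeta> * \<psi> \<zeta> \<partial>lborel) = (\<integral>\<zeta>. h \<zeta> * \<psi> \<zeta> \<partial>lborel)"
      using g h that by (auto simp: has_fourier_def)
    then show "integrable lborel (\<lambda>\<zeta>. f \<zeta> * \<psi> \<zeta>)" "(\<integral>\<zeta>. f \<zeta> * \<psi> \<zeta> \<partial>lborel) = 0"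
      by (simp_all add: f_def left_diff_distrib)
  qed
  let ?G = "- ([:0, 1:]\<^sup>2) :: real poly"
  define \<gamma> where "\<gamma> = poly_exp2 1 ?G 1 ?G"
  have \<gamma>: "\<gamma> \<in> schwartz" unfolding \<gamma>_def by (rule poly_exp2_schwartz) auto
  have \<gamma>b [measurable]: "\<gamma> \<in> borel_measurable borel" by (rule schwartz_borel[OF \<gamma>])
  have \<gamma>0: "\<gamma> p \<noteq> 0" for p by (auto simp: \<gamma>_def poly_exp2_def poly_exp_def split_beta)
  have box: "(\<integral>\<zeta>. indicator (box a b) \<zeta> *\<^sub>R (f \<zeta> * \<gamma> \<zeta>) \<partial>lborel) = 0" for a b
  proof (cases "fst a < fst b \<and> snd a < snd b")
    case False
    then have "box a b = {}" by (auto simp: mem_box_2d)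
    then show ?thesis by simp
  next
    case True
    define L where "L a b = [: - (a + b) / (b - a), 2 / (b - a) :]" for a b :: real
    define B where "B a b n = ?G - L a b ^ (2 * n)" for a b n
    have B: "poly (B a b n) x \<le> - x\<^sup>2" for a b n x
      by (simp add: B_def poly_power power_mult power2_eq_square)
    define \<psi> where "\<psi> n = poly_exp2 1 (B (fst a) (fst b) n) 1 (B (snd a) (snd b) n)" for n
    have \<psi>: "\<psi> n \<in> schwartz" for n unfolding \<psi>_def by (rule poly_exp2_schwartz) (rule B)+
    let ?z = "\<lambda>a b x::real. poly (L a b) x"
    have z: "\<bar>?z a b x\<bar> < 1 \<longleftrightarrow> a < x \<and> x < b" "\<bar>?z a b x\<bar> = 1 \<longleftrightarrow> x = a \<or> x = b" if "a < b" for a b x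
    proof -
      have "?z a b x = (2 * x - (a + b)) / (b - a)" by (simp add: L_def diff_divide_distrib add_divide_distrib)
      then have "\<bar>?z a b x\<bar> = \<bar>2 * x - (a + b)\<bar> / (b - a)" using that by (simp add: abs_divide)
      then have "\<bar>?z a b x\<bar> < 1 \<longleftrightarrow> \<bar>2 * x - (a + b)\<bar> < b - a" "\<bar>?z a b x\<bar> = 1 \<longleftrightarrow> \<bar>2 * x - (a + b)\<bar> = b - a"
        using that by (auto simp: pos_divide_less_eq)
      then show "\<bar>?z a b x\<bar> < 1 \<longleftrightarrow> a < x \<and> x < b" "\<bar>?z a b x\<bar> = 1 \<longleftrightarrow> x = a \<or> x = b"
        using that by linarith+
    qed
    have t: "(\<lambda>n. exp (- (?z a b x ^ (2 * n)))) \<longlonglongrightarrow> (if a < x \<and> x < b then 1 else 0)"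
      if "a < b" "x \<noteq> a" "x \<noteq> b" for a b x
      using tendsto_exp_power[of "?z a b x"] that by (simp only: z simp_thms)
    have eq: "\<psi> n p = \<gamma> p * of_real (exp (- (?z (fst a) (fst b) (fst p) ^ (2 * n))) * exp (- (?z (snd a) (snd b) (snd p) ^ (2 * n))))" for n p
      by (simp add: \<psi>_def \<gamma>_def poly_exp2_def poly_exp_def B_def split_beta poly_power exp_diff exp_minus field_simps)
    have lim: "(\<lambda>n. f p * \<psi> n p) \<longlonglongrightarrow> indicator (box a b) p *\<^sub>R (f p * \<gamma> p)"
      if n: "fst p \<noteq> fst a" "fst p \<noteq> fst b" "snd p \<noteq> snd a" "snd p \<noteq> snd b" for p
    proof -
      have "(\<lambda>n. exp (- (?z (fst a) (fst b) (fst p) ^ (2 * n))) * exp (- (?z (snd a) (snd b) (snd p) ^ (2 * n))))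
        \<longlonglongrightarrow> (if fst a < fst p \<and> fst p < fst b then 1 else 0) * (if snd a < snd p \<and> snd p < snd b then 1 else 0)"
        using True n by (intro tendsto_mult t) auto
      also have "(if fst a < fst p \<and> fst p < fst b then 1 else 0) * (if snd a < snd p \<and> snd p < snd b then 1 else 0)
          = (indicator (box a b) p :: real)"
        by (simp add: mem_box_2d indicator_def)
      finally have "(\<lambda>n. exp (- (?z (fst a) (fst b) (fst p) ^ (2 * n))) * exp (- (?z (snd a) (snd b) (snd p) ^ (2 * n))))
        \<longlonglongrightarrow> indicator (box a b) p" .
      from tendsto_mult[OF tendsto_const tendsto_of_real[OF this], of "f p * \<gamma> p"] show ?thesis
        by (simp only: eq scaleR_conv_of_real mult_ac)
    qed
    have "(\<lambda>n. \<integral>p. f p * \<psi> n p \<partial>lborel) \<longlonglongrightarrow> (\<integral>p. indicator (box a b) p *\<^sub>R (f p * \<gamma> p) \<partial>lborel)"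
    proof (rule integral_dominated_convergence)
      show "integrable lborel (\<lambda>p. cmod (f p * \<gamma> p))" using f(1)[OF \<gamma>] by simp
      \<comment> \<open>Only on the lines through the sides of the box can an affine coordinate have
        modulus 1, and these lines are null sets.\<close>
      have nn: "AE p::real \<times> real in lborel. fst p \<noteq> k \<and> snd p \<noteq> l" for k l
        using AE_lborel_coordinate[of "(1, 0) :: real \<times> real" k] AE_lborel_coordinate[of "(0, 1) :: real \<times> real" l]
        by (auto simp: Basis_prod_def inner_prod_def)
      show "AE p in lborel. (\<lambda>n. f p * \<psi> n p) \<longlonglongrightarrow> indicator (box a b) p *\<^sub>R (f p * \<gamma> p)"
        using nn[of "fst a" "snd a"] nn[of "fst b" "snd b"] by eventually_elim (rule lim, auto)
      show "AE p in lborel. norm (f p * \<psi> n p) \<le> cmod (f p * \<gamma> p)" for n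
      proof (intro always_eventually allI)
        fix p
        have "exp (- (?z (fst a) (fst b) (fst p) ^ (2 * n))) * exp (- (?z (snd a) (snd b) (snd p) ^ (2 * n))) \<le> 1 * 1"
          by (intro mult_mono) (auto simp: power_mult)
        from mult_left_mono[OF this norm_ge_zero, of "f p * \<gamma> p"]
        show "norm (f p * \<psi> n p) \<le> cmod (f p * \<gamma> p)"
          unfolding eq norm_mult norm_of_real abs_mult abs_exp_cancel by (simp only: mult_1_right mult.assoc)
      qed
      show "(\<lambda>p. f p * \<psi> n p) \<in> borel_measurable lborel" for n
        using schwartz_borel[OF \<psi>[of n]] by measurable
    qed measurable
    then show ?thesis unfolding f(2)[OF \<psi>] by (simp add: LIMSEQ_const_iff)
  qed
  have "AE \<zeta> in lborel. Re (f \<zeta> * \<gamma> \<zeta>) = 0" "AE \<zeta> in lborel. Im (f \<zeta> * \<gamma> \<zeta>) = 0"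
  proof -
    have fi: "integrable lborel (\<lambda>\<zeta>. f \<zeta> * \<gamma> \<zeta>)" and f0: "(\<integral>\<zeta>. f \<zeta> * \<gamma> \<zeta> \<partial>lborel) = 0" using f[OF \<gamma>] .
    have bi: "integrable lborel (\<lambda>\<zeta>. indicator (box a b) \<zeta> *\<^sub>R (f \<zeta> * \<gamma> \<zeta>))" for a b
      by (rule integrable_mult_indicator[OF _ fi]) simp
    show "AE \<zeta> in lborel. Re (f \<zeta> * \<gamma> \<zeta>) = 0" "AE \<zeta> in lborel. Im (f \<zeta> * \<gamma> \<zeta>) = 0"
      using integral_Re[OF fi] integral_Im[OF fi] integral_Re[OF bi] integral_Im[OF bi] f0 box
      by (intro AE_zero_of_integral_boxes integrable_Re integrable_Im fi; simp)+
  qed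
  then show ?thesis
  proof eventually_elim
    case (elim \<zeta>)
    then have "f \<zeta> * \<gamma> \<zeta> = 0" by (simp add: complex_eq_iff)
    with \<gamma>0[of \<zeta>] show ?case by (simp add: f_def)
  qed
qed

section \<open>Operations on distributions in terms of their Fourier transforms\<close>

lemma has_fourier_cong_AE:
  assumes L: "has_fourier L g" and ae: "AE \<zeta> in lborel. g \<zeta> = h \<zeta>" and h: "h \<in> borel_measurable borel"
  shows "has_fourier L h"
proof -
  have gb: "g \<in> borel_measurable borel" using L by (simp add: has_fourier_def)
  have "integrable lborel (\<lambda>\<zeta>. h \<zeta> * \<psi> \<zeta>) \<and> (\<integral>\<zeta>. h \<zeta> * \<psi> \<zeta> \<partial>lborel) = (\<integral>\<zeta>. g \<zeta> * \<psi> \<zeta> \<partial>lborel)"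
    if p: "\<psi> \<in> schwartz" for \<psi>
  proof -
    have i: "integrable lborel (\<lambda>\<zeta>. g \<zeta> * \<psi> \<zeta>)" using L p by (simp add: has_fourier_def)
    have m: "(\<lambda>\<zeta>. h \<zeta> * \<psi> \<zeta>) \<in> borel_measurable lborel" "(\<lambda>\<zeta>. g \<zeta> * \<psi> \<zeta>) \<in> borel_measurable lborel"
      using h gb schwartz_borel[OF p] by auto
    have a: "AE \<zeta> in lborel. g \<zeta> * \<psi> \<zeta> = h \<zeta> * \<psi> \<zeta>" using ae by eventually_elim simp
    show ?thesis
      using integrable_cong_AE_imp[OF i m(1)] integral_cong_AE[OF m(2) m(1) a] a by simp
  qed
  then show ?thesis using L h by (auto simp: has_fourier_def)
qed

lemma hat_works: "has_fourier L g \<Longrightarrow> has_fourier L (hat L)"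
  unfolding hat_def by (rule someI[of "has_fourier L"])

lemma hat_AE: "has_fourier L g \<Longrightarrow> AE \<zeta> in lborel. hat L \<zeta> = g \<zeta>"
  by (rule has_fourier_unique[OF hat_works])

lemma hat_borel: "has_fourier L g \<Longrightarrow> hat L \<in> borel_measurable borel"
  using hat_works by (auto simp: has_fourier_def)

lemma has_fourier_add: "has_fourier L g \<Longrightarrow> has_fourier M h \<Longrightarrow> has_fourier (L + M) (\<lambda>\<zeta>. g \<zeta> + h \<zeta>)"
  by (auto simp: has_fourier_def plus_tdist.rep_eq distrib_right)

lemma has_fourier_scaleR: "has_fourier L g \<Longrightarrow> has_fourier (r *\<^sub>R L) (\<lambda>\<zeta>. of_real r * g \<zeta>)"
  by (auto simp: has_fourier_def scaleR_tdist.rep_eq scaleR_conv_of_real mult.assoc)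

lemma has_fourier_diff:
  assumes "has_fourier L g" "has_fourier M h"
  shows "has_fourier (L - M) (\<lambda>\<zeta>. g \<zeta> - h \<zeta>)"
  using has_fourier_add[OF assms(1) has_fourier_scaleR[OF assms(2), of "-1"]] by simp

text \<open>The derivative moves to \<open>fourier \<psi>\<close> with a minus sign, where it
  becomes multiplication of \<psi> by - \<i> \<xi>; the two signs combine to the multiplier \<i>
  \<xi>.\<close>

lemma has_fourier_dist_dx:
  assumes L: "has_fourier L g"
  shows "has_fourier (dist_dx L) (\<lambda>\<zeta>. \<i> * of_real (fst \<zeta>) * g \<zeta>)"
  unfolding has_fourier_def
proof (intro conjI ballI)
  show "(\<lambda>\<zeta>. \<i> * of_real (fst \<zeta>) * g \<zeta>) \<in> borel_measurable borel"
  proof (intro borel_measurable_times)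
    show "(\<lambda>\<zeta>::real \<times> real. complex_of_real (fst \<zeta>)) \<in> borel_measurable borel"
      by (intro borel_measurable_continuous_onI continuous_intros)
  qed (use L in \<open>auto simp: has_fourier_def\<close>)
  fix \<psi> assume p: "\<psi> \<in> schwartz"
  have m: "(\<lambda>p. - \<i> * mulx \<psi> p) \<in> schwartz" by (intro schwartz_scale schwartz_mulx p)
  have eq: "\<i> * of_real (fst \<zeta>) * g \<zeta> * \<psi> \<zeta> = - (g \<zeta> * (- \<i> * mulx \<psi> \<zeta>))" for \<zeta> by (simp add: mulx_def)
  show "integrable lborel (\<lambda>\<zeta>. \<i> * of_real (fst \<zeta>) * g \<zeta> * \<psi> \<zeta>)"
    unfolding eq using L m by (auto simp: has_fourier_def)
  have "pairing (dist_dx L) (fourier \<psi>) = - pairing L (fourier (\<lambda>p. - \<i> * mulx \<psi> p))"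
    using p by (simp only: dist_dx.rep_eq schwartz_fourier if_True dx_fourier)
  then show "pairing (dist_dx L) (fourier \<psi>) = (\<integral>\<zeta>. \<i> * of_real (fst \<zeta>) * g \<zeta> * \<psi> \<zeta> \<partial>lborel)"
    unfolding eq using L m by (simp add: has_fourier_def)
qed

text \<open>\<open>fourier_multiplier\<close> acts on the chosen representative
  \<open>hat L\<close>, which equals \<open>g\<close> only almost everywhere; integrability
  guarantees that the product is the transform of some distribution, so that \<open>of_hat\<close>
  is meaningful.\<close>

lemma has_fourier_multiplier:
  assumes L: "has_fourier L g" and m: "m \<in> borel_measurable borel" and i: "integrable lborel (\<lambda>\<zeta>. m \<zeta> * g \<zeta>)"
  shows "has_fourier (fourier_multiplier m L) (\<lambda>\<zeta>. m \<zeta> * g \<zeta>)"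
proof -
  have ae: "AE \<zeta> in lborel. m \<zeta> * g \<zeta> = m \<zeta> * hat L \<zeta>"
    using hat_AE[OF L] by eventually_elim simp
  have "has_fourier (dist_of (\<lambda>\<zeta>. m \<zeta> * g \<zeta>)) (\<lambda>\<zeta>. m \<zeta> * hat L \<zeta>)"
    by (rule has_fourier_cong_AE[OF has_fourier_dist_of[OF i] ae]) (rule borel_measurable_times[OF m hat_borel[OF L]])
  from of_hat_eq[OF this] show ?thesis
    unfolding fourier_multiplier_def using has_fourier_dist_of[OF i] by simp
qed

section \<open>The integral equation on the Fourier side\<close>

definition dispersion :: "real \<Rightarrow> real \<times> real \<Rightarrow> real" where
  "dispersion \<alpha> = (\<lambda>(\<xi>, \<eta>). \<xi> ^ 3 + sgn \<xi> * \<bar>\<xi>\<bar> powr \<alpha> * \<eta>\<^sup>2)"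

lemma borel_measurable_dispersion [measurable]: "dispersion \<alpha> \<in> borel_measurable borel"
proof -
  have [measurable]: "(\<lambda>x::real \<times> real. fst x) \<in> borel_measurable borel" "(\<lambda>x::real \<times> real. snd x) \<in> borel_measurable borel"
    by (auto intro!: borel_measurable_continuous_onI continuous_intros)
  show ?thesis unfolding dispersion_def split_beta' by measurable
qed

lemma borel_measurable_cis [measurable (raw)]:
  assumes "f \<in> borel_measurable M" shows "(\<lambda>x. cis (f x)) \<in> borel_measurable M"
  by (rule measurable_compose[OF assms]) (intro borel_measurable_continuous_onI continuous_intros)

section \<open>A majorant stable under convolution\<close>

definition decay :: "real \<times> real \<Rightarrow> real" where
  "decay \<zeta> = inverse ((1 + (norm \<zeta>)\<^sup>2)\<^sup>2)"

lemma decay_pos: "0 < decay \<zeta>"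
  unfolding decay_def by (intro positive_imp_inverse_positive zero_less_power one_plus_square_pos)

lemma borel_measurable_decay [measurable]: "decay \<in> borel_measurable borel"
  unfolding decay_def by measurable

lemma integrable_decay: "integrable lborel decay"
proof (rule Bochner_Integration.integrable_bound[OF integrable_inverse_squares])
  have "decay p \<le> (case p of (x, y) \<Rightarrow> inverse ((1 + x\<^sup>2) * (1 + y\<^sup>2)))" for p
  proof (cases p)
    case (Pair x y)
    have "(1 + x\<^sup>2) * (1 + y\<^sup>2) \<le> (1 + (x\<^sup>2 + y\<^sup>2)) * (1 + (x\<^sup>2 + y\<^sup>2))"
      by (intro mult_mono) auto
    then show ?thesis
      unfolding decay_def Pair prod.case
      by (intro le_imp_inverse_le mult_pos_pos one_plus_square_pos) (simp add: norm_Pair power2_eq_square[of "1 + _"])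
  qed
  then show "AE p in lborel. norm (decay p) \<le> norm (case p of (x, y) \<Rightarrow> inverse ((1 + x\<^sup>2) * (1 + y\<^sup>2)))"
    using less_imp_le[OF decay_pos] order_trans by (intro always_eventually allI) (fastforce simp: split_beta)
qed simp

text \<open>One of p, q is at least half as long as p + q, so one factor decays like
  \<open>decay (p + q)\<close> while the other stays available for integration. In numbers:
  \<open>C\<^sup>2\<close> is at most 8 times \<open>A\<^sup>2 + B\<^sup>2\<close>, divided by the
  product of the three squares.\<close>

lemma decay_mult: "decay p * decay q \<le> 8 * decay (p + q) * (decay p + decay q)"
proof -
  define A B C where "A = 1 + (norm p)\<^sup>2" and "B = 1 + (norm q)\<^sup>2" and "C = 1 + (norm (p + q))\<^sup>2"
  have pos: "0 < A" "0 < B" "0 < C" unfolding A_def B_def C_def by (rule one_plus_square_pos)+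
  have "(norm (p + q))\<^sup>2 \<le> (norm p + norm q)\<^sup>2"
    by (intro power_mono norm_triangle_ineq) simp
  also have "\<dots> \<le> 2 * (norm p)\<^sup>2 + 2 * (norm q)\<^sup>2"
    using sum_squares_bound[of "norm p" "norm q"] by (simp add: power2_sum)
  finally have "C \<le> 2 * (A + B)" unfolding A_def B_def C_def by simp
  then have "C\<^sup>2 \<le> (2 * (A + B))\<^sup>2" using pos by (intro power_mono) auto
  also have "\<dots> \<le> 8 * (A\<^sup>2 + B\<^sup>2)"
    using sum_squares_bound[of A B] by (simp add: power2_sum power_mult_distrib)
  finally have "C\<^sup>2 \<le> 8 * (A\<^sup>2 + B\<^sup>2)" .
  then have "C\<^sup>2 / (A\<^sup>2 * B\<^sup>2 * C\<^sup>2) \<le> 8 * (A\<^sup>2 + B\<^sup>2) / (A\<^sup>2 * B\<^sup>2 * C\<^sup>2)"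
    using pos by (intro divide_right_mono) auto
  then show ?thesis
    unfolding decay_def A_def[symmetric] B_def[symmetric] C_def[symmetric]
    using pos by (simp add: divide_simps)
qed

text \<open>The rate of decay in \<open>\<xi>\<close> decreases with time, so that integration in time gains the factor
  \<open>1 / \<xi>\<close> that compensates the derivative in the nonlinearity.\<close>

definition majorant :: "real \<Rightarrow> real \<Rightarrow> real \<times> real \<Rightarrow> real" where
  "majorant T t \<zeta> = (if 0 \<le> fst \<zeta> then decay \<zeta> * exp (- ((T + 1 - t) * fst \<zeta>) - \<bar>snd \<zeta>\<bar>) else 0)"

lemma majorant_nonneg: "0 \<le> majorant T t \<zeta>"
  by (simp add: majorant_def less_imp_le[OF decay_pos])

lemma majorant_mono: "s \<le> t \<Longrightarrow> majorant T s \<zeta> \<le> majorant T t \<zeta>"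
  by (auto simp: majorant_def less_imp_le[OF decay_pos] intro!: mult_left_mono mult_right_mono)

lemma majorant_le_decay: "t \<le> T \<Longrightarrow> majorant T t \<zeta> \<le> decay \<zeta>"
proof -
  assume "t \<le> T"
  then have "- ((T + 1 - t) * fst \<zeta>) - \<bar>snd \<zeta>\<bar> \<le> 0" if "0 \<le> fst \<zeta>"
    using mult_nonneg_nonneg[of "T + 1 - t" "fst \<zeta>"] that by linarith
  then show ?thesis
    by (auto simp: majorant_def less_imp_le[OF decay_pos] intro!: mult_left_le)
qed

text \<open>The exponent is linear in \<xi> and |\<eta>| is subadditive, so the exponentials
  multiply to at most the exponential at p + q; only the polynomial factors need
  \<open>decay_mult\<close>.\<close>

lemma majorant_mult:
  "majorant T t p * majorant T t q \<le> 8 * majorant T t (p + q) * (decay p + decay q)"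
proof (cases "0 \<le> fst p \<and> 0 \<le> fst q")
  case True
  let ?c = "T + 1 - t"
  have "exp (- (?c * fst p) - \<bar>snd p\<bar>) * exp (- (?c * fst q) - \<bar>snd q\<bar>) \<le> exp (- (?c * fst (p + q)) - \<bar>snd (p + q)\<bar>)"
    unfolding exp_add[symmetric] using abs_triangle_ineq[of "snd p" "snd q"] by (simp add: algebra_simps)
  then have "decay p * decay q * (exp (- (?c * fst p) - \<bar>snd p\<bar>) * exp (- (?c * fst q) - \<bar>snd q\<bar>))
    \<le> (8 * decay (p + q) * (decay p + decay q)) * exp (- (?c * fst (p + q)) - \<bar>snd (p + q)\<bar>)"
    by (intro mult_mono decay_mult) (auto intro!: mult_nonneg_nonneg add_nonneg_nonneg less_imp_le[OF decay_pos])
  moreover have "majorant T t p = decay p * exp (- (?c * fst p) - \<bar>snd p\<bar>)"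
    "majorant T t q = decay q * exp (- (?c * fst q) - \<bar>snd q\<bar>)"
    "majorant T t (p + q) = decay (p + q) * exp (- (?c * fst (p + q)) - \<bar>snd (p + q)\<bar>)"
    using True by (simp_all add: majorant_def)
  ultimately show ?thesis by (simp only: mult_ac)
next
  case False
  then have "majorant T t p * majorant T t q = 0" by (auto simp: majorant_def)
  then show ?thesis
    by (auto simp: majorant_nonneg less_imp_le[OF decay_pos] intro!: mult_nonneg_nonneg add_nonneg_nonneg)
qed

definition conv :: "(real \<times> real \<Rightarrow> complex) \<Rightarrow> (real \<times> real \<Rightarrow> complex) \<Rightarrow> real \<times> real \<Rightarrow> complex" where
  "conv f g \<zeta> = (\<integral>\<zeta>'. f (\<zeta> - \<zeta>') * g \<zeta>' \<partial>lborel)"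

text \<open>The factor 8 of \<open>decay_mult\<close>, doubled because the two terms
  \<open>decay (\<zeta> - \<zeta>')\<close> and \<open>decay \<zeta>'\<close> have the same
  integral.\<close>

definition conv_const :: real where
  "conv_const = 16 * (\<integral>\<zeta>. decay \<zeta> \<partial>lborel)"

lemma conv_const_nonneg: "0 \<le> conv_const"
  unfolding conv_const_def by (intro mult_nonneg_nonneg Bochner_Integration.integral_nonneg less_imp_le[OF decay_pos]) simp

lemma conv_bound:
  assumes [measurable]: "f \<in> borel_measurable borel" "g \<in> borel_measurable borel"
    and f: "\<And>\<zeta>. cmod (f \<zeta>) \<le> A * majorant T t \<zeta>" and g: "\<And>\<zeta>. cmod (g \<zeta>) \<le> B * majorant T t \<zeta>"
    and A: "0 \<le> A" and B: "0 \<le> B"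
  shows "integrable lborel (\<lambda>\<zeta>'. f (\<zeta> - \<zeta>') * g \<zeta>')"
    and "cmod (conv f g \<zeta>) \<le> A * B * conv_const * majorant T t \<zeta>"
proof -
  let ?h = "\<lambda>\<zeta>'. A * B * (8 * majorant T t \<zeta>) * (decay (\<zeta> - \<zeta>') + decay \<zeta>')"
  have d: "integrable lborel (\<lambda>\<zeta>'. decay (\<zeta> - \<zeta>'))" by (simp add: lborel_integrable_reflect integrable_decay)
  have h: "integrable lborel ?h"
    by (intro integrable_mult_right Bochner_Integration.integrable_add integrable_decay d)
  have le: "cmod (f (\<zeta> - \<zeta>') * g \<zeta>') \<le> ?h \<zeta>'" for \<zeta>'
  proof -
    have "cmod (f (\<zeta> - \<zeta>') * g \<zeta>') \<le> (A * majorant T t (\<zeta> - \<zeta>')) * (B * majorant T t \<zeta>')"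
      unfolding norm_mult by (intro mult_mono f g mult_nonneg_nonneg A majorant_nonneg norm_ge_zero)
    also have "\<dots> = A * B * (majorant T t (\<zeta> - \<zeta>') * majorant T t \<zeta>')" by simp
    also have "\<dots> \<le> A * B * (8 * majorant T t (\<zeta> - \<zeta>' + \<zeta>') * (decay (\<zeta> - \<zeta>') + decay \<zeta>'))"
      by (intro mult_left_mono majorant_mult mult_nonneg_nonneg A B)
    finally show ?thesis by (simp add: mult.assoc)
  qed
  show i: "integrable lborel (\<lambda>\<zeta>'. f (\<zeta> - \<zeta>') * g \<zeta>')"
  proof (rule Bochner_Integration.integrable_bound[OF h])
    show "AE \<zeta>' in lborel. norm (f (\<zeta> - \<zeta>') * g \<zeta>') \<le> norm (?h \<zeta>')"
      unfolding real_norm_def by (intro always_eventually allI order_trans[OF le abs_ge_self])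
  qed measurable
  have "cmod (conv f g \<zeta>) \<le> (\<integral>\<zeta>'. ?h \<zeta>' \<partial>lborel)"
    unfolding conv_def by (rule Bochner_Integration.integral_norm_bound_integral[OF i h]) (rule le)
  also have "\<dots> = A * B * (8 * majorant T t \<zeta>) * ((\<integral>\<zeta>'. decay (\<zeta> - \<zeta>') \<partial>lborel) + (\<integral>\<zeta>'. decay \<zeta>' \<partial>lborel))"
    using d integrable_decay by simp
  also have "\<dots> = A * B * conv_const * majorant T t \<zeta>"
    by (simp add: lborel_integral_reflect conv_const_def)
  finally show "cmod (conv f g \<zeta>) \<le> A * B * conv_const * majorant T t \<zeta>" .
qed

section \<open>The Duhamel operator on the Fourier side\<close>

lemma measurable_uncurry:
  assumes "case_prod U \<in> borel_measurable (borel \<Otimes>\<^sub>M borel)"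
    and "f \<in> borel_measurable M" "g \<in> borel_measurable M"
  shows "(\<lambda>x. U (f x) (g x)) \<in> borel_measurable M"
  using measurable_compose[OF measurable_Pair[OF assms(2,3)] assms(1)] by simp

lemma measurable_conv:
  assumes U: "case_prod U \<in> borel_measurable (borel \<Otimes>\<^sub>M borel)" and V: "case_prod V \<in> borel_measurable (borel \<Otimes>\<^sub>M borel)"
  shows "(\<lambda>(s::real, \<zeta>). conv (U s) (V s) \<zeta>) \<in> borel_measurable (borel \<Otimes>\<^sub>M borel)"
proof -
  have "(\<lambda>(x, \<zeta>'). U (fst x) (snd x - \<zeta>') * V (fst x) \<zeta>') \<in> borel_measurable ((borel \<Otimes>\<^sub>M borel) \<Otimes>\<^sub>M lborel)"
    unfolding split_beta'
    by (intro borel_measurable_times measurable_uncurry[OF U] measurable_uncurry[OF V]) measurable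
  from sigma_finite_measure.borel_measurable_lebesgue_integral[OF lborel.sigma_finite_measure_axioms this]
  show ?thesis unfolding conv_def split_beta' .
qed

text \<open>The Duhamel integral with the outer phase
  \<open>cis (- (t * dispersion \<alpha> \<zeta>))\<close> taken out. The prefactor collects \<i>
  \<xi> / 2 from writing the nonlinearity as half the derivative of the square, and the
  normalisation of the convolution.\<close>

definition duhamel :: "real \<Rightarrow> (real \<Rightarrow> real \<times> real \<Rightarrow> complex) \<Rightarrow> (real \<Rightarrow> real \<times> real \<Rightarrow> complex) \<Rightarrow> real \<Rightarrow> real \<times> real \<Rightarrow> complex" where
  "duhamel \<alpha> U V t \<zeta> = \<i> * of_real (fst \<zeta> / (2 * (2 * pi)\<^sup>2)) *
     (LINT s:{0..t}|lborel. cis (s * dispersion \<alpha> \<zeta>) * conv (U s) (V s) \<zeta>)"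

lemma measurable_duhamel:
  assumes U: "case_prod U \<in> borel_measurable (borel \<Otimes>\<^sub>M borel)" and V: "case_prod V \<in> borel_measurable (borel \<Otimes>\<^sub>M borel)"
  shows "(\<lambda>(t, \<zeta>). duhamel \<alpha> U V t \<zeta>) \<in> borel_measurable (borel \<Otimes>\<^sub>M borel)"
proof -
  have i: "(\<lambda>x. indicat_real {0..fst (fst x)} (snd x)) \<in> borel_measurable (((borel :: real measure) \<Otimes>\<^sub>M (borel :: (real \<times> real) measure)) \<Otimes>\<^sub>M lborel)"
  proof -
    have eq: "(\<lambda>x. indicat_real {0..fst (fst x)} (snd x)) = indicator {x :: (real \<times> real \<times> real) \<times> real. 0 \<le> snd x \<and> snd x \<le> fst (fst x)}"
      by (auto simp: indicator_def fun_eq_iff)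
    have "{x \<in> space ((borel \<Otimes>\<^sub>M borel) \<Otimes>\<^sub>M lborel). 0 \<le> snd x \<and> snd x \<le> fst (fst x)} \<in> sets (((borel :: real measure) \<Otimes>\<^sub>M (borel :: (real \<times> real) measure)) \<Otimes>\<^sub>M lborel)"
      by measurable
    then have "{x. 0 \<le> snd x \<and> snd x \<le> fst (fst x)} \<in> sets (((borel :: real measure) \<Otimes>\<^sub>M (borel :: (real \<times> real) measure)) \<Otimes>\<^sub>M lborel)"
      by (simp add: space_pair_measure)
    then show ?thesis unfolding eq by (rule borel_measurable_indicator)
  qed
  have "(\<lambda>(x, s). indicat_real {0..fst x} s *\<^sub>R (cis (s * dispersion \<alpha> (snd x)) * conv (U s) (V s) (snd x)))
      \<in> borel_measurable ((borel \<Otimes>\<^sub>M borel) \<Otimes>\<^sub>M lborel)"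
    unfolding split_beta'
    by (intro borel_measurable_scaleR i borel_measurable_times borel_measurable_cis measurable_uncurry[OF measurable_conv[OF U V]]) measurable
  from sigma_finite_measure.borel_measurable_lebesgue_integral[OF lborel.sigma_finite_measure_axioms this]
  have "(\<lambda>x. LINT s:{0..fst x}|lborel. cis (s * dispersion \<alpha> (snd x)) * conv (U s) (V s) (snd x)) \<in> borel_measurable (borel \<Otimes>\<^sub>M borel)"
    unfolding set_lebesgue_integral_def .
  moreover have "(\<lambda>x. of_real (fst (snd x) / (2 * (2 * pi)\<^sup>2)) :: complex) \<in> borel_measurable ((borel :: real measure) \<Otimes>\<^sub>M (borel :: (real \<times> real) measure))"
    unfolding borel_prod by (intro borel_measurable_continuous_onI continuous_intros) auto
  ultimately show ?thesis
    unfolding duhamel_def split_beta' by (intro borel_measurable_times) auto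
qed

text \<open>Stated without division by x, so that x = 0 is included.\<close>

lemma exp_time_integral:
  fixes t x :: real
  assumes "0 \<le> t"
  shows "integrable lborel (\<lambda>s. indicator {0..t} s *\<^sub>R exp (s * x))"
    and "x * (\<integral>s. indicator {0..t} s *\<^sub>R exp (s * x) \<partial>lborel) = exp (t * x) - 1"
proof -
  show i: "integrable lborel (\<lambda>s. indicator {0..t} s *\<^sub>R exp (s * x))"
    by (rule borel_integrable_compact) (auto intro!: continuous_intros)
  have "(\<integral>s. (x * exp (s * x)) * indicator {0..t} s \<partial>lborel) = exp (t * x) - exp (0 * x)"
    by (rule integral_FTC_Icc_real[OF assms]) (auto intro!: derivative_eq_intros continuous_intros)
  then show "x * (\<integral>s. indicator {0..t} s *\<^sub>R exp (s * x) \<partial>lborel) = exp (t * x) - 1"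
    by (simp add: mult_ac flip: integral_mult_right_zero)
qed

text \<open>As a function of time the majorant is a constant times e^(s \<xi>), whose integral times
  \<xi> is at most its value at t. The constant does not grow with t or T, so a long time interval
  costs nothing here.\<close>

lemma time_integral_bound:
  assumes h [measurable]: "h \<in> borel_measurable borel" and t: "0 \<le> t" 
    and b: "\<And>s. 0 \<le> s \<Longrightarrow> s \<le> t \<Longrightarrow> cmod (h s) \<le> A * majorant T s \<zeta>" and A: "0 \<le> A"
  shows "set_integrable lborel {0..t} h"
    and "\<bar>fst \<zeta>\<bar> * cmod (LINT s:{0..t}|lborel. h s) \<le> A * majorant T t \<zeta>"
proof -
  let ?c = "A * (if 0 \<le> fst \<zeta> then decay \<zeta> * exp (- ((T + 1) * fst \<zeta>) - \<bar>snd \<zeta>\<bar>) else 0)"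
  let ?k = "\<lambda>s. ?c * (indicator {0..t} s *\<^sub>R exp (s * fst \<zeta>))"
  have eq: "A * majorant T s \<zeta> = ?c * exp (s * fst \<zeta>)" for s
    by (simp add: majorant_def algebra_simps flip: exp_add)
  have k: "integrable lborel ?k" by (intro integrable_mult_right exp_time_integral t)
  have le: "cmod (indicator {0..t} s *\<^sub>R h s) \<le> ?k s" for s
    using b[of s] by (simp only: eq) (auto simp: indicator_def)
  show i: "set_integrable lborel {0..t} h"
    unfolding set_integrable_def
  proof (rule Bochner_Integration.integrable_bound[OF k])
    show "AE s in lborel. norm (indicator {0..t} s *\<^sub>R h s) \<le> norm (?k s)"
      unfolding real_norm_def by (intro always_eventually allI order_trans[OF le abs_ge_self])
  qed measurable
  have "cmod (LINT s:{0..t}|lborel. h s) \<le> (\<integral>s. ?k s \<partial>lborel)"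
    unfolding set_lebesgue_integral_def
    by (rule Bochner_Integration.integral_norm_bound_integral[OF i[unfolded set_integrable_def] k]) (rule le)
  then have "\<bar>fst \<zeta>\<bar> * cmod (LINT s:{0..t}|lborel. h s) \<le> \<bar>fst \<zeta>\<bar> * (?c * (\<integral>s. indicator {0..t} s *\<^sub>R exp (s * fst \<zeta>) \<partial>lborel))"
    by (intro mult_left_mono) simp_all
  also have "\<dots> = ?c * (fst \<zeta> * (\<integral>s. indicator {0..t} s *\<^sub>R exp (s * fst \<zeta>) \<partial>lborel))"
    by simp
  also have "\<dots> = ?c * (exp (t * fst \<zeta>) - 1)"
    by (simp only: exp_time_integral(2)[OF t])
  also have "\<dots> \<le> ?c * exp (t * fst \<zeta>)"
    using A by (intro mult_left_mono) (auto intro!: mult_nonneg_nonneg less_imp_le[OF decay_pos])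
  finally show "\<bar>fst \<zeta>\<bar> * cmod (LINT s:{0..t}|lborel. h s) \<le> A * majorant T t \<zeta>"
    by (simp only: eq)
qed

text \<open>Despite the derivative, the bilinear term obeys the same majorant at the same time; this
  closes the iteration. The prefactor \<open>1 / (2 * (2 * pi)\<^sup>2)\<close> is estimated by
  1.\<close>

lemma duhamel_bound:
  assumes U: "case_prod U \<in> borel_measurable (borel \<Otimes>\<^sub>M borel)" and V: "case_prod V \<in> borel_measurable (borel \<Otimes>\<^sub>M borel)"
    and A: "0 \<le> A" and B: "0 \<le> B" and t: "t \<in> {0..T}"
    and bU: "\<And>s \<zeta>. s \<in> {0..T} \<Longrightarrow> cmod (U s \<zeta>) \<le> A * majorant T s \<zeta>"
    and bV: "\<And>s \<zeta>. s \<in> {0..T} \<Longrightarrow> cmod (V s \<zeta>) \<le> B * majorant T s \<zeta>"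
  shows "set_integrable lborel {0..t} (\<lambda>s. cis (s * dispersion \<alpha> \<zeta>) * conv (U s) (V s) \<zeta>)"
    and "cmod (duhamel \<alpha> U V t \<zeta>) \<le> A * B * conv_const * majorant T t \<zeta>"
proof -
  have m: "U s \<in> borel_measurable borel" "V s \<in> borel_measurable borel" for s
    using measurable_uncurry[OF U measurable_const measurable_ident_sets] measurable_uncurry[OF V measurable_const measurable_ident_sets] by auto
  let ?h = "\<lambda>s. cis (s * dispersion \<alpha> \<zeta>) * conv (U s) (V s) \<zeta>"
  have h: "?h \<in> borel_measurable borel"
    by (intro borel_measurable_times borel_measurable_cis measurable_uncurry[OF measurable_conv[OF U V]]) measurable
  have b: "cmod (?h s) \<le> A * B * conv_const * majorant T s \<zeta>" if "0 \<le> s" "s \<le> t" for s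
    unfolding norm_mult norm_cis using conv_bound(2)[OF m bU bV A B, of s] that t by simp
  have AB: "0 \<le> A * B * conv_const" by (intro mult_nonneg_nonneg A B conv_const_nonneg)
  show "set_integrable lborel {0..t} ?h"
    using t by (intro time_integral_bound(1)[OF h _ b AB]) auto
  have "cmod (duhamel \<alpha> U V t \<zeta>) = (\<bar>fst \<zeta>\<bar> * cmod (LINT s:{0..t}|lborel. ?h s)) * (1 / (2 * (2 * pi)\<^sup>2))"
    by (simp add: duhamel_def norm_mult norm_divide norm_power)
  also have "\<dots> \<le> (A * B * conv_const * majorant T t \<zeta>) * 1"
  proof (rule mult_mono)
    show "\<bar>fst \<zeta>\<bar> * cmod (LINT s:{0..t}|lborel. ?h s) \<le> A * B * conv_const * majorant T t \<zeta>"
      using t by (intro time_integral_bound(2)[OF h _ b AB]) auto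
    have "1 * 1 \<le> (2 * pi) * (2 * pi)" using pi_ge_two by (intro mult_mono) auto
    then show "1 / (2 * (2 * pi)\<^sup>2) \<le> 1" by (simp add: power2_eq_square)
  qed (use t AB in \<open>auto intro!: mult_nonneg_nonneg majorant_nonneg\<close>)
  finally show "cmod (duhamel \<alpha> U V t \<zeta>) \<le> A * B * conv_const * majorant T t \<zeta>" by simp
qed

text \<open>If p and \<zeta> - p both have first coordinate at least a and their sum stays below b +
  a, each stays below b. The convolution at \<zeta> therefore only sees lower frequencies.\<close>

lemma conv_cong_below:
  assumes f: "\<And>p. fst p < a \<Longrightarrow> f p = 0" and g: "\<And>p. fst p < a \<Longrightarrow> g p = 0"
    and eq: "\<And>p. fst p < b \<Longrightarrow> f p = g p" and \<zeta>: "fst \<zeta> < b + a"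
  shows "conv f f \<zeta> = conv g g \<zeta>"
  unfolding conv_def
proof (rule Bochner_Integration.integral_cong)
  fix p
  show "f (\<zeta> - p) * f p = g (\<zeta> - p) * g p"
  proof (cases "fst p < a \<or> fst (\<zeta> - p) < a")
    case True
    then show ?thesis by (elim disjE) (simp_all add: f g)
  next
    case False
    then have "fst p < b" "fst (\<zeta> - p) < b" using \<zeta> by auto
    then show ?thesis using eq by simp
  qed
qed simp

section \<open>Picard iteration\<close>

fun picard :: "real \<Rightarrow> (real \<times> real \<Rightarrow> complex) \<Rightarrow> nat \<Rightarrow> real \<Rightarrow> real \<times> real \<Rightarrow> complex" where
  "picard \<alpha> g 0 t \<zeta> = 0"
| "picard \<alpha> g (Suc m) t \<zeta> = cis (- (t * dispersion \<alpha> \<zeta>)) * (g \<zeta> + duhamel \<alpha> (picard \<alpha> g m) (picard \<alpha> g m) t \<zeta>)"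

lemma measurable_picard:
  assumes g: "g \<in> borel_measurable borel"
  shows "case_prod (picard \<alpha> g m) \<in> borel_measurable (borel \<Otimes>\<^sub>M borel)"
proof (induction m)
  case (Suc m)
  have "(\<lambda>x. cis (- (fst x * dispersion \<alpha> (snd x))) * (g (snd x) + duhamel \<alpha> (picard \<alpha> g m) (picard \<alpha> g m) (fst x) (snd x)))
      \<in> borel_measurable (borel \<Otimes>\<^sub>M borel)"
    by (intro borel_measurable_times borel_measurable_add borel_measurable_cis borel_measurable_uminus
        measurable_compose[OF measurable_snd g] measurable_compose[OF measurable_snd borel_measurable_dispersion]
        measurable_uncurry[OF measurable_duhamel[OF Suc Suc]] measurable_fst measurable_snd)
  then show ?case by (simp add: split_beta')
qed simp

lemma picard_support:
  assumes g: "\<And>p. fst p < a \<Longrightarrow> g p = 0" and a: "0 < a" and \<zeta>: "fst \<zeta> < a"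
  shows "picard \<alpha> g m t \<zeta> = 0"
  using \<zeta>
proof (induction m arbitrary: t \<zeta>)
  case (Suc m)
  have "conv (picard \<alpha> g m s) (picard \<alpha> g m s) \<zeta> = conv (\<lambda>_. 0) (\<lambda>_. 0) \<zeta>" for s
    by (rule conv_cong_below[where a=a and b=a]) (use Suc a in auto)
  then show ?case using g Suc.prems by (simp add: duhamel_def conv_def)
qed simp

text \<open>Induction on the step: below (m + 2) a the quadratic term only involves iterates below
  (m + 1) a, where they already agree; below a all iterates vanish.\<close>

lemma picard_stable:
  assumes g: "\<And>p. fst p < a \<Longrightarrow> g p = 0" and a: "0 < a" and \<zeta>: "fst \<zeta> < of_nat (Suc m) * a"
  shows "picard \<alpha> g (Suc m) t \<zeta> = picard \<alpha> g m t \<zeta>"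
  using \<zeta>
proof (induction m arbitrary: t \<zeta>)
  case 0
  then have "fst \<zeta> < a" by simp
  from picard_support[OF g a this] show ?case by (simp only:)
next
  case (Suc m)
  have "conv (picard \<alpha> g (Suc m) s) (picard \<alpha> g (Suc m) s) \<zeta> = conv (picard \<alpha> g m s) (picard \<alpha> g m s) \<zeta>" for s
  proof (rule conv_cong_below[where a=a and b="of_nat (Suc m) * a"])
    show "picard \<alpha> g (Suc m) s p = 0" if "fst p < a" for p by (rule picard_support[OF g a that])
    show "picard \<alpha> g m s p = 0" if "fst p < a" for p by (rule picard_support[OF g a that])
    show "picard \<alpha> g (Suc m) s p = picard \<alpha> g m s p" if "fst p < of_nat (Suc m) * a" for p by (rule Suc.IH[OF that])
    show "fst \<zeta> < of_nat (Suc m) * a + a" using Suc.prems by (simp add: algebra_simps)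
  qed
  then show ?case by (simp only: picard.simps(2) duhamel_def)
qed

lemma picard_eq:
  assumes g: "\<And>p. fst p < a \<Longrightarrow> g p = 0" and a: "0 < a" and \<zeta>: "fst \<zeta> < of_nat (Suc m) * a" and "m \<le> n"
  shows "picard \<alpha> g n t \<zeta> = picard \<alpha> g m t \<zeta>"
  using \<open>m \<le> n\<close>
proof (induction n rule: dec_induct)
  case (step n)
  have "of_nat (Suc m) * a \<le> of_nat (Suc n) * a" using step a by (intro mult_right_mono) auto
  then have "fst \<zeta> < of_nat (Suc n) * a" using \<zeta> by linarith
  from picard_stable[OF g a this] step show ?case by (simp del: picard.simps)
qed simp

text \<open>The ball of radius \<delta> is mapped to itself: the data take up \<delta> / 2, and the
  quadratic term at most \<open>\<delta> * \<delta> * conv_const\<close>, again at most \<delta> /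
  2. Convergence comes from the supports, not from a contraction.\<close>

lemma picard_bound:
  assumes g: "g \<in> borel_measurable borel" "\<And>p. cmod (g p) \<le> \<delta> / 2 * majorant T 0 p"
    and \<delta>: "0 \<le> \<delta>" "\<delta> * conv_const \<le> 1 / 2" and t: "t \<in> {0..T}"
  shows "cmod (picard \<alpha> g m t \<zeta>) \<le> \<delta> * majorant T t \<zeta>"
  using t
proof (induction m arbitrary: t \<zeta>)
  case 0
  then show ?case using \<delta> by (simp add: majorant_nonneg)
next
  case (Suc m)
  note P = measurable_picard[OF g(1), of \<alpha> m]
  have "cmod (picard \<alpha> g (Suc m) t \<zeta>) \<le> cmod (g \<zeta>) + cmod (duhamel \<alpha> (picard \<alpha> g m) (picard \<alpha> g m) t \<zeta>)"
    by (simp add: norm_mult norm_triangle_ineq)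
  also have "\<dots> \<le> \<delta> / 2 * majorant T t \<zeta> + \<delta> / 2 * majorant T t \<zeta>"
  proof (rule add_mono)
    show "cmod (g \<zeta>) \<le> \<delta> / 2 * majorant T t \<zeta>"
      using Suc.prems \<delta> by (intro order_trans[OF g(2)] mult_left_mono majorant_mono) auto
    have "cmod (duhamel \<alpha> (picard \<alpha> g m) (picard \<alpha> g m) t \<zeta>) \<le> \<delta> * \<delta> * conv_const * majorant T t \<zeta>"
      by (rule duhamel_bound(2)[OF P P \<delta>(1) \<delta>(1) Suc.prems Suc.IH Suc.IH])
    also have "\<dots> \<le> \<delta> / 2 * majorant T t \<zeta>"
      using mult_left_mono[OF \<delta>(2,1)] by (intro mult_right_mono majorant_nonneg) (simp add: mult_ac)
    finally show "cmod (duhamel \<alpha> (picard \<alpha> g m) (picard \<alpha> g m) t \<zeta>) \<le> \<delta> / 2 * majorant T t \<zeta>" .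
  qed
  finally show ?case by simp
qed

text \<open>Below \<open>\<xi> = (m + 1) a\<close> the Picard iteration is stationary from its \<open>m\<close>-th step on, because all
  iterates are supported in \<open>\<xi> \<ge> a\<close>.\<close>

lemma integral_equation_solution:
  assumes g: "g \<in> borel_measurable borel" "\<And>p. cmod (g p) \<le> \<delta> / 2 * majorant T 0 p"
    and \<delta>: "0 \<le> \<delta>" "\<delta> * conv_const \<le> 1 / 2"
    and supp: "\<And>p. fst p < a \<Longrightarrow> g p = 0" and a: "0 < a"
  obtains U where "case_prod U \<in> borel_measurable (borel \<Otimes>\<^sub>M borel)"
    and "\<And>t \<zeta>. t \<in> {0..T} \<Longrightarrow> cmod (U t \<zeta>) \<le> \<delta> * majorant T t \<zeta>"
    and "\<And>t \<zeta>. U t \<zeta> = cis (- (t * dispersion \<alpha> \<zeta>)) * (g \<zeta> + duhamel \<alpha> U U t \<zeta>)"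
proof
  let ?N = "\<lambda>\<zeta>::real \<times> real. nat \<lfloor>fst \<zeta> / a\<rfloor>"
  \<comment> \<open>At frequency \<zeta> the iteration is stopped at the least m with \<xi> < (m +
    1) a; for negative \<xi> the conversion by \<open>nat\<close> gives m = 0, where the iterate is
    0.\<close>
  define U where "U t \<zeta> = picard \<alpha> g (?N \<zeta>) t \<zeta>" for t \<zeta>
  have N: "fst \<zeta> < of_nat (Suc (?N \<zeta>)) * a" for \<zeta>
  proof -
    have "fst \<zeta> / a < of_nat (Suc (?N \<zeta>))" by linarith
    then show ?thesis using a by (simp add: pos_divide_less_eq)
  qed
  have eq: "U t \<zeta> = picard \<alpha> g m t \<zeta>" if "fst \<zeta> < of_nat (Suc m) * a" for t \<zeta> m
  proof -
    have "picard \<alpha> g (max m (?N \<zeta>)) t \<zeta> = picard \<alpha> g m t \<zeta>"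
      by (rule picard_eq[OF supp a that]) auto
    moreover have "picard \<alpha> g (max m (?N \<zeta>)) t \<zeta> = picard \<alpha> g (?N \<zeta>) t \<zeta>"
      by (rule picard_eq[OF supp a N]) auto
    ultimately show ?thesis by (simp add: U_def)
  qed
  show "case_prod U \<in> borel_measurable (borel \<Otimes>\<^sub>M borel)"
  proof -
    \<comment> \<open>\<open>U\<close> is patched together from countably many jointly measurable
      iterates, selected by a measurable index.\<close>
    have "(\<lambda>x. (case_prod (picard \<alpha> g (?N (snd x)))) x) \<in> borel_measurable (borel \<Otimes>\<^sub>M borel)"
    proof (rule measurable_compose_countable[where g="\<lambda>x. ?N (snd x)"])
      show "case_prod (picard \<alpha> g i) \<in> borel_measurable (borel \<Otimes>\<^sub>M borel)" for i by (rule measurable_picard[OF g(1)])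
      have "(\<lambda>x::real \<times> real. fst x) \<in> borel_measurable borel"
        by (auto intro!: borel_measurable_continuous_onI continuous_intros)
      from measurable_compose[OF measurable_snd this]
      have "(\<lambda>x. fst (snd x)) \<in> borel_measurable (borel \<Otimes>\<^sub>M (borel :: (real \<times> real) measure))" for M :: "real measure" .
      then show "(\<lambda>x. ?N (snd x)) \<in> measurable (borel \<Otimes>\<^sub>M borel) (count_space UNIV)" by measurable
    qed
    then show ?thesis by (simp add: U_def split_beta')
  qed
  show "cmod (U t \<zeta>) \<le> \<delta> * majorant T t \<zeta>" if "t \<in> {0..T}" for t \<zeta>
    unfolding U_def by (rule picard_bound[OF g \<delta> that])
  show "U t \<zeta> = cis (- (t * dispersion \<alpha> \<zeta>)) * (g \<zeta> + duhamel \<alpha> U U t \<zeta>)" for t \<zeta>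
  proof -
    let ?m = "?N \<zeta>"
    have "conv (U s) (U s) \<zeta> = conv (picard \<alpha> g ?m s) (picard \<alpha> g ?m s) \<zeta>" for s
    proof (rule conv_cong_below[where a=a and b="of_nat ?m * a"])
      show "U s p = 0" if "fst p < a" for p unfolding U_def by (rule picard_support[OF supp a that])
      show "picard \<alpha> g ?m s p = 0" if "fst p < a" for p by (rule picard_support[OF supp a that])
      show "U s p = picard \<alpha> g ?m s p" if "fst p < of_nat ?m * a" for p
        using that a by (intro eq) (simp add: algebra_simps)
      show "fst \<zeta> < of_nat ?m * a + a" using N[of \<zeta>] by (simp add: algebra_simps)
    qed
    then have "duhamel \<alpha> U U t \<zeta> = duhamel \<alpha> (picard \<alpha> g ?m) (picard \<alpha> g ?m) t \<zeta>"
      by (simp add: duhamel_def)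
    moreover have "U t \<zeta> = picard \<alpha> g (Suc ?m) t \<zeta>"
      using picard_stable[OF supp a N] by (simp only: U_def)
    ultimately show ?thesis by simp
  qed
qed

section \<open>Solutions of the Cauchy problem\<close>

lemma W_eq: "W \<alpha> t = fourier_multiplier (\<lambda>\<zeta>. cis (- (t * dispersion \<alpha> \<zeta>)))"
  unfolding W_def dispersion_def by (intro arg_cong[where f=fourier_multiplier]) (auto simp: fun_eq_iff)

lemma has_fourier_W:
  assumes L: "has_fourier L g" and g: "integrable lborel g"
  shows "has_fourier (W \<alpha> t L) (\<lambda>\<zeta>. cis (- (t * dispersion \<alpha> \<zeta>)) * g \<zeta>)"
  unfolding W_eq
  by (intro has_fourier_multiplier[OF L] integrable_cis_mult[OF g] borel_measurable_cis) measurable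

text \<open>Representatives differ on null sets, and reflection preserves these; so the choice made
  by \<open>hat\<close> does not influence the convolution at any \<zeta>, not merely at almost
  every one.\<close>

lemma conv_hat:
  assumes f: "has_fourier L f" and g: "has_fourier M g"
  shows "hat_convolution L M \<zeta> = conv f g \<zeta> / of_real ((2 * pi)\<^sup>2)"
    and "integrable lborel (\<lambda>\<zeta>'. hat L (\<zeta> - \<zeta>') * hat M \<zeta>') \<longleftrightarrow> integrable lborel (\<lambda>\<zeta>'. f (\<zeta> - \<zeta>') * g \<zeta>')"
proof -
  have [measurable]: "f \<in> borel_measurable borel" "g \<in> borel_measurable borel"
    "hat L \<in> borel_measurable borel" "hat M \<in> borel_measurable borel"
    using f g hat_borel[OF f] hat_borel[OF g] by (auto simp: has_fourier_def)
  have ae: "AE \<zeta>' in lborel. hat L (\<zeta> - \<zeta>') * hat M \<zeta>' = f (\<zeta> - \<zeta>') * g \<zeta>'"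
    using lborel_AE_reflect[OF hat_AE[OF f], of \<zeta>] hat_AE[OF g] by eventually_elim simp
  show "hat_convolution L M \<zeta> = conv f g \<zeta> / of_real ((2 * pi)\<^sup>2)"
    unfolding hat_convolution_def conv_def by (subst integral_cong_AE[OF _ _ ae]) measurable
  show "integrable lborel (\<lambda>\<zeta>'. hat L (\<zeta> - \<zeta>') * hat M \<zeta>') \<longleftrightarrow> integrable lborel (\<lambda>\<zeta>'. f (\<zeta> - \<zeta>') * g \<zeta>')"
    by (rule integrable_cong_AE[OF _ _ ae]) measurable
qed

section \<open>Sobolev norms of functions below the majorant\<close>

lemma japanese_ge_1: "1 \<le> japanese a"
  by (simp add: japanese_def)

lemma japanese_powr_le_exp: "\<exists>C\<ge>0. \<forall>a. japanese a powr r \<le> C * exp \<bar>a\<bar>"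
proof -
  define n where "n = nat \<lceil>\<bar>r\<bar>\<rceil>"
  obtain C where C: "\<And>x. \<bar>poly ([:1, 1:] ^ n) x\<bar> \<le> C * exp \<bar>x :: real\<bar>" using poly_le_exp by blast
  have "japanese a powr r \<le> C * exp \<bar>a\<bar>" for a
  proof -
    have j: "japanese a \<le> 1 + \<bar>a\<bar>"
      unfolding japanese_def by (rule real_le_lsqrt) (auto simp: power2_sum)
    have "r \<le> real n" unfolding n_def by linarith
    then have "japanese a powr r \<le> japanese a powr real n"
      by (intro powr_mono japanese_ge_1)
    also have "\<dots> = japanese a ^ n"
      using japanese_ge_1[of a] by (intro powr_realpow) linarith
    also have "\<dots> \<le> (1 + \<bar>a\<bar>) ^ n"
      using j japanese_ge_1[of a] by (intro power_mono) linarith+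
    also have "\<dots> \<le> C * exp \<bar>a\<bar>" using C[of "\<bar>a\<bar>"] by simp
    finally show ?thesis .
  qed
  moreover have "0 \<le> C" using order_trans[OF abs_ge_zero C[of 0]] by simp
  ultimately show ?thesis by blast
qed

lemma sobolev_weight_nonneg: "0 \<le> sobolev_weight s1 s2 \<zeta>"
  by (auto simp: sobolev_weight_def split_beta)

lemma borel_measurable_sobolev_weight [measurable]: "sobolev_weight s1 s2 \<in> borel_measurable borel"
proof -
  have [measurable]: "(\<lambda>x::real \<times> real. fst x) \<in> borel_measurable borel" "(\<lambda>x::real \<times> real. snd x) \<in> borel_measurable borel"
    by (auto intro!: borel_measurable_continuous_onI continuous_intros)
  show ?thesis unfolding sobolev_weight_def japanese_def split_beta' by measurable
qed

text \<open>The rate T + 1 - t is at least 1, which is the purpose of the 1 in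
  \<open>majorant\<close>. One factor of the square thus brings e^(- |\<xi>| - |\<eta>|), which
  absorbs the weight for every real s1 and s2; the other factor is at most 1.\<close>

lemma weighted_majorant_le_decay:
  obtains C where "0 \<le> C" and "\<And>T t \<zeta>. t \<le> T \<Longrightarrow> sobolev_weight s1 s2 \<zeta> * (majorant T t \<zeta>)\<^sup>2 \<le> C * decay \<zeta>"
proof -
  obtain C where C: "0 \<le> C" "\<And>a. japanese a powr (2 * s1) \<le> C * exp \<bar>a\<bar>" using japanese_powr_le_exp by blast
  obtain D where D: "0 \<le> D" "\<And>a. japanese a powr (2 * s2) \<le> D * exp \<bar>a\<bar>" using japanese_powr_le_exp by blast
  show ?thesis
  proof
    show "0 \<le> C + D" using C D by simp
    fix T t \<zeta> assume t: "t \<le> (T :: real)"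
    show "sobolev_weight s1 s2 \<zeta> * (majorant T t \<zeta>)\<^sup>2 \<le> (C + D) * decay \<zeta>"
    proof (cases "0 \<le> fst \<zeta>")
      case True
      let ?e = "exp (\<bar>fst \<zeta>\<bar> + \<bar>snd \<zeta>\<bar>)"
      have e: "exp \<bar>fst \<zeta>\<bar> \<le> ?e" "exp \<bar>snd \<zeta>\<bar> \<le> ?e" by simp_all
      have "sobolev_weight s1 s2 \<zeta> \<le> C * exp \<bar>fst \<zeta>\<bar> + D * exp \<bar>snd \<zeta>\<bar>"
        unfolding sobolev_weight_def split_beta by (intro add_mono C D)
      also have "\<dots> \<le> C * ?e + D * ?e" by (intro add_mono mult_left_mono C D e)
      finally have w: "sobolev_weight s1 s2 \<zeta> \<le> (C + D) * ?e" by (simp add: distrib_right)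
      have "1 * fst \<zeta> \<le> (T + 1 - t) * fst \<zeta>" using True t by (intro mult_right_mono) auto
      then have "majorant T t \<zeta> \<le> decay \<zeta> * exp (- (\<bar>fst \<zeta>\<bar> + \<bar>snd \<zeta>\<bar>))"
        using True by (auto simp: majorant_def intro!: mult_left_mono less_imp_le[OF decay_pos])
      moreover have "majorant T t \<zeta> \<le> 1"
      proof -
        have "1 \<le> (1 + (norm \<zeta>)\<^sup>2)\<^sup>2" by (intro one_le_power) simp
        then have "decay \<zeta> \<le> 1" unfolding decay_def by (simp add: inverse_le_1_iff)
        then show ?thesis using majorant_le_decay[OF t, of \<zeta>] by simp
      qed
      ultimately have "(majorant T t \<zeta>)\<^sup>2 \<le> decay \<zeta> * exp (- (\<bar>fst \<zeta>\<bar> + \<bar>snd \<zeta>\<bar>)) * 1"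
        unfolding power2_eq_square
        by (intro mult_mono majorant_nonneg) (auto intro!: mult_nonneg_nonneg less_imp_le[OF decay_pos])
      with w have "sobolev_weight s1 s2 \<zeta> * (majorant T t \<zeta>)\<^sup>2 \<le> ((C + D) * ?e) * (decay \<zeta> * exp (- (\<bar>fst \<zeta>\<bar> + \<bar>snd \<zeta>\<bar>)) * 1)"
        using C D by (intro mult_mono) auto
      also have "\<dots> = (C + D) * decay \<zeta> * (?e * exp (- (\<bar>fst \<zeta>\<bar> + \<bar>snd \<zeta>\<bar>)))" by simp
      also have "?e * exp (- (\<bar>fst \<zeta>\<bar> + \<bar>snd \<zeta>\<bar>)) = 1" by (simp flip: exp_add)
      finally show ?thesis by simp
    next
      case False
      then show ?thesis using C D less_imp_le[OF decay_pos] by (simp add: majorant_def)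
    qed
  qed
qed

lemma integrable_le_decay:
  fixes f :: "real \<times> real \<Rightarrow> 'b::{banach, second_countable_topology}"
  assumes f: "f \<in> borel_measurable borel" and le: "\<And>\<zeta>. norm (f \<zeta>) \<le> C * decay \<zeta>"
  shows "integrable lborel f"
proof -
  have i: "integrable lborel (\<lambda>\<zeta>. C * decay \<zeta>)" by (intro integrable_mult_right integrable_decay)
  show ?thesis
  proof (rule Bochner_Integration.integrable_bound[OF i])
    show "f \<in> borel_measurable lborel" using f by simp
    show "AE \<zeta> in lborel. norm (f \<zeta>) \<le> norm (C * decay \<zeta>)"
      unfolding real_norm_def by (intro always_eventually allI order_trans[OF le abs_ge_self])
  qed
qed

lemma integrable_le_majorant:
  fixes f :: "real \<times> real \<Rightarrow> 'b::{banach, second_countable_topology}"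
  assumes f: "f \<in> borel_measurable borel" and le: "\<And>\<zeta>. norm (f \<zeta>) \<le> C * majorant T t \<zeta>" and "t \<le> T" "0 \<le> C"
  shows "integrable lborel f"
proof (rule integrable_le_decay[OF f])
  show "norm (f \<zeta>) \<le> C * decay \<zeta>" for \<zeta>
    using le[of \<zeta>] mult_left_mono[OF majorant_le_decay[OF assms(3), of \<zeta>] assms(4)] by linarith
qed

lemma integrable_weighted:
  assumes [measurable]: "f \<in> borel_measurable borel"
    and le: "\<And>\<zeta>. sobolev_weight s1 s2 \<zeta> * (cmod (f \<zeta>))\<^sup>2 \<le> C * decay \<zeta>"
  shows "integrable lborel (\<lambda>\<zeta>. sobolev_weight s1 s2 \<zeta> * (cmod (f \<zeta>))\<^sup>2)"
proof (rule integrable_le_decay)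
  show "norm (sobolev_weight s1 s2 \<zeta> * (cmod (f \<zeta>))\<^sup>2) \<le> C * decay \<zeta>" for \<zeta>
    using le[of \<zeta>] mult_nonneg_nonneg[OF sobolev_weight_nonneg zero_le_power2] by (simp only: real_norm_def abs_of_nonneg)
qed measurable

lemma sobolevI:
  assumes f: "has_fourier L f" and i: "integrable lborel (\<lambda>\<zeta>. sobolev_weight s1 s2 \<zeta> * (cmod (f \<zeta>))\<^sup>2)"
  shows "L \<in> sobolev s1 s2"
    and "(sobolev_norm s1 s2 L)\<^sup>2 = (\<integral>\<zeta>. sobolev_weight s1 s2 \<zeta> * (cmod (f \<zeta>))\<^sup>2 \<partial>lborel)"
proof -
  have [measurable]: "f \<in> borel_measurable borel" "hat L \<in> borel_measurable borel"
    using f hat_borel[OF f] by (auto simp: has_fourier_def)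
  have ae: "AE \<zeta> in lborel. sobolev_weight s1 s2 \<zeta> * (cmod (hat L \<zeta>))\<^sup>2 = sobolev_weight s1 s2 \<zeta> * (cmod (f \<zeta>))\<^sup>2"
    using hat_AE[OF f] by eventually_elim simp
  show "L \<in> sobolev s1 s2"
    unfolding sobolev_def using f i by (auto simp: integrable_cong_AE[OF _ _ ae])
  have "0 \<le> (\<integral>\<zeta>. sobolev_weight s1 s2 \<zeta> * (cmod (hat L \<zeta>))\<^sup>2 \<partial>lborel)"
    by (intro Bochner_Integration.integral_nonneg mult_nonneg_nonneg sobolev_weight_nonneg) auto
  then show "(sobolev_norm s1 s2 L)\<^sup>2 = (\<integral>\<zeta>. sobolev_weight s1 s2 \<zeta> * (cmod (f \<zeta>))\<^sup>2 \<partial>lborel)"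
    unfolding sobolev_norm_def by (simp add: integral_cong_AE[OF _ _ ae])
qed

lemma sobolev_norm_nonneg: "0 \<le> sobolev_norm s1 s2 f"
  unfolding sobolev_norm_def
  by (intro real_sqrt_ge_zero Bochner_Integration.integral_nonneg mult_nonneg_nonneg sobolev_weight_nonneg) auto

text \<open>Again the rate is at least 1, and \<xi> e^(- \<xi>) \<le> 1. This bounds the transform
  of the nonlinearity uniformly in time, before any integration.\<close>

lemma abs_fst_majorant_le_decay:
  assumes t: "t \<le> T" shows "\<bar>fst \<zeta>\<bar> * majorant T t \<zeta> \<le> decay \<zeta>"
proof (cases "0 \<le> fst \<zeta>")
  case True
  have "1 * fst \<zeta> \<le> (T + 1 - t) * fst \<zeta>" using True t by (intro mult_right_mono) auto
  then have "exp (- ((T + 1 - t) * fst \<zeta>) - \<bar>snd \<zeta>\<bar>) \<le> exp (- fst \<zeta>)" by simp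
  then have "fst \<zeta> * exp (- ((T + 1 - t) * fst \<zeta>) - \<bar>snd \<zeta>\<bar>) \<le> exp (fst \<zeta>) * exp (- fst \<zeta>)"
    using True exp_ge_add_one_self[of "fst \<zeta>"] by (intro mult_mono) (auto simp del: exp_ge_add_one_self)
  also have "\<dots> = 1" by (simp flip: exp_add)
  finally have "decay \<zeta> * (fst \<zeta> * exp (- ((T + 1 - t) * fst \<zeta>) - \<bar>snd \<zeta>\<bar>)) \<le> decay \<zeta> * 1"
    by (intro mult_left_mono less_imp_le[OF decay_pos])
  then show ?thesis using True by (simp add: majorant_def mult.left_commute)
qed (simp add: majorant_def less_imp_le[OF decay_pos])

lemma tendsto_set_integral_Icc:
  fixes h :: "real \<Rightarrow> complex"
  assumes h: "set_integrable lborel {0..T} h" and X: "\<And>n. X n \<in> {0..T}" "X \<longlonglongrightarrow> t" and t: "t \<in> {0..T}"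
  shows "(\<lambda>n. LINT s:{0..X n}|lborel. h s) \<longlonglongrightarrow> (LINT s:{0..t}|lborel. h s)"
proof -
  have sub: "set_integrable lborel {0..r} h" if "r \<in> {0..T}" for r
    by (rule set_integrable_subset[OF h]) (use that in auto)
  show ?thesis
    unfolding set_lebesgue_integral_def
  proof (rule integral_dominated_convergence)
    show "integrable lborel (\<lambda>s. norm (indicat_real {0..T} s *\<^sub>R h s))"
      using h unfolding set_integrable_def by (rule integrable_norm)
    show "(\<lambda>s. indicat_real {0..t} s *\<^sub>R h s) \<in> borel_measurable lborel"
      using sub[OF t] unfolding set_integrable_def by (rule borel_measurable_integrable)
    show "(\<lambda>s. indicat_real {0..X n} s *\<^sub>R h s) \<in> borel_measurable lborel" for n
      using sub[OF X(1)] unfolding set_integrable_def by (rule borel_measurable_integrable)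
    show "AE s in lborel. norm (indicat_real {0..X n} s *\<^sub>R h s) \<le> norm (indicat_real {0..T} s *\<^sub>R h s)" for n
      using X(1)[of n] by (auto simp: indicator_def)
    show "AE s in lborel. (\<lambda>n. indicat_real {0..X n} s *\<^sub>R h s) \<longlonglongrightarrow> indicat_real {0..t} s *\<^sub>R h s"
      using AE_lborel_singleton[of t]
    proof eventually_elim
      case (elim s)
      then consider "s < t" | "t < s" by linarith
      then have "eventually (\<lambda>n. indicat_real {0..X n} s = indicat_real {0..t} s) sequentially"
      proof cases
        case 1
        from order_tendstoD(1)[OF X(2) 1] show ?thesis by eventually_elim (use 1 in \<open>auto simp: indicator_def\<close>)
      next
        case 2
        from order_tendstoD(2)[OF X(2) 2] show ?thesis by eventually_elim (use 2 in \<open>auto simp: indicator_def\<close>)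
      qed
      then show ?case by (intro tendsto_eventually) (auto elim: eventually_mono)
    qed
  qed
qed

section \<open>From the integral equation to solutions of the Cauchy problem\<close>

locale fourier_solution =
  fixes \<alpha> T \<delta> :: real and g :: "real \<times> real \<Rightarrow> complex" and U :: "real \<Rightarrow> real \<times> real \<Rightarrow> complex"
  assumes T: "0 \<le> T" and \<delta>: "0 \<le> \<delta>"
    and g: "integrable lborel g"
    and U: "case_prod U \<in> borel_measurable (borel \<Otimes>\<^sub>M borel)"
    and bound: "\<And>t \<zeta>. t \<in> {0..T} \<Longrightarrow> cmod (U t \<zeta>) \<le> \<delta> * majorant T t \<zeta>"
    and eq: "\<And>t \<zeta>. U t \<zeta> = cis (- (t * dispersion \<alpha> \<zeta>)) * (g \<zeta> + duhamel \<alpha> U U t \<zeta>)"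
begin

lemma U_borel [measurable]: "U t \<in> borel_measurable borel"
  using measurable_uncurry[OF U measurable_const measurable_ident_sets] by auto

lemma U_integrable: "t \<in> {0..T} \<Longrightarrow> integrable lborel (U t)"
  by (rule integrable_le_majorant[OF U_borel bound _ \<delta>]) auto

lemma U_fourier: "t \<in> {0..T} \<Longrightarrow> has_fourier (dist_of (U t)) (U t)"
  by (intro has_fourier_dist_of U_integrable)

lemma U_0: "U 0 = g"
proof
  fix \<zeta>
  have "(LINT s:{0..0}|lborel. cis (s * dispersion \<alpha> \<zeta>) * conv (U s) (U s) \<zeta>) = 0"
    unfolding set_lebesgue_integral_def
    by (rule integral_eq_zero_AE) (use AE_lborel_singleton[of 0] in eventually_elim, auto simp: indicator_def)
  then show "U 0 \<zeta> = g \<zeta>" by (subst eq) (simp add: duhamel_def)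
qed

text \<open>The majorant at the final time dominates those at all earlier times; the resulting bound
  is the dominating function for continuity in time.\<close>

lemma weighted_bound:
  shows "\<exists>C. \<forall>s\<in>{0..T}. \<forall>t\<in>{0..T}. \<forall>\<zeta>. sobolev_weight s1 s2 \<zeta> * (cmod (U s \<zeta> - U t \<zeta>))\<^sup>2 \<le> C * decay \<zeta>"
    and "\<exists>C. \<forall>t\<in>{0..T}. \<forall>\<zeta>. sobolev_weight s1 s2 \<zeta> * (cmod (U t \<zeta>))\<^sup>2 \<le> C * decay \<zeta>"
proof -
  obtain C where C: "0 \<le> C" "\<And>T t \<zeta>. t \<le> T \<Longrightarrow> sobolev_weight s1 s2 \<zeta> * (majorant T t \<zeta>)\<^sup>2 \<le> C * decay \<zeta>"
    using weighted_majorant_le_decay[of s1 s2] by blast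
  have T': "cmod (U t \<zeta>) \<le> \<delta> * majorant T T \<zeta>" if "t \<in> {0..T}" for t \<zeta>
    using that \<delta> by (intro order_trans[OF bound] mult_left_mono majorant_mono) auto
  have *: "sobolev_weight s1 s2 \<zeta> * x\<^sup>2 \<le> (4 * \<delta>\<^sup>2 * C) * decay \<zeta>" if "0 \<le> x" "x \<le> 2 * (\<delta> * majorant T T \<zeta>)" for x \<zeta>
  proof -
    have "sobolev_weight s1 s2 \<zeta> * x\<^sup>2 \<le> sobolev_weight s1 s2 \<zeta> * (2 * (\<delta> * majorant T T \<zeta>))\<^sup>2"
      using that by (intro mult_left_mono power_mono sobolev_weight_nonneg)
    also have "\<dots> = 4 * \<delta>\<^sup>2 * (sobolev_weight s1 s2 \<zeta> * (majorant T T \<zeta>)\<^sup>2)" by (simp add: power_mult_distrib)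
    also have "\<dots> \<le> 4 * \<delta>\<^sup>2 * (C * decay \<zeta>)" by (intro mult_left_mono C) auto
    finally show ?thesis by simp
  qed
  have "sobolev_weight s1 s2 \<zeta> * (cmod (U s \<zeta> - U t \<zeta>))\<^sup>2 \<le> (4 * \<delta>\<^sup>2 * C) * decay \<zeta>"
    if "s \<in> {0..T}" "t \<in> {0..T}" for s t \<zeta>
    using T'[OF that(1), of \<zeta>] T'[OF that(2), of \<zeta>] norm_triangle_ineq4[of "U s \<zeta>" "U t \<zeta>"]
    by (intro *) auto
  then show "\<exists>C. \<forall>s\<in>{0..T}. \<forall>t\<in>{0..T}. \<forall>\<zeta>. sobolev_weight s1 s2 \<zeta> * (cmod (U s \<zeta> - U t \<zeta>))\<^sup>2 \<le> C * decay \<zeta>"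
    by blast
  have "sobolev_weight s1 s2 \<zeta> * (cmod (U t \<zeta>))\<^sup>2 \<le> (4 * \<delta>\<^sup>2 * C) * decay \<zeta>"
    if "t \<in> {0..T}" for t \<zeta>
  proof (rule *)
    have "0 \<le> \<delta> * majorant T T \<zeta>" by (intro mult_nonneg_nonneg \<delta> majorant_nonneg)
    then show "cmod (U t \<zeta>) \<le> 2 * (\<delta> * majorant T T \<zeta>)" using T'[OF that, of \<zeta>] by linarith
  qed simp
  then show "\<exists>C. \<forall>t\<in>{0..T}. \<forall>\<zeta>. sobolev_weight s1 s2 \<zeta> * (cmod (U t \<zeta>))\<^sup>2 \<le> C * decay \<zeta>"
    by blast
qed

lemma U_sobolev: assumes t: "t \<in> {0..T}" shows "dist_of (U t) \<in> sobolev s1 s2"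
proof -
  obtain C where C: "\<And>t \<zeta>. t \<in> {0..T} \<Longrightarrow> sobolev_weight s1 s2 \<zeta> * (cmod (U t \<zeta>))\<^sup>2 \<le> C * decay \<zeta>"
    using weighted_bound(2)[of s1 s2] by blast
  show ?thesis
    by (rule sobolevI(1)[OF U_fourier[OF t] integrable_weighted[OF U_borel C[OF t]]])
qed

lemma U_tendsto:
  assumes X: "\<And>n. X n \<in> {0..T}" "X \<longlonglongrightarrow> t" and t: "t \<in> {0..T}"
  shows "(\<lambda>n. U (X n) \<zeta>) \<longlonglongrightarrow> U t \<zeta>"
proof -
  have i: "set_integrable lborel {0..T} (\<lambda>s. cis (s * dispersion \<alpha> \<zeta>) * conv (U s) (U s) \<zeta>)"
    by (rule duhamel_bound(1)[OF U U \<delta> \<delta> _ bound bound]) (use T in auto)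
  have "continuous_on UNIV (\<lambda>t. cis (- (t * dispersion \<alpha> \<zeta>)))" by (intro continuous_intros)
  then have "isCont (\<lambda>t. cis (- (t * dispersion \<alpha> \<zeta>))) t" by (simp add: continuous_on_eq_continuous_at)
  from isCont_tendsto_compose[OF this X(2)]
  show ?thesis
    unfolding eq[of _ \<zeta>] duhamel_def
    by (intro tendsto_mult tendsto_add tendsto_const tendsto_set_integral_Icc[OF i X t])
qed

lemma U_continuous:
  assumes t: "t \<in> {0..T}"
  shows "((\<lambda>t'. sobolev_norm s1 s2 (dist_of (U t') - dist_of (U t))) \<longlongrightarrow> 0) (at t within {0..T})"
proof -
  obtain C where C: "\<And>s t \<zeta>. s \<in> {0..T} \<Longrightarrow> t \<in> {0..T} \<Longrightarrow> sobolev_weight s1 s2 \<zeta> * (cmod (U s \<zeta> - U t \<zeta>))\<^sup>2 \<le> C * decay \<zeta>"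
    using weighted_bound(1)[of s1 s2] by blast
  have n: "sobolev_norm s1 s2 (dist_of (U s) - dist_of (U t)) = sqrt (\<integral>\<zeta>. sobolev_weight s1 s2 \<zeta> * (cmod (U s \<zeta> - U t \<zeta>))\<^sup>2 \<partial>lborel)"
    if s: "s \<in> {0..T}" for s
  proof -
    have i: "integrable lborel (\<lambda>\<zeta>. sobolev_weight s1 s2 \<zeta> * (cmod (U s \<zeta> - U t \<zeta>))\<^sup>2)"
      by (rule integrable_weighted[OF _ C[OF s t]]) measurable
    from sobolevI(2)[OF has_fourier_diff[OF U_fourier[OF s] U_fourier[OF t]] i]
    show ?thesis by (simp add: sobolev_norm_nonneg real_sqrt_unique)
  qed
  show ?thesis
    unfolding tendsto_at_iff_sequentially
  proof (intro allI impI)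
    fix X assume X: "\<forall>i. X i \<in> {0..T} - {t}" "X \<longlonglongrightarrow> t"
    then have X1: "X n \<in> {0..T}" for n by auto
    have "(\<lambda>n. \<integral>\<zeta>. sobolev_weight s1 s2 \<zeta> * (cmod (U (X n) \<zeta> - U t \<zeta>))\<^sup>2 \<partial>lborel) \<longlonglongrightarrow> (\<integral>\<zeta>. 0 \<partial>(lborel :: (real \<times> real) measure))"
    proof (rule integral_dominated_convergence)
      show "integrable lborel (\<lambda>\<zeta>. C * decay \<zeta>)" by (intro integrable_mult_right integrable_decay)
      show "AE \<zeta> in lborel. norm (sobolev_weight s1 s2 \<zeta> * (cmod (U (X n) \<zeta> - U t \<zeta>))\<^sup>2) \<le> C * decay \<zeta>" for n
        using C[OF X1 t] by (intro always_eventually allI) (simp add: sobolev_weight_nonneg abs_mult)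
      show "AE \<zeta> in lborel. (\<lambda>n. sobolev_weight s1 s2 \<zeta> * (cmod (U (X n) \<zeta> - U t \<zeta>))\<^sup>2) \<longlonglongrightarrow> 0"
      proof (intro always_eventually allI)
        fix \<zeta>
        have "(\<lambda>n. sobolev_weight s1 s2 \<zeta> * (cmod (U (X n) \<zeta> - U t \<zeta>))\<^sup>2) \<longlonglongrightarrow> sobolev_weight s1 s2 \<zeta> * (cmod (U t \<zeta> - U t \<zeta>))\<^sup>2"
          by (intro tendsto_mult tendsto_const tendsto_power tendsto_norm tendsto_diff U_tendsto X1 X t)
        then show "(\<lambda>n. sobolev_weight s1 s2 \<zeta> * (cmod (U (X n) \<zeta> - U t \<zeta>))\<^sup>2) \<longlonglongrightarrow> 0" by simp
      qed
    qed measurable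
    from tendsto_real_sqrt[OF this]
    show "((\<lambda>t'. sobolev_norm s1 s2 (dist_of (U t') - dist_of (U t))) \<circ> X) \<longlonglongrightarrow> 0"
      by (simp add: o_def n[OF X1])
  qed
qed

lemma conv_U:
  assumes t: "t \<in> {0..T}"
  shows "integrable lborel (\<lambda>\<zeta>'. U t (\<zeta> - \<zeta>') * U t \<zeta>')"
    and "cmod (conv (U t) (U t) \<zeta>) \<le> \<delta> * \<delta> * conv_const * majorant T t \<zeta>"
    and "conv (U t) (U t) \<in> borel_measurable borel"
  using conv_bound[OF U_borel U_borel bound[OF t] bound[OF t] \<delta> \<delta>]
    measurable_uncurry[OF measurable_conv[OF U U] measurable_const measurable_ident_sets] by auto

lemma product_U:
  assumes t: "t \<in> {0..T}"
  shows "product_exists (dist_of (U t)) (dist_of (U t))"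
    and "has_fourier (product (dist_of (U t)) (dist_of (U t))) (\<lambda>\<zeta>. conv (U t) (U t) \<zeta> / of_real ((2 * pi)\<^sup>2))"
proof -
  note f = U_fourier[OF t]
  have i: "integrable lborel (\<lambda>\<zeta>. conv (U t) (U t) \<zeta> / of_real ((2 * pi)\<^sup>2))"
    by (intro integrable_divide integrable_le_majorant[OF conv_U(3)[OF t] conv_U(2)[OF t]])
       (use t \<delta> conv_const_nonneg in auto)
  have e: "hat_convolution (dist_of (U t)) (dist_of (U t)) = (\<lambda>\<zeta>. conv (U t) (U t) \<zeta> / of_real ((2 * pi)\<^sup>2))"
    using conv_hat(1)[OF f f] by blast
  show "product_exists (dist_of (U t)) (dist_of (U t))"
    unfolding product_exists_def e conv_hat(2)[OF f f] using f has_fourier_dist_of[OF i] conv_U(1)[OF t] by auto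
  show "has_fourier (product (dist_of (U t)) (dist_of (U t))) (\<lambda>\<zeta>. conv (U t) (U t) \<zeta> / of_real ((2 * pi)\<^sup>2))"
    unfolding product_def e using of_hat_eq[OF has_fourier_dist_of[OF i]] has_fourier_dist_of[OF i] by simp
qed

definition nonlinearity :: "real \<Rightarrow> real \<times> real \<Rightarrow> complex" where
  "nonlinearity t \<zeta> = \<i> * of_real (fst \<zeta> / (2 * (2 * pi)\<^sup>2)) * conv (U t) (U t) \<zeta>"

lemma uux_U:
  assumes t: "t \<in> {0..T}"
  shows "has_fourier (uux (dist_of (U t))) (nonlinearity t)"
proof -
  have "(\<lambda>\<zeta>. of_real (1 / 2) * (\<i> * of_real (fst \<zeta>) * (conv (U t) (U t) \<zeta> / of_real ((2 * pi)\<^sup>2)))) = nonlinearity t"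
    by (auto simp: nonlinearity_def fun_eq_iff)
  then show ?thesis
    using has_fourier_scaleR[OF has_fourier_dist_dx[OF product_U(2)[OF t]], of "1 / 2"] by (simp add: uux_def)
qed

lemma nonlinearity_bound:
  assumes t: "t \<in> {0..T}"
  shows "cmod (nonlinearity t \<zeta>) \<le> \<delta> * \<delta> * conv_const * decay \<zeta>"
proof -
  have "1 * 1 \<le> (2 * pi) * (2 * pi)" using pi_ge_two by (intro mult_mono) auto
  then have p: "1 / (2 * (2 * pi)\<^sup>2) \<le> 1" by (simp add: power2_eq_square)
  have nn: "0 \<le> \<delta> * \<delta> * conv_const" using \<delta> conv_const_nonneg by simp
  have "cmod (nonlinearity t \<zeta>) = (1 / (2 * (2 * pi)\<^sup>2)) * (\<bar>fst \<zeta>\<bar> * cmod (conv (U t) (U t) \<zeta>))"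
    by (simp add: nonlinearity_def norm_mult norm_divide norm_power)
  also have "\<dots> \<le> 1 * (\<bar>fst \<zeta>\<bar> * (\<delta> * \<delta> * conv_const * majorant T t \<zeta>))"
    by (intro mult_mono p conv_U(2)[OF t]) auto
  also have "\<dots> = \<delta> * \<delta> * conv_const * (\<bar>fst \<zeta>\<bar> * majorant T t \<zeta>)" by simp
  also have "\<dots> \<le> \<delta> * \<delta> * conv_const * decay \<zeta>"
    using t nn by (intro mult_left_mono abs_fst_majorant_le_decay) auto
  finally show ?thesis .
qed

lemma measurable_nonlinearity: "case_prod nonlinearity \<in> borel_measurable (borel \<Otimes>\<^sub>M borel)"
proof -
  have "(\<lambda>x. of_real (fst (snd x) / (2 * (2 * pi)\<^sup>2)) :: complex) \<in> borel_measurable ((borel :: real measure) \<Otimes>\<^sub>M (borel :: (real \<times> real) measure))"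
    unfolding borel_prod by (intro borel_measurable_continuous_onI continuous_intros) auto
  then show ?thesis
    unfolding nonlinearity_def split_beta'
    by (intro borel_measurable_times measurable_uncurry[OF measurable_conv[OF U U]]) auto
qed

lemma nonlinearity_integrable: "t \<in> {0..T} \<Longrightarrow> integrable lborel (nonlinearity t)"
  by (rule integrable_le_decay[OF _ nonlinearity_bound])
     (use measurable_uncurry[OF measurable_nonlinearity measurable_const measurable_ident_sets] in auto)

text \<open>Each test function is some \<open>fourier h\<close>, so every pairing becomes an
  integral over frequencies. Fubini exchanges time and frequency, and splitting the phase for t - s
  into those for t and s turns the inner integral into \<open>duhamel\<close>.\<close>

lemma duhamel_formula:
  assumes t: "t \<in> {0..T}" and \<psi>: "\<psi> \<in> schwartz"
  shows "set_integrable lebesgue {0..t} (\<lambda>t'. pairing (W \<alpha> (t - t') (uux (dist_of (U t')))) \<psi>)"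
    and "pairing (dist_of (U t)) \<psi> = pairing (W \<alpha> t (dist_of g)) \<psi>
      + (LINT t':{0..t}|lebesgue. pairing (W \<alpha> (t - t') (uux (dist_of (U t')))) \<psi>)"
proof -
  obtain h where h: "h \<in> schwartz" "fourier h = \<psi>" using fourier_surj[OF \<psi>] .
  have hb [measurable]: "h \<in> borel_measurable borel" by (rule schwartz_borel[OF h(1)])
  obtain B where B: "\<And>p. cmod (h p) \<le> B"
    using schwartz_moment_bound[OF h(1), of 0 0 0 0] by auto
  define K where "K = \<delta> * \<delta> * conv_const * B"
  let ?P = "\<lambda>s. pairing (W \<alpha> (t - s) (uux (dist_of (U s)))) \<psi>"
  let ?F = "\<lambda>s \<zeta>. cis (- ((t - s) * dispersion \<alpha> \<zeta>)) * nonlinearity s \<zeta> * h \<zeta>"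
  let ?G = "\<lambda>s \<zeta>. indicat_real {0..t} s *\<^sub>R ?F s \<zeta>"
  have P: "?P s = (\<integral>\<zeta>. ?F s \<zeta> \<partial>lborel)" if "s \<in> {0..t}" for s
  proof -
    have s: "s \<in> {0..T}" using that t by auto
    from has_fourier_W[OF uux_U[OF s] nonlinearity_integrable[OF s], of \<alpha> "t - s"] h
    show ?thesis by (auto simp: has_fourier_def)
  qed
  have Gm: "case_prod ?G \<in> borel_measurable (lborel \<Otimes>\<^sub>M lborel)"
    unfolding split_beta'
    by (intro borel_measurable_scaleR borel_measurable_times borel_measurable_cis measurable_uncurry[OF measurable_nonlinearity]
         measurable_compose[OF measurable_snd hb[folded measurable_lborel1]] borel_measurable_uminus
         measurable_compose[OF measurable_snd borel_measurable_dispersion[folded measurable_lborel1]]) measurable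
  have Gle: "norm (?G s \<zeta>) \<le> indicat_real {0..t} s * (K * decay \<zeta>)" for s \<zeta>
  proof (cases "s \<in> {0..t}")
    case True
    then have "s \<in> {0..T}" using t by auto
    have "cmod (?F s \<zeta>) \<le> (\<delta> * \<delta> * conv_const * decay \<zeta>) * B"
      unfolding norm_mult norm_cis mult_1_left
      using order_trans[OF norm_ge_zero nonlinearity_bound[OF \<open>s \<in> {0..T}\<close>]]
      by (intro mult_mono B nonlinearity_bound[OF \<open>s \<in> {0..T}\<close>]) auto
    then show ?thesis using True by (simp add: K_def mult_ac)
  qed simp
  have Gi: "integrable (lborel \<Otimes>\<^sub>M lborel) (case_prod ?G)"
  proof (rule Bochner_Integration.integrable_bound[OF _ Gm])
    have m: "(\<lambda>(s, \<zeta>). indicat_real {0..t} s * (K * decay \<zeta>)) \<in> borel_measurable (lborel \<Otimes>\<^sub>M lborel)"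
      unfolding split_beta' by measurable
    show "integrable (lborel \<Otimes>\<^sub>M lborel) (\<lambda>(s, \<zeta>). indicat_real {0..t} s * (K * decay \<zeta>))"
    proof (rule lborel_pair.Fubini_integrable[OF m])
      have "integrable lborel (\<lambda>s. indicat_real {0..t} s * (\<integral>\<zeta>. norm (K * decay \<zeta>) \<partial>lborel))"
        by (intro integrable_mult_left integrable_real_indicator) (auto simp: emeasure_lborel_Icc_eq)
      then show "integrable lborel (\<lambda>s. \<integral>\<zeta>. norm (case (s, \<zeta>) of (s, \<zeta>) \<Rightarrow> indicat_real {0..t} s * (K * decay \<zeta>)) \<partial>lborel)"
        by (simp add: abs_mult)
      show "AE s in lborel. integrable lborel (\<lambda>\<zeta>. case (s, \<zeta>) of (s, \<zeta>) \<Rightarrow> indicat_real {0..t} s * (K * decay \<zeta>))"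
        by (simp add: integrable_decay)
    qed
    show "AE x in lborel \<Otimes>\<^sub>M lborel. norm (case_prod ?G x) \<le> norm (case x of (s, \<zeta>) \<Rightarrow> indicat_real {0..t} s * (K * decay \<zeta>))"
      unfolding split_beta' real_norm_def by (intro always_eventually allI order_trans[OF Gle abs_ge_self])
  qed
  have PG: "(\<lambda>s. indicat_real {0..t} s *\<^sub>R ?P s) = (\<lambda>s. \<integral>\<zeta>. ?G s \<zeta> \<partial>lborel)"
    by (auto simp: fun_eq_iff P indicator_def)
  \<comment> \<open>As a partial integral of a jointly measurable function, the pairing is Borel in
    time on the interval, so integrals with respect to \<open>lebesgue\<close> and
    \<open>lborel\<close> agree.\<close>
  have Pi: "integrable lborel (\<lambda>s. indicat_real {0..t} s *\<^sub>R ?P s)"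
    unfolding PG using lborel_pair.integrable_fst'[OF Gi] by simp
  then show "set_integrable lebesgue {0..t} ?P"
    unfolding set_integrable_def by (subst integrable_completion) auto
  have "(LINT s:{0..t}|lebesgue. ?P s) = (\<integral>s. \<integral>\<zeta>. ?G s \<zeta> \<partial>lborel \<partial>lborel)"
    unfolding set_lebesgue_integral_def using Pi by (subst integral_completion) (auto simp: PG)
  also have "\<dots> = (\<integral>\<zeta>. \<integral>s. ?G s \<zeta> \<partial>lborel \<partial>lborel)"
    using lborel_pair.Fubini_integral[OF Gi] by simp
  also have "\<dots> = (\<integral>\<zeta>. cis (- (t * dispersion \<alpha> \<zeta>)) * duhamel \<alpha> U U t \<zeta> * h \<zeta> \<partial>lborel)"
  proof (rule Bochner_Integration.integral_cong)
    fix \<zeta>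
    let ?c = "cis (- (t * dispersion \<alpha> \<zeta>)) * (\<i> * of_real (fst \<zeta> / (2 * (2 * pi)\<^sup>2))) * h \<zeta>"
    have "?G s \<zeta> = ?c * (indicat_real {0..t} s *\<^sub>R (cis (s * dispersion \<alpha> \<zeta>) * conv (U s) (U s) \<zeta>))" for s
    proof -
      have "cis (- ((t - s) * dispersion \<alpha> \<zeta>)) = cis (- (t * dispersion \<alpha> \<zeta>)) * cis (s * dispersion \<alpha> \<zeta>)"
        by (simp add: cis_mult algebra_simps)
      then show ?thesis by (simp only: nonlinearity_def scaleR_conv_of_real mult_ac)
    qed
    then have "(\<integral>s. ?G s \<zeta> \<partial>lborel) = ?c * (LINT s:{0..t}|lborel. cis (s * dispersion \<alpha> \<zeta>) * conv (U s) (U s) \<zeta>)"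
      by (simp only: set_lebesgue_integral_def integral_mult_right_zero)
    then show "(\<integral>s. ?G s \<zeta> \<partial>lborel) = cis (- (t * dispersion \<alpha> \<zeta>)) * duhamel \<alpha> U U t \<zeta> * h \<zeta>"
      by (simp only: duhamel_def mult_ac)
  qed simp
  finally have D: "(LINT s:{0..t}|lebesgue. ?P s) = (\<integral>\<zeta>. cis (- (t * dispersion \<alpha> \<zeta>)) * duhamel \<alpha> U U t \<zeta> * h \<zeta> \<partial>lborel)" .
  have W: "pairing (W \<alpha> t (dist_of g)) \<psi> = (\<integral>\<zeta>. cis (- (t * dispersion \<alpha> \<zeta>)) * g \<zeta> * h \<zeta> \<partial>lborel)"
    and Wi: "integrable lborel (\<lambda>\<zeta>. cis (- (t * dispersion \<alpha> \<zeta>)) * g \<zeta> * h \<zeta>)"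
    using has_fourier_W[OF has_fourier_dist_of[OF g] g, of \<alpha> t] h by (auto simp: has_fourier_def)
  have V: "pairing (dist_of (U t)) \<psi> = (\<integral>\<zeta>. U t \<zeta> * h \<zeta> \<partial>lborel)" and Vi: "integrable lborel (\<lambda>\<zeta>. U t \<zeta> * h \<zeta>)"
    using U_fourier[OF t] h by (auto simp: has_fourier_def)
  have e: "cis (- (t * dispersion \<alpha> \<zeta>)) * duhamel \<alpha> U U t \<zeta> * h \<zeta> = U t \<zeta> * h \<zeta> - cis (- (t * dispersion \<alpha> \<zeta>)) * g \<zeta> * h \<zeta>" for \<zeta>
    by (subst eq[of t \<zeta>]) (simp add: algebra_simps)
  show "pairing (dist_of (U t)) \<psi> = pairing (W \<alpha> t (dist_of g)) \<psi> + (LINT s:{0..t}|lebesgue. ?P s)"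
    unfolding D e W V Bochner_Integration.integral_diff[OF Vi Wi] by simp
qed

lemma solution: "is_solution \<alpha> s1 s2 T (dist_of g) (\<lambda>t. dist_of (U t))"
  unfolding is_solution_def
  using U_0 U_sobolev U_continuous product_U(1) duhamel_formula by auto

end

section \<open>Second derivatives along rays\<close>

text \<open>The quadratic coefficient is identified although \<open>p\<close> is only differentiable
  at 0. If q exceeded 2 b by d, the remainder \<open>H\<close> would have derivative at least d / 2
  times x for small x \<ge> 0, hence grow like d / 4 times x^2, against the cubic bound.\<close>

lemma second_derivative_le:
  fixes f p :: "real \<Rightarrow> real"
  assumes e: "0 < e" and f: "\<And>x. \<bar>x\<bar> < e \<Longrightarrow> (f has_real_derivative p x) (at x)"
    and p: "(p has_real_derivative q) (at 0)"
    and C: "\<And>x. \<bar>x\<bar> < e \<Longrightarrow> \<bar>f x - x * a - x\<^sup>2 * b\<bar> \<le> C * \<bar>x\<bar> ^ 3"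
  shows "q \<le> 2 * b"
proof (rule ccontr)
  assume "\<not> q \<le> 2 * b"
  define d where "d = q - 2 * b"
  have d: "0 < d" using \<open>\<not> q \<le> 2 * b\<close> by (simp add: d_def)
  define H where "H x = f x - x * a - x\<^sup>2 * b" for x
  have H: "(H has_real_derivative p x - a - 2 * x * b) (at x)" if "\<bar>x\<bar> < e" for x
    unfolding H_def using f[OF that] by (auto intro!: derivative_eq_intros)
  have H0: "H 0 = 0" using C[of 0] e by (simp add: H_def)
  \<comment> \<open>A remainder of third order has derivative 0 at 0; comparison with the formula
    for the derivative of \<open>H\<close> yields p 0 = a.\<close>
  have "(H has_real_derivative 0) (at 0)"
    unfolding DERIV_def
  proof (rule Lim_null_comparison)
    have "(\<lambda>h::real. C * h\<^sup>2) \<midarrow>0\<rightarrow> C * 0\<^sup>2" by (intro tendsto_intros)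
    then show "((\<lambda>h::real. C * h\<^sup>2) \<longlongrightarrow> 0) (at 0)" by simp
    have "norm ((H (0 + h) - H 0) / h) \<le> C * h\<^sup>2" if "h \<noteq> 0" "\<bar>h\<bar> < e" for h
    proof -
      have "\<bar>H h\<bar> \<le> C * \<bar>h\<bar> ^ 3" using C[OF that(2)] by (simp add: H_def)
      also have "\<bar>h\<bar> ^ 3 = h\<^sup>2 * \<bar>h\<bar>" by (simp add: power3_eq_cube power2_eq_square)
      finally have "\<bar>H h\<bar> \<le> C * h\<^sup>2 * \<bar>h\<bar>" by (simp only: mult.assoc)
      then show ?thesis using that(1) by (simp add: H0 abs_divide pos_divide_le_eq)
    qed
    then show "\<forall>\<^sub>F h in at 0. norm ((H (0 + h) - H 0) / h) \<le> C * h\<^sup>2"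
      using e by (auto simp: eventually_at dist_real_def intro!: exI[of _ e])
  qed
  from DERIV_unique[OF this H] e have pa: "p 0 = a" by simp
  have "\<forall>\<^sub>F h in at 0. dist ((p (0 + h) - p 0) / h) q < d / 2"
    by (rule tendstoD[OF p[unfolded DERIV_def]]) (use d in simp)
  then obtain r where r: "0 < r" "\<And>h. h \<noteq> 0 \<Longrightarrow> \<bar>h\<bar> < r \<Longrightarrow> \<bar>(p h - a) / h - q\<bar> < d / 2"
    unfolding eventually_at by (auto simp: pa dist_real_def)
  \<comment> \<open>The last bound makes C x at most d / 8, while the growth of \<open>H\<close>
    forces C x to be at least d / 4.\<close>
  define x where "x = min (min (e / 2) (r / 2)) (d / (8 * (\<bar>C\<bar> + 1)))"
  have x: "0 < x" "x < e" "x < r" "x \<le> d / (8 * (\<bar>C\<bar> + 1))"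
    using e r d by (auto simp: x_def min_less_iff_disj intro!: divide_pos_pos)
  have "H 0 - d / 4 * 0\<^sup>2 \<le> H x - d / 4 * x\<^sup>2"
  proof (rule DERIV_nonneg_imp_nondecreasing[of 0 x "\<lambda>x. H x - d / 4 * x\<^sup>2"])
    fix y assume y: "0 \<le> y" "y \<le> x"
    have "((\<lambda>x. H x - d / 4 * x\<^sup>2) has_real_derivative p y - a - 2 * y * b - d / 2 * y) (at y)"
      using H[of y] y x by (auto intro!: derivative_eq_intros)
    moreover have "0 \<le> p y - a - 2 * y * b - d / 2 * y"
    proof (cases "y = 0")
      case False
      then have y0: "0 < y" using y by simp
      have "\<bar>(p y - a) / y - q\<bar> < d / 2" using r(2)[of y] y0 y x by simp
      then have "q - d / 2 \<le> (p y - a) / y" by linarith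
      then have "(q - d / 2) * y \<le> p y - a" using y0 by (simp add: pos_le_divide_eq)
      moreover have "(q - d / 2) * y = 2 * y * b + d / 2 * y" by (simp add: d_def field_simps)
      ultimately show ?thesis by linarith
    qed (simp add: pa)
    ultimately show "\<exists>D. ((\<lambda>x. H x - d / 4 * x\<^sup>2) has_real_derivative D) (at y) \<and> 0 \<le> D" by blast
  qed (use x in simp)
  then have "d / 4 * x\<^sup>2 \<le> H x" using H0 by simp
  also have "\<dots> \<le> C * \<bar>x\<bar> ^ 3" using C[of x] x by (simp add: H_def)
  also have "\<dots> = C * x * x\<^sup>2" using x by (simp add: power3_eq_cube power2_eq_square)
  finally have "d / 4 \<le> C * x" using x by simp
  also have "\<dots> \<le> (\<bar>C\<bar> + 1) * x" using x by (intro mult_right_mono) auto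
  also have "\<dots> \<le> (\<bar>C\<bar> + 1) * (d / (8 * (\<bar>C\<bar> + 1)))" using x by (intro mult_left_mono) auto
  also have "\<dots> = d / 8"
  proof -
    have "k * (d / (8 * k)) = d / 8" if "k \<noteq> 0" for k using that by simp
    from this[of "\<bar>C\<bar> + 1"] show ?thesis by linarith
  qed
  finally show False using d by simp
qed

lemma second_derivative_eq:
  fixes f p :: "real \<Rightarrow> real"
  assumes e: "0 < e" and f: "\<And>x. \<bar>x\<bar> < e \<Longrightarrow> (f has_real_derivative p x) (at x)"
    and p: "(p has_real_derivative q) (at 0)"
    and C: "\<And>x. \<bar>x\<bar> < e \<Longrightarrow> \<bar>f x - x * a - x\<^sup>2 * b\<bar> \<le> C * \<bar>x\<bar> ^ 3"
  shows "q = 2 * b"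
proof (rule antisym)
  show "q \<le> 2 * b" by (rule second_derivative_le[OF e f p C])
  have "- q \<le> 2 * (- b)"
  proof (rule second_derivative_le[OF e, of "\<lambda>x. - f x" "\<lambda>x. - p x" _ "- a" _ C])
    show "\<bar>- f x - x * - a - x\<^sup>2 * - b\<bar> \<le> C * \<bar>x\<bar> ^ 3" if "\<bar>x\<bar> < e" for x
      using C[OF that] by (simp add: abs_if split: if_splits)
  qed (use f p in \<open>auto intro!: DERIV_minus\<close>)
  then show "2 * b \<le> q" by simp
qed

text \<open>\<open>K\<close> bounds the second derivative at 0 and is fixed before \<phi>, the
  functional and the constants \<open>e\<close>, \<open>C\<close> of the expansion, all of which may
  later depend on the frequency. Along the ray, l composed with \<open>F\<close> is a real function
  whose second derivative at 0 is \<open>l (D2 0 \<phi> \<phi>)\<close>, and this is twice the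
  quadratic coefficient.\<close>

lemma C2_at_quadratic_bound:
  fixes V :: "'a::real_vector set"
  assumes F: "C2_at V N F 0"
    and V: "\<And>x y. x \<in> V \<Longrightarrow> y \<in> V \<Longrightarrow> x + y \<in> V" "\<And>x r. x \<in> V \<Longrightarrow> r *\<^sub>R x \<in> V"
    and FV: "\<And>x. x \<in> V \<Longrightarrow> F x \<in> V"
    and N: "\<And>x. 0 \<le> N x" "\<And>x r. x \<in> V \<Longrightarrow> N (r *\<^sub>R x) = \<bar>r\<bar> * N x"
  obtains K where "0 \<le> K" and "\<And>l c \<phi> a b C e. \<lbrakk>\<phi> \<in> V; 0 \<le> c;
      \<And>x y. x \<in> V \<Longrightarrow> y \<in> V \<Longrightarrow> l (x + y) = l x + l y; \<And>x r. x \<in> V \<Longrightarrow> l (r *\<^sub>R x) = r * l x;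
      \<And>x. x \<in> V \<Longrightarrow> \<bar>l x\<bar> \<le> c * N x; 0 < e;
      \<And>x. \<bar>x\<bar> < e \<Longrightarrow> \<bar>l (F (x *\<^sub>R \<phi>)) - x * a - x\<^sup>2 * b\<bar> \<le> C * \<bar>x\<bar> ^ 3\<rbrakk>
      \<Longrightarrow> \<bar>2 * b\<bar> \<le> c * K * (N \<phi>)\<^sup>2"
proof -
  from F[unfolded C2_at_def diff_zero] obtain r D D2 where zr: "0 \<in> V" and r: "0 < r" and
    *: "\<forall>x\<in>V. N x < r \<longrightarrow> has_frechet_derivative_on V N F (D x) x \<and> bilinear_bounded_on V N (D2 x) \<and>
        (\<forall>\<epsilon>>0. \<exists>\<delta>>0. \<forall>h\<in>V. N h < \<delta> \<longrightarrow> (\<forall>k\<in>V. N (D (x + h) k - D x k - D2 x h k) \<le> \<epsilon> * N h * N k))"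
    by blast
  from * have
    D: "\<And>x. x \<in> V \<Longrightarrow> N x < r \<Longrightarrow> has_frechet_derivative_on V N F (D x) x"
    and B: "\<And>x. x \<in> V \<Longrightarrow> N x < r \<Longrightarrow> bilinear_bounded_on V N (D2 x)"
    and D2: "\<And>x \<epsilon>. x \<in> V \<Longrightarrow> N x < r \<Longrightarrow> \<epsilon> > 0 \<Longrightarrow> \<exists>\<delta>>0. \<forall>h\<in>V. N h < \<delta> \<longrightarrow>
           (\<forall>k\<in>V. N (D (x + h) k - D x k - D2 x h k) \<le> \<epsilon> * N h * N k)"
    by blast+
  have N0: "N 0 = 0" using N(2)[OF zr, of 0] by simp
  have B0: "bilinear_bounded_on V N (D2 0)" using B[OF zr] r N0 by simp
  then obtain K0 where K0: "\<And>h k. h \<in> V \<Longrightarrow> k \<in> V \<Longrightarrow> N (D2 0 h k) \<le> K0 * N h * N k"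
    unfolding bilinear_bounded_on_def by blast
  have D2V: "D2 0 h k \<in> V" if "h \<in> V" "k \<in> V" for h k
    using B0 that unfolding bilinear_bounded_on_def linear_bounded_on_def by blast
  have D2s: "D2 0 (s *\<^sub>R h) k = s *\<^sub>R D2 0 h k" if "h \<in> V" "k \<in> V" for h k s
    using B0 that unfolding bilinear_bounded_on_def linear_bounded_on_def by blast
  have DV: "D x k \<in> V" and Ds: "D x (s *\<^sub>R k) = s *\<^sub>R D x k" if "x \<in> V" "N x < r" "k \<in> V" for x k s
    using D[OF that(1,2)] that(3) unfolding has_frechet_derivative_on_def linear_bounded_on_def by blast+
  have diffV: "x - y \<in> V" if "x \<in> V" "y \<in> V" for x y
    using V(1)[OF that(1) V(2)[OF that(2), of "-1"]] by simp
  show ?thesis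
  proof
    show "0 \<le> \<bar>K0\<bar>" by simp
    fix l c \<phi> a b C and e :: real
    assume \<phi>: "\<phi> \<in> V" and c: "0 \<le> c"
      and l: "\<And>x y. x \<in> V \<Longrightarrow> y \<in> V \<Longrightarrow> l (x + y) = l x + l y" "\<And>x r. x \<in> V \<Longrightarrow> l (r *\<^sub>R x) = r * l x"
        "\<And>x. x \<in> V \<Longrightarrow> \<bar>l x\<bar> \<le> c * N x" and e: "0 < e"
      and C: "\<And>x. \<bar>x\<bar> < e \<Longrightarrow> \<bar>l (F (x *\<^sub>R \<phi>)) - x * a - x\<^sup>2 * b\<bar> \<le> C * \<bar>x\<bar> ^ 3"
    have ld: "l (x - y) = l x - l y" if "x \<in> V" "y \<in> V" for x y
      using l(1)[OF that(1) V(2)[OF that(2), of "-1"]] l(2)[OF that(2), of "-1"] by simp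
    \<comment> \<open>Keeps the segment of the ray inside the ball on which \<open>F\<close> is
      differentiable.\<close>
    define e1 where "e1 = min e (r / (N \<phi> + 1))"
    have n1: "0 < N \<phi> + 1" using N(1)[of \<phi>] by linarith
    have e1: "0 < e1" using e r n1 by (simp add: e1_def)
    have small: "N (x *\<^sub>R \<phi>) < r" if "\<bar>x\<bar> < e1" for x
    proof -
      have "N (x *\<^sub>R \<phi>) = \<bar>x\<bar> * N \<phi>" by (rule N(2)[OF \<phi>])
      also have "\<dots> \<le> \<bar>x\<bar> * (N \<phi> + 1)" by (intro mult_left_mono) auto
      also have "\<dots> < r" using that n1 by (simp add: e1_def pos_less_divide_eq)
      finally show ?thesis .
    qed
    have x\<phi>: "x *\<^sub>R \<phi> \<in> V" for x by (rule V(2)[OF \<phi>])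
    \<comment> \<open>Converts a remainder estimate in the norm, along the ray, into one for a real
      function of s. The summands 1 in \<open>Q\<close> keep it positive when c, N \<phi> or M
      vanishes.\<close>
    have est: "\<exists>d>0. \<forall>s. \<bar>s\<bar> < d \<longrightarrow> \<bar>l (G s)\<bar> \<le> \<epsilon> * \<bar>s\<bar>"
      if G: "\<And>s. G s \<in> V" and \<epsilon>: "0 < \<epsilon>" and h: "\<And>\<epsilon>'. 0 < \<epsilon>' \<Longrightarrow> \<exists>\<delta>>0. \<forall>s. N (s *\<^sub>R \<phi>) < \<delta> \<longrightarrow> N (G s) \<le> \<epsilon>' * N (s *\<^sub>R \<phi>) * M" and M: "0 \<le> M" for G \<epsilon> M
    proof -
      define Q where "Q = (c + 1) * (N \<phi> + 1) * (M + 1)"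
      define \<epsilon>' where "\<epsilon>' = \<epsilon> / Q"
      have p: "0 < Q" unfolding Q_def using c n1 M by (intro mult_pos_pos) auto
      have \<epsilon>': "0 < \<epsilon>'" unfolding \<epsilon>'_def using \<epsilon> p by (rule divide_pos_pos)
      obtain \<delta> where \<delta>: "0 < \<delta>" "\<And>s. N (s *\<^sub>R \<phi>) < \<delta> \<Longrightarrow> N (G s) \<le> \<epsilon>' * N (s *\<^sub>R \<phi>) * M" using h[OF \<epsilon>'] by blast
      show ?thesis
      proof (intro exI[of _ "\<delta> / (N \<phi> + 1)"] conjI allI impI)
        show "0 < \<delta> / (N \<phi> + 1)" using \<delta> n1 by simp
        fix s assume s: "\<bar>s\<bar> < \<delta> / (N \<phi> + 1)"
        have "N (s *\<^sub>R \<phi>) = \<bar>s\<bar> * N \<phi>" by (rule N(2)[OF \<phi>])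
        also have "\<dots> \<le> \<bar>s\<bar> * (N \<phi> + 1)" by (intro mult_left_mono) auto
        also have "\<dots> < \<delta>" using s n1 by (simp add: pos_less_divide_eq)
        finally have "N (G s) \<le> \<epsilon>' * (\<bar>s\<bar> * N \<phi>) * M" using \<delta>(2)[of s] N(2)[OF \<phi>, of s] by simp
        then have "\<bar>l (G s)\<bar> \<le> c * (\<epsilon>' * (\<bar>s\<bar> * N \<phi>) * M)"
          using l(3)[OF G, of s] c by (meson mult_left_mono order_trans)
        also have "\<dots> = \<epsilon>' * \<bar>s\<bar> * (c * N \<phi> * M)" by simp
        also have "\<dots> \<le> \<epsilon>' * \<bar>s\<bar> * Q"
          unfolding Q_def using \<epsilon>' c M N(1)[of \<phi>] by (intro mult_left_mono mult_mono) auto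
        also have "\<dots> = \<epsilon> * \<bar>s\<bar>"
          unfolding \<epsilon>'_def using p by simp
        finally show "\<bar>l (G s)\<bar> \<le> \<epsilon> * \<bar>s\<bar>" .
      qed
    qed
    define f where "f x = l (F (x *\<^sub>R \<phi>))" for x
    define p where "p x = l (D (x *\<^sub>R \<phi>) \<phi>)" for x
    have f: "(f has_real_derivative p x) (at x)" if x: "\<bar>x\<bar> < e1" for x
    proof -
      let ?G = "\<lambda>s. F (x *\<^sub>R \<phi> + s *\<^sub>R \<phi>) - F (x *\<^sub>R \<phi>) - D (x *\<^sub>R \<phi>) (s *\<^sub>R \<phi>)"
      have lG: "l (?G s) = f (x + s) - f x - p x * s" for s
        using FV[OF x\<phi>] FV[OF V(1)[OF x\<phi> x\<phi>]] DV[OF x\<phi> small[OF x] \<phi>] Ds[OF x\<phi> small[OF x] \<phi>]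
        by (simp add: ld diffV V(2) l(2) f_def p_def scaleR_add_left[symmetric])
      have "\<exists>d>0. \<forall>s. \<bar>s\<bar> < d \<longrightarrow> \<bar>l (?G s)\<bar> \<le> \<epsilon> * \<bar>s\<bar>" if "0 < \<epsilon>" for \<epsilon>
      proof (rule est[OF _ that, of _ 1])
        show "?G s \<in> V" for s
          by (intro diffV FV V(1) x\<phi> DV[OF x\<phi> small[OF x]])
        show "\<exists>\<delta>>0. \<forall>s. N (s *\<^sub>R \<phi>) < \<delta> \<longrightarrow> N (?G s) \<le> \<epsilon>' * N (s *\<^sub>R \<phi>) * 1" if "0 < \<epsilon>'" for \<epsilon>'
          using D[OF x\<phi> small[OF x]] that x\<phi> unfolding has_frechet_derivative_on_def mult_1_right by blast
      qed simp
      then show ?thesis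
        unfolding has_field_derivative_def has_derivative_at_alt lG
        by (auto intro!: bounded_linear_mult_right) (metis add_diff_cancel_left' diff_add_cancel add.commute)
    qed
    have p: "(p has_real_derivative l (D2 0 \<phi> \<phi>)) (at 0)"
    proof -
      \<comment> \<open>Sending large s to 0 makes \<open>?G s\<close> an element of
        \<open>V\<close> for every s, as \<open>est\<close> requires: \<open>D\<close> is only
        controlled in the ball around 0.\<close>
      define m where "m s = (if \<bar>s\<bar> < e1 then s else 0)" for s
      let ?G = "\<lambda>s. D (0 + m s *\<^sub>R \<phi>) \<phi> - D 0 \<phi> - D2 0 (m s *\<^sub>R \<phi>) \<phi>"
      have m: "\<bar>m s\<bar> < e1" "\<bar>m s\<bar> \<le> \<bar>s\<bar>" for s using e1 by (auto simp: m_def)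
      have zr': "N 0 < r" using r N0 by simp
      have lG: "l (?G s) = p (m s) - p 0 - l (D2 0 \<phi> \<phi>) * m s" for s
        using DV[OF x\<phi> small[OF m(1)] \<phi>] DV[OF zr zr' \<phi>] D2V[OF \<phi> \<phi>] D2s[OF \<phi> \<phi>]
        by (simp add: ld diffV V(2) l(2) p_def)
      have ex: "\<exists>d>0. \<forall>s. \<bar>s\<bar> < d \<longrightarrow> \<bar>l (?G s)\<bar> \<le> \<epsilon> * \<bar>s\<bar>" if "0 < \<epsilon>" for \<epsilon>
      proof (rule est[OF _ that, of _ "N \<phi>"])
        show "?G s \<in> V" for s
          using DV[OF x\<phi> small[OF m(1)] \<phi>] by (simp add: diffV DV[OF zr zr' \<phi>] D2V[OF x\<phi> \<phi>])
        show "\<exists>\<delta>>0. \<forall>s. N (s *\<^sub>R \<phi>) < \<delta> \<longrightarrow> N (?G s) \<le> \<epsilon>' * N (s *\<^sub>R \<phi>) * N \<phi>" if \<epsilon>': "0 < \<epsilon>'" for \<epsilon>'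
        proof -
          obtain \<delta> where \<delta>: "0 < \<delta>" "\<And>h k. h \<in> V \<Longrightarrow> N h < \<delta> \<Longrightarrow> k \<in> V \<Longrightarrow> N (D (0 + h) k - D 0 k - D2 0 h k) \<le> \<epsilon>' * N h * N k"
            using D2[OF zr zr' \<epsilon>'] by blast
          have "N (?G s) \<le> \<epsilon>' * N (s *\<^sub>R \<phi>) * N \<phi>" if "N (s *\<^sub>R \<phi>) < \<delta>" for s
          proof -
            have le: "N (m s *\<^sub>R \<phi>) \<le> N (s *\<^sub>R \<phi>)"
              unfolding N(2)[OF \<phi>] by (intro mult_right_mono m(2) N)
            then have "N (m s *\<^sub>R \<phi>) < \<delta>" using that by simp
            from \<delta>(2)[OF x\<phi> this \<phi>] have "N (?G s) \<le> \<epsilon>' * N (m s *\<^sub>R \<phi>) * N \<phi>" .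
            also have "\<dots> \<le> \<epsilon>' * N (s *\<^sub>R \<phi>) * N \<phi>" using \<epsilon>' by (intro mult_right_mono mult_left_mono le N) auto
            finally show ?thesis .
          qed
          then show ?thesis using \<delta>(1) by blast
        qed
      qed (rule N)
      have "\<exists>d>0. \<forall>y. norm (y - 0) < d \<longrightarrow> norm (p y - p 0 - l (D2 0 \<phi> \<phi>) * (y - 0)) \<le> \<epsilon> * norm (y - 0)" if \<epsilon>: "0 < \<epsilon>" for \<epsilon>
      proof -
        obtain d where d: "0 < d" "\<And>s. \<bar>s\<bar> < d \<Longrightarrow> \<bar>l (?G s)\<bar> \<le> \<epsilon> * \<bar>s\<bar>" using ex[OF \<epsilon>] by blast
        have "\<bar>p y - p 0 - l (D2 0 \<phi> \<phi>) * y\<bar> \<le> \<epsilon> * \<bar>y\<bar>" if "\<bar>y\<bar> < min d e1" for y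
          using d(2)[of y] that unfolding lG by (simp add: m_def)
        then show ?thesis using d(1) e1 by (intro exI[of _ "min d e1"]) auto
      qed
      then show ?thesis
        unfolding has_field_derivative_def has_derivative_at_alt
        by (intro conjI bounded_linear_mult_right) auto
    qed
    have "l (D2 0 \<phi> \<phi>) = 2 * b"
      by (rule second_derivative_eq[OF e1 f p, of a b C]) (use C in \<open>auto simp: f_def e1_def\<close>)
    then have "\<bar>2 * b\<bar> \<le> c * N (D2 0 \<phi> \<phi>)" using l(3)[OF D2V[OF \<phi> \<phi>]] by simp
    also have "\<dots> \<le> c * (\<bar>K0\<bar> * N \<phi> * N \<phi>)"
    proof (intro mult_left_mono c order_trans[OF K0[OF \<phi> \<phi>]])
      show "K0 * N \<phi> * N \<phi> \<le> \<bar>K0\<bar> * N \<phi> * N \<phi>" by (intro mult_right_mono N) auto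
    qed
    finally show "\<bar>2 * b\<bar> \<le> c * \<bar>K0\<bar> * (N \<phi>)\<^sup>2" by (simp add: power2_eq_square mult.assoc)
  qed
qed

section \<open>Linear functionals on Sobolev spaces\<close>

lemma sobolev_hat:
  assumes "L \<in> sobolev s1 s2"
  shows "has_fourier L (hat L)" "integrable lborel (\<lambda>\<zeta>. sobolev_weight s1 s2 \<zeta> * (cmod (hat L \<zeta>))\<^sup>2)"
    "(sobolev_norm s1 s2 L)\<^sup>2 = (\<integral>\<zeta>. sobolev_weight s1 s2 \<zeta> * (cmod (hat L \<zeta>))\<^sup>2 \<partial>lborel)"
proof -
  show h: "has_fourier L (hat L)" and i: "integrable lborel (\<lambda>\<zeta>. sobolev_weight s1 s2 \<zeta> * (cmod (hat L \<zeta>))\<^sup>2)"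
    using assms hat_works by (auto simp: sobolev_def)
  show "(sobolev_norm s1 s2 L)\<^sup>2 = (\<integral>\<zeta>. sobolev_weight s1 s2 \<zeta> * (cmod (hat L \<zeta>))\<^sup>2 \<partial>lborel)"
    by (rule sobolevI(2)[OF h i])
qed

lemma sobolev_scaleR:
  assumes L: "L \<in> sobolev s1 s2"
  shows "r *\<^sub>R L \<in> sobolev s1 s2" and "sobolev_norm s1 s2 (r *\<^sub>R L) = \<bar>r\<bar> * sobolev_norm s1 s2 L"
proof -
  note h = sobolev_hat[OF L]
  have e: "sobolev_weight s1 s2 \<zeta> * (cmod (of_real r * hat L \<zeta>))\<^sup>2 = r\<^sup>2 * (sobolev_weight s1 s2 \<zeta> * (cmod (hat L \<zeta>))\<^sup>2)" for \<zeta>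
    by (simp add: norm_mult power_mult_distrib)
  have i: "integrable lborel (\<lambda>\<zeta>. sobolev_weight s1 s2 \<zeta> * (cmod (of_real r * hat L \<zeta>))\<^sup>2)"
    unfolding e by (intro integrable_mult_right h)
  show "r *\<^sub>R L \<in> sobolev s1 s2" by (rule sobolevI(1)[OF has_fourier_scaleR[OF h(1)] i])
  have "(sobolev_norm s1 s2 (r *\<^sub>R L))\<^sup>2 = (\<bar>r\<bar> * sobolev_norm s1 s2 L)\<^sup>2"
    unfolding sobolevI(2)[OF has_fourier_scaleR[OF h(1)] i] e power_mult_distrib h(3) by simp
  then show "sobolev_norm s1 s2 (r *\<^sub>R L) = \<bar>r\<bar> * sobolev_norm s1 s2 L"
    by (rule power2_eq_imp_eq) (auto intro: sobolev_norm_nonneg mult_nonneg_nonneg)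
qed

lemma sobolev_add:
  assumes L: "L \<in> sobolev s1 s2" and M: "M \<in> sobolev s1 s2"
  shows "L + M \<in> sobolev s1 s2"
proof (rule sobolevI(1)[OF has_fourier_add[OF sobolev_hat(1)[OF L] sobolev_hat(1)[OF M]]])
  have [measurable]: "hat L \<in> borel_measurable borel" "hat M \<in> borel_measurable borel"
    using hat_borel[OF sobolev_hat(1)[OF L]] hat_borel[OF sobolev_hat(1)[OF M]] .
  let ?b = "\<lambda>\<zeta>. 2 * (sobolev_weight s1 s2 \<zeta> * (cmod (hat L \<zeta>))\<^sup>2) + 2 * (sobolev_weight s1 s2 \<zeta> * (cmod (hat M \<zeta>))\<^sup>2)"
  have i: "integrable lborel ?b"
    by (intro Bochner_Integration.integrable_add integrable_mult_right sobolev_hat(2)[OF L] sobolev_hat(2)[OF M])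
  have le: "norm (sobolev_weight s1 s2 \<zeta> * (cmod (hat L \<zeta> + hat M \<zeta>))\<^sup>2) \<le> ?b \<zeta>" for \<zeta>
  proof -
    have "(cmod (hat L \<zeta> + hat M \<zeta>))\<^sup>2 \<le> (cmod (hat L \<zeta>) + cmod (hat M \<zeta>))\<^sup>2"
      by (intro power_mono norm_triangle_ineq) simp
    also have "\<dots> \<le> 2 * (cmod (hat L \<zeta>))\<^sup>2 + 2 * (cmod (hat M \<zeta>))\<^sup>2"
      using sum_squares_bound[of "cmod (hat L \<zeta>)" "cmod (hat M \<zeta>)"] by (simp add: power2_sum)
    finally have "sobolev_weight s1 s2 \<zeta> * (cmod (hat L \<zeta> + hat M \<zeta>))\<^sup>2 \<le> sobolev_weight s1 s2 \<zeta> * (2 * (cmod (hat L \<zeta>))\<^sup>2 + 2 * (cmod (hat M \<zeta>))\<^sup>2)"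
      by (intro mult_left_mono sobolev_weight_nonneg)
    then show ?thesis by (simp add: sobolev_weight_nonneg abs_mult algebra_simps)
  qed
  show "integrable lborel (\<lambda>\<zeta>. sobolev_weight s1 s2 \<zeta> * (cmod (hat L \<zeta> + hat M \<zeta>))\<^sup>2)"
  proof (rule Bochner_Integration.integrable_bound[OF i])
    show "AE \<zeta> in lborel. norm (sobolev_weight s1 s2 \<zeta> * (cmod (hat L \<zeta> + hat M \<zeta>))\<^sup>2) \<le> norm (?b \<zeta>)"
      using order_trans[OF le abs_ge_self] by (intro always_eventually allI) (simp only: real_norm_def)
  qed measurable
qed

text \<open>The optimal r is B / A; adding d to numerator and denominator keeps it positive and
  finite when A or B is 0. Together with a pointwise inequality this replaces
  Cauchy-Schwarz.\<close>

lemma le_of_weighted_AM_GM: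
  fixes x A B :: real
  assumes x: "\<And>r. 0 < r \<Longrightarrow> x \<le> (r * A\<^sup>2 + B\<^sup>2 / r) / 2" and A: "0 \<le> A" and B: "0 \<le> B"
  shows "x \<le> A * B"
proof (rule field_le_epsilon)
  fix e :: real assume e: "0 < e"
  define d where "d = min 1 (e / (A + B + 1))"
  have d: "0 < d" "d \<le> 1" "d \<le> e / (A + B + 1)" using e A B by (auto simp: d_def)
  have s: "0 < A + B + 1" using A B by linarith
  define r where "r = (B + d) / (A + d)"
  have r: "0 < r" using A B d by (simp add: r_def)
  have "r * A\<^sup>2 \<le> r * (A + d)\<^sup>2" using r A d by (intro mult_left_mono power_mono) auto
  also have "\<dots> = (A + d) * (B + d)" using A d by (simp add: r_def power2_eq_square)
  finally have 1: "r * A\<^sup>2 \<le> (A + d) * (B + d)" .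
  have "B\<^sup>2 / r \<le> (B + d)\<^sup>2 / r" using r B d by (intro divide_right_mono power_mono) auto
  also have "\<dots> = (A + d) * (B + d)" using A B d by (simp add: r_def power2_eq_square field_simps)
  finally have "x \<le> (A + d) * (B + d)" using x[OF r] 1 by simp
  also have "\<dots> = A * B + d * (A + B + d)" by (simp add: algebra_simps)
  also have "\<dots> \<le> A * B + d * (A + B + 1)" using d by (intro add_left_mono mult_left_mono) auto
  also have "d * (A + B + 1) \<le> e" using d(3) s by (simp add: pos_le_divide_eq)
  finally show "x \<le> A * B + e" by simp
qed

text \<open>Bounds a Sobolev norm from below by duality on the frequency set \<open>R\<close>. The
  real part is taken because the differential calculus is over the real scalars.\<close>

definition freq_functional :: "(real \<times> real) set \<Rightarrow> (real \<times> real \<Rightarrow> complex) \<Rightarrow> tdist \<Rightarrow> real" where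
  "freq_functional R k L = Re (\<integral>\<zeta>. indicator R \<zeta> * (k \<zeta> * hat L \<zeta>) \<partial>lborel)"

text \<open>Cauchy-Schwarz on \<open>R\<close>, where the weight is at least \<open>w0\<close>. It
  is obtained from the pointwise bound \<open>?b r\<close> with a free parameter r, which yields
  integrability at the same time.\<close>

lemma freq_functional_bound:
  assumes L: "L \<in> sobolev s1 s2" and R: "R \<in> sets borel" "emeasure lborel R < \<infinity>"
    and w0: "0 < w0" "\<And>\<zeta>. \<zeta> \<in> R \<Longrightarrow> w0 \<le> sobolev_weight s1 s2 \<zeta>"
    and k: "k \<in> borel_measurable borel" "\<And>\<zeta>. cmod (k \<zeta>) \<le> 1"
  shows "integrable lborel (\<lambda>\<zeta>. indicator R \<zeta> * (k \<zeta> * hat L \<zeta>))"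
    and "\<bar>freq_functional R k L\<bar> \<le> sqrt (measure lborel R / w0) * sobolev_norm s1 s2 L"
proof -
  note h = sobolev_hat[OF L]
  have [measurable]: "hat L \<in> borel_measurable borel" "k \<in> borel_measurable borel" "R \<in> sets borel"
    using hat_borel[OF h(1)] k R by auto
  let ?f = "\<lambda>\<zeta>. indicator R \<zeta> * (k \<zeta> * hat L \<zeta>)"
  let ?b = "\<lambda>r \<zeta>. (r * (sobolev_weight s1 s2 \<zeta> * (cmod (hat L \<zeta>))\<^sup>2) + indicator R \<zeta> / (r * w0)) / 2"
  have iR: "integrable lborel (indicat_real R)" using R by simp
  have ib: "integrable lborel (?b r)" for r
    by (intro integrable_divide Bochner_Integration.integrable_add integrable_mult_right h iR)
  have le: "cmod (?f \<zeta>) \<le> ?b r \<zeta>" if r: "0 < r" for r \<zeta>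
  proof (cases "\<zeta> \<in> R")
    case True
    let ?x = "cmod (hat L \<zeta>)" and ?w = "sobolev_weight s1 s2 \<zeta>"
    have "0 \<le> (r * w0 * ?x - 1)\<^sup>2" by simp
    then have "2 * (r * w0 * ?x) \<le> (r * w0 * ?x)\<^sup>2 + 1" by (simp add: power2_diff)
    then have "2 * (r * w0 * ?x) / (r * w0) \<le> ((r * w0 * ?x)\<^sup>2 + 1) / (r * w0)"
      using r w0 by (intro divide_right_mono) auto
    then have "2 * ?x \<le> r * w0 * ?x\<^sup>2 + 1 / (r * w0)"
      using r w0 by (simp add: add_divide_distrib power2_eq_square mult_ac)
    also have "\<dots> \<le> r * ?w * ?x\<^sup>2 + 1 / (r * w0)"
      using r w0(2)[OF True] by (intro add_right_mono mult_right_mono mult_left_mono) auto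
    finally have "?x \<le> ?b r \<zeta>" using True by (simp add: mult.assoc)
    moreover have "cmod (?f \<zeta>) \<le> ?x" using True k(2)[of \<zeta>] by (simp add: norm_mult mult_left_le_one_le)
    ultimately show ?thesis by simp
  next
    case False
    then show ?thesis using r w0 by (simp add: sobolev_weight_nonneg)
  qed
  show i: "integrable lborel ?f"
  proof (rule Bochner_Integration.integrable_bound[OF ib[of 1]])
    show "AE \<zeta> in lborel. norm (?f \<zeta>) \<le> norm (?b 1 \<zeta>)"
      using order_trans[OF le[OF zero_less_one] abs_ge_self] by (intro always_eventually allI) (simp only: real_norm_def)
  qed measurable
  have "\<bar>freq_functional R k L\<bar> \<le> sobolev_norm s1 s2 L * sqrt (measure lborel R / w0)"
  proof (rule le_of_weighted_AM_GM)
    fix r :: real assume r: "0 < r"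
    have "\<bar>freq_functional R k L\<bar> \<le> cmod (\<integral>\<zeta>. ?f \<zeta> \<partial>lborel)"
      unfolding freq_functional_def by (rule abs_Re_le_cmod)
    also have "\<dots> \<le> (\<integral>\<zeta>. ?b r \<zeta> \<partial>lborel)"
      by (rule Bochner_Integration.integral_norm_bound_integral[OF i ib]) (rule le[OF r])
    also have "\<dots> = (r * (sobolev_norm s1 s2 L)\<^sup>2 + measure lborel R / (r * w0)) / 2"
      unfolding h(3) using h(2) iR R by simp
    also have "measure lborel R / (r * w0) = (sqrt (measure lborel R / w0))\<^sup>2 / r"
      using w0 by simp
    finally show "\<bar>freq_functional R k L\<bar> \<le> (r * (sobolev_norm s1 s2 L)\<^sup>2 + (sqrt (measure lborel R / w0))\<^sup>2 / r) / 2" .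
  qed (use w0 in \<open>auto intro: sobolev_norm_nonneg\<close>)
  then show "\<bar>freq_functional R k L\<bar> \<le> sqrt (measure lborel R / w0) * sobolev_norm s1 s2 L"
    by (simp add: mult.commute)
qed

lemma freq_functional_eq:
  assumes L: "has_fourier L g" and [measurable]: "k \<in> borel_measurable borel" "R \<in> sets borel"
  shows "freq_functional R k L = Re (\<integral>\<zeta>. indicator R \<zeta> * (k \<zeta> * g \<zeta>) \<partial>lborel)"
proof -
  have [measurable]: "g \<in> borel_measurable borel" "hat L \<in> borel_measurable borel"
    using L hat_borel[OF L] by (auto simp: has_fourier_def)
  have ae: "AE \<zeta> in lborel. indicator R \<zeta> * (k \<zeta> * hat L \<zeta>) = indicator R \<zeta> * (k \<zeta> * g \<zeta>)"
    using hat_AE[OF L] by eventually_elim simp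
  show ?thesis
    unfolding freq_functional_def by (subst integral_cong_AE[OF _ _ ae]) measurable
qed

lemma freq_functional_add:
  assumes L: "L \<in> sobolev s1 s2" and M: "M \<in> sobolev s1 s2" and R: "R \<in> sets borel" "emeasure lborel R < \<infinity>"
    and w0: "0 < w0" "\<And>\<zeta>. \<zeta> \<in> R \<Longrightarrow> w0 \<le> sobolev_weight s1 s2 \<zeta>"
    and k: "k \<in> borel_measurable borel" "\<And>\<zeta>. cmod (k \<zeta>) \<le> 1"
  shows "freq_functional R k (L + M) = freq_functional R k L + freq_functional R k M"
proof -
  have "indicator R \<zeta> * (k \<zeta> * (hat L \<zeta> + hat M \<zeta>)) = indicator R \<zeta> * (k \<zeta> * hat L \<zeta>) + indicator R \<zeta> * (k \<zeta> * hat M \<zeta>)" for \<zeta>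
    by (simp add: algebra_simps)
  then show ?thesis
    unfolding freq_functional_eq[OF has_fourier_add[OF sobolev_hat(1)[OF L] sobolev_hat(1)[OF M]] k(1) R(1)]
    using freq_functional_bound(1)[OF L R w0 k] freq_functional_bound(1)[OF M R w0 k]
    by (simp add: freq_functional_def)
qed

lemma freq_functional_scaleR:
  assumes L: "L \<in> sobolev s1 s2" and R: "R \<in> sets borel" and k: "k \<in> borel_measurable borel"
  shows "freq_functional R k (r *\<^sub>R L) = r * freq_functional R k L"
proof -
  have e: "indicator R \<zeta> * (k \<zeta> * (of_real r * hat L \<zeta>)) = of_real r * (indicator R \<zeta> * (k \<zeta> * hat L \<zeta>))" for \<zeta>
    by simp
  show ?thesis
    unfolding freq_functional_eq[OF has_fourier_scaleR[OF sobolev_hat(1)[OF L]] k R] e integral_mult_right_zero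
    unfolding freq_functional_def by simp
qed

section \<open>Second order expansion of the flow\<close>

lemma conv_diff:
  assumes f: "f \<in> borel_measurable borel" "\<And>\<zeta>. cmod (f \<zeta>) \<le> A * majorant T t \<zeta>"
    and g: "g \<in> borel_measurable borel" "\<And>\<zeta>. cmod (g \<zeta>) \<le> A * majorant T t \<zeta>" and A: "0 \<le> A"
  shows "conv f f \<zeta> - conv g g \<zeta> = conv (\<lambda>p. f p - g p) f \<zeta> + conv g (\<lambda>p. f p - g p) \<zeta>"
proof -
  note i = conv_bound(1)[OF f(1) f(1) f(2) f(2) A A, of \<zeta>] conv_bound(1)[OF g(1) f(1) g(2) f(2) A A, of \<zeta>]
    conv_bound(1)[OF g(1) g(1) g(2) g(2) A A, of \<zeta>]
  show ?thesis unfolding conv_def using i by (simp add: left_diff_distrib right_diff_distrib)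
qed

lemma duhamel_diff:
  assumes U: "case_prod U \<in> borel_measurable (borel \<Otimes>\<^sub>M borel)" and V: "case_prod V \<in> borel_measurable (borel \<Otimes>\<^sub>M borel)"
    and A: "0 \<le> A" and t: "t \<in> {0..T}"
    and bU: "\<And>s \<zeta>. s \<in> {0..T} \<Longrightarrow> cmod (U s \<zeta>) \<le> A * majorant T s \<zeta>"
    and bV: "\<And>s \<zeta>. s \<in> {0..T} \<Longrightarrow> cmod (V s \<zeta>) \<le> A * majorant T s \<zeta>"
  shows "duhamel \<alpha> U U t \<zeta> - duhamel \<alpha> V V t \<zeta>
    = duhamel \<alpha> (\<lambda>s p. U s p - V s p) U t \<zeta> + duhamel \<alpha> V (\<lambda>s p. U s p - V s p) t \<zeta>"
proof -
  let ?D = "\<lambda>s p. U s p - V s p"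
  let ?I = "\<lambda>F G s. indicat_real {0..t} s *\<^sub>R (cis (s * dispersion \<alpha> \<zeta>) * conv (F s) (G s) \<zeta>)"
  have D: "case_prod ?D \<in> borel_measurable (borel \<Otimes>\<^sub>M borel)"
    unfolding split_beta' using U V unfolding split_beta' by (intro borel_measurable_diff)
  have A2: "0 \<le> A + A" using A by simp
  have bD: "cmod (?D s \<zeta>) \<le> (A + A) * majorant T s \<zeta>" if "s \<in> {0..T}" for s \<zeta>
    using norm_triangle_ineq4[of "U s \<zeta>" "V s \<zeta>"] bU[OF that, of \<zeta>] bV[OF that, of \<zeta>] by (simp add: distrib_right)
  note i = duhamel_bound(1)[OF U U A A t bU bU, of \<alpha> \<zeta>] duhamel_bound(1)[OF V V A A t bV bV, of \<alpha> \<zeta>]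
    duhamel_bound(1)[OF D U A2 A t bD bU, of \<alpha> \<zeta>] duhamel_bound(1)[OF V D A A2 t bV bD, of \<alpha> \<zeta>]
  have e: "?I U U s - ?I V V s = ?I ?D U s + ?I V ?D s" for s
  proof (cases "s \<in> {0..t}")
    case True
    then have s: "s \<in> {0..T}" using t by auto
    have m: "U s \<in> borel_measurable borel" "V s \<in> borel_measurable borel"
      using measurable_uncurry[OF U measurable_const measurable_ident_sets] measurable_uncurry[OF V measurable_const measurable_ident_sets] by auto
    have "conv (U s) (U s) \<zeta> - conv (V s) (V s) \<zeta> = conv (?D s) (U s) \<zeta> + conv (V s) (?D s) \<zeta>"
      by (rule conv_diff[OF m(1) bU[OF s] m(2) bV[OF s] A])
    then show ?thesis using True by (simp only: indicator_simps scaleR_one right_diff_distrib[symmetric] distrib_left[symmetric])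
  qed simp
  have "(LINT s:{0..t}|lborel. cis (s * dispersion \<alpha> \<zeta>) * conv (U s) (U s) \<zeta>) - (LINT s:{0..t}|lborel. cis (s * dispersion \<alpha> \<zeta>) * conv (V s) (V s) \<zeta>)
    = (\<integral>s. ?I U U s - ?I V V s \<partial>lborel)"
    unfolding set_lebesgue_integral_def using i(1,2) unfolding set_integrable_def by simp
  also have "\<dots> = (LINT s:{0..t}|lborel. cis (s * dispersion \<alpha> \<zeta>) * conv (?D s) (U s) \<zeta>) + (LINT s:{0..t}|lborel. cis (s * dispersion \<alpha> \<zeta>) * conv (V s) (?D s) \<zeta>)"
    unfolding e set_lebesgue_integral_def using i(3,4) unfolding set_integrable_def by simp
  finally show ?thesis
    unfolding duhamel_def right_diff_distrib[symmetric] distrib_left[symmetric] by (rule arg_cong)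
qed

lemma duhamel_scale:
  "duhamel \<alpha> (\<lambda>s p. c * U s p) (\<lambda>s p. c * U s p) t \<zeta> = c\<^sup>2 * duhamel \<alpha> U U t \<zeta>"
proof -
  have "conv (\<lambda>p. c * U s p) (\<lambda>p. c * U s p) \<zeta> = c\<^sup>2 * conv (U s) (U s) \<zeta>" for s
  proof -
    have "c * U s (\<zeta> - p) * (c * U s p) = c\<^sup>2 * (U s (\<zeta> - p) * U s p)" for p by (simp add: power2_eq_square)
    then show ?thesis unfolding conv_def by (simp only: integral_mult_right_zero)
  qed
  then have "indicat_real {0..t} s *\<^sub>R (cis (s * dispersion \<alpha> \<zeta>) * conv (\<lambda>p. c * U s p) (\<lambda>p. c * U s p) \<zeta>)
    = c\<^sup>2 * (indicat_real {0..t} s *\<^sub>R (cis (s * dispersion \<alpha> \<zeta>) * conv (U s) (U s) \<zeta>))" for s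
    by simp
  then show ?thesis
    unfolding duhamel_def set_lebesgue_integral_def by (simp only: integral_mult_right_zero mult_ac)
qed

definition free_evolution :: "real \<Rightarrow> (real \<times> real \<Rightarrow> complex) \<Rightarrow> real \<Rightarrow> real \<times> real \<Rightarrow> complex" where
  "free_evolution \<alpha> g t \<zeta> = cis (- (t * dispersion \<alpha> \<zeta>)) * g \<zeta>"

lemma measurable_free_evolution:
  assumes g: "g \<in> borel_measurable borel"
  shows "case_prod (free_evolution \<alpha> g) \<in> borel_measurable (borel \<Otimes>\<^sub>M borel)"
  unfolding free_evolution_def split_beta'
  by (intro borel_measurable_times borel_measurable_cis borel_measurable_uminus
      measurable_compose[OF measurable_snd g] measurable_compose[OF measurable_snd borel_measurable_dispersion]
      measurable_fst)

context fourier_solution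
begin

text \<open>\<open>U\<close> and the free evolution \<open>V\<close> differ by a Duhamel term of
  order \<delta>^2. Replacing \<open>U\<close> by \<open>V\<close> in the quadratic term produces
  two bilinear terms with one such difference each, hence an error of order \<delta>^3.\<close>

lemma second_order_expansion:
  assumes gb: "\<And>\<zeta>. cmod (g \<zeta>) \<le> \<delta> * majorant T 0 \<zeta>" and t: "t \<in> {0..T}"
  defines "V \<equiv> free_evolution \<alpha> g"
  shows "cmod (U t \<zeta> - V t \<zeta> - cis (- (t * dispersion \<alpha> \<zeta>)) * duhamel \<alpha> V V t \<zeta>) \<le> 2 * \<delta> ^ 3 * conv_const\<^sup>2 * majorant T t \<zeta>"
proof -
  have gm: "g \<in> borel_measurable borel" using g by auto
  have V: "case_prod V \<in> borel_measurable (borel \<Otimes>\<^sub>M borel)" unfolding V_def by (rule measurable_free_evolution[OF gm])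
  have bV: "cmod (V s \<zeta>) \<le> \<delta> * majorant T s \<zeta>" if "s \<in> {0..T}" for s \<zeta>
    using that \<delta> by (simp add: V_def free_evolution_def norm_mult) (intro order_trans[OF gb] mult_left_mono majorant_mono; simp)
  let ?D = "\<lambda>s p. U s p - V s p"
  have D: "case_prod ?D \<in> borel_measurable (borel \<Otimes>\<^sub>M borel)"
    unfolding split_beta' using U V unfolding split_beta' by (intro borel_measurable_diff)
  have De: "?D s \<zeta> = cis (- (s * dispersion \<alpha> \<zeta>)) * duhamel \<alpha> U U s \<zeta>" for s \<zeta>
    by (subst eq) (simp add: V_def free_evolution_def algebra_simps)
  have nn: "0 \<le> \<delta> * \<delta> * conv_const" using \<delta> conv_const_nonneg by simp
  have bD: "cmod (?D s \<zeta>) \<le> \<delta> * \<delta> * conv_const * majorant T s \<zeta>" if "s \<in> {0..T}" for s \<zeta>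
    unfolding De norm_mult norm_cis mult_1_left by (rule duhamel_bound(2)[OF U U \<delta> \<delta> that bound bound])
  have "U t \<zeta> - V t \<zeta> - cis (- (t * dispersion \<alpha> \<zeta>)) * duhamel \<alpha> V V t \<zeta>
    = cis (- (t * dispersion \<alpha> \<zeta>)) * (duhamel \<alpha> U U t \<zeta> - duhamel \<alpha> V V t \<zeta>)"
    by (simp only: De right_diff_distrib)
  also have "cmod \<dots> = cmod (duhamel \<alpha> ?D U t \<zeta> + duhamel \<alpha> V ?D t \<zeta>)"
  proof -
    have "duhamel \<alpha> U U t \<zeta> - duhamel \<alpha> V V t \<zeta> = duhamel \<alpha> ?D U t \<zeta> + duhamel \<alpha> V ?D t \<zeta>"
      by (rule duhamel_diff[OF U V \<delta> t bound bV])
    then show ?thesis by (simp only: norm_mult norm_cis mult_1_left)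
  qed
  also have "\<dots> \<le> cmod (duhamel \<alpha> ?D U t \<zeta>) + cmod (duhamel \<alpha> V ?D t \<zeta>)" by (rule norm_triangle_ineq)
  also have "\<dots> \<le> (\<delta> * \<delta> * conv_const) * \<delta> * conv_const * majorant T t \<zeta> + \<delta> * (\<delta> * \<delta> * conv_const) * conv_const * majorant T t \<zeta>"
    by (intro add_mono duhamel_bound(2)[OF D U nn \<delta> t bD bound] duhamel_bound(2)[OF V D \<delta> nn t bV bD])
  also have "\<dots> = 2 * \<delta> ^ 3 * conv_const\<^sup>2 * majorant T t \<zeta>" by (simp add: power3_eq_cube power2_eq_square)
  finally show ?thesis .
qed

end

lemma dist_of_scale:
  assumes q: "integrable lborel q"
  shows "x *\<^sub>R dist_of q = dist_of (\<lambda>\<zeta>. of_real x * q \<zeta>)"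
  by (rule has_fourier_inj[OF has_fourier_scaleR[OF has_fourier_dist_of[OF q]] has_fourier_dist_of])
     (intro integrable_mult_right q)

text \<open>For small x the data x q fall under the Picard construction, and the uniqueness
  assumption identifies the constructed solution with the value of S. Since the linear and quadratic
  terms are homogeneous in x, the expansion of the solution becomes one in powers of x.\<close>

lemma flow_expansion:
  assumes T: "0 \<le> T" and t: "t \<in> {0..T}"
    and q: "q \<in> borel_measurable borel" "\<And>\<zeta>. cmod (q \<zeta>) \<le> K * majorant T 0 \<zeta>" and K: "0 \<le> K"
    and a: "0 < a" "\<And>\<zeta>. fst \<zeta> < a \<Longrightarrow> q \<zeta> = 0"
    and S: "\<And>\<phi> u. \<phi> \<in> sobolev s1 s2 \<Longrightarrow> is_solution \<alpha> s1 s2 T \<phi> u \<Longrightarrow> u t = S \<phi>"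
    and k: "k \<in> borel_measurable borel" "\<And>\<zeta>. cmod (k \<zeta>) \<le> 1" and R: "R \<in> sets borel"
  defines "V \<equiv> free_evolution \<alpha> q"
  shows "\<exists>e>0. \<exists>C. \<forall>x. \<bar>x\<bar> < e \<longrightarrow>
    \<bar>freq_functional R k (S (x *\<^sub>R dist_of q)) - x * Re (\<integral>\<zeta>. indicator R \<zeta> * (k \<zeta> * V t \<zeta>) \<partial>lborel)
      - x\<^sup>2 * Re (\<integral>\<zeta>. indicator R \<zeta> * (k \<zeta> * (cis (- (t * dispersion \<alpha> \<zeta>)) * duhamel \<alpha> V V t \<zeta>)) \<partial>lborel)\<bar> \<le> C * \<bar>x\<bar> ^ 3"
proof -
  have qi: "integrable lborel q" by (rule integrable_le_majorant[OF q T K])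
  have Vm: "case_prod V \<in> borel_measurable (borel \<Otimes>\<^sub>M borel)" unfolding V_def by (rule measurable_free_evolution[OF q(1)])
  have bV: "cmod (V s \<zeta>) \<le> K * majorant T s \<zeta>" if "s \<in> {0..T}" for s \<zeta>
    using that K by (simp add: V_def free_evolution_def norm_mult) (intro order_trans[OF q(2)] mult_left_mono majorant_mono; simp)
  have tT: "t \<le> T" using t by simp
  define P where "P \<zeta> = cis (- (t * dispersion \<alpha> \<zeta>)) * duhamel \<alpha> V V t \<zeta>" for \<zeta>
  have Vb: "V t \<in> borel_measurable borel"
    using measurable_uncurry[OF Vm measurable_const measurable_ident_sets] by auto
  have Pb: "P \<in> borel_measurable borel"
    unfolding P_def
    by (intro borel_measurable_times borel_measurable_cis borel_measurable_uminus borel_measurable_const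
        measurable_uncurry[OF measurable_duhamel[OF Vm Vm]] borel_measurable_dispersion measurable_ident_sets) simp
  have Pi: "integrable lborel P"
  proof (rule integrable_le_majorant[OF Pb _ tT])
    show "cmod (P \<zeta>) \<le> K * K * conv_const * majorant T t \<zeta>" for \<zeta>
      unfolding P_def norm_mult norm_cis mult_1_left by (rule duhamel_bound(2)[OF Vm Vm K K t bV bV])
  qed (use K conv_const_nonneg in simp)
  have Vi: "integrable lborel (V t)" by (rule integrable_le_majorant[OF Vb bV[OF t] tT K])
  have ki: "integrable lborel (\<lambda>\<zeta>. indicator R \<zeta> * (k \<zeta> * f \<zeta>))" if f: "integrable lborel f" for f
  proof (rule Bochner_Integration.integrable_bound[OF f])
    show "(\<lambda>\<zeta>. indicator R \<zeta> * (k \<zeta> * f \<zeta>)) \<in> borel_measurable lborel"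
      using borel_measurable_integrable[OF f] k(1) R by (intro borel_measurable_times) auto
    show "AE \<zeta> in lborel. norm (indicator R \<zeta> * (k \<zeta> * f \<zeta>)) \<le> norm (f \<zeta>)"
      using k(2) by (auto simp: norm_mult indicator_def mult_left_le_one_le)
  qed
  \<comment> \<open>For |x| < e the radius \<delta> = 2 |x| K satisfies the smallness condition of
    the iteration; 16 in \<open>C\<close> comes from 2 \<delta>^3 = 16 |x|^3 K^3.\<close>
  define e where "e = 1 / (4 * (K + 1) * (conv_const + 1))"
  define C where "C = 16 * K ^ 3 * conv_const\<^sup>2 * (\<integral>\<zeta>. decay \<zeta> \<partial>lborel)"
  have pos: "0 < 4 * (K + 1) * (conv_const + 1)" using K conv_const_nonneg by (intro mult_pos_pos) auto
  then have e: "0 < e" by (simp add: e_def)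
  have "\<bar>freq_functional R k (S (x *\<^sub>R dist_of q)) - x * Re (\<integral>\<zeta>. indicator R \<zeta> * (k \<zeta> * V t \<zeta>) \<partial>lborel)
      - x\<^sup>2 * Re (\<integral>\<zeta>. indicator R \<zeta> * (k \<zeta> * P \<zeta>) \<partial>lborel)\<bar> \<le> C * \<bar>x\<bar> ^ 3" if x: "\<bar>x\<bar> < e" for x
  proof -
    define \<delta> where "\<delta> = 2 * \<bar>x\<bar> * K"
    define g where "g \<zeta> = of_real x * q \<zeta>" for \<zeta>
    have \<delta>: "0 \<le> \<delta>" using K by (simp add: \<delta>_def)
    have gb: "cmod (g \<zeta>) \<le> \<delta> / 2 * majorant T 0 \<zeta>" for \<zeta>
      using mult_left_mono[OF q(2)[of \<zeta>], of "\<bar>x\<bar>"] by (simp add: g_def \<delta>_def norm_mult mult.assoc)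
    have "\<delta> * conv_const \<le> 2 * \<bar>x\<bar> * ((K + 1) * (conv_const + 1))"
      unfolding \<delta>_def mult.assoc using K conv_const_nonneg by (intro mult_left_mono mult_mono) auto
    also have "\<bar>x\<bar> * (4 * (K + 1) * (conv_const + 1)) < 1"
      using x pos unfolding e_def by (simp only: pos_less_divide_eq)
    then have "4 * (\<bar>x\<bar> * ((K + 1) * (conv_const + 1))) < 1" by (simp only: mult_ac)
    then have "2 * \<bar>x\<bar> * ((K + 1) * (conv_const + 1)) \<le> 1 / 2" by (simp only: mult.assoc)
    finally have \<delta>2: "\<delta> * conv_const \<le> 1 / 2" .
    have gm: "g \<in> borel_measurable borel" unfolding g_def using q(1) by (intro borel_measurable_times) auto
    have gs: "g p = 0" if "fst p < a" for p using a(2)[OF that] by (simp add: g_def)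
    obtain U where U: "case_prod U \<in> borel_measurable (borel \<Otimes>\<^sub>M borel)"
      "\<And>t \<zeta>. t \<in> {0..T} \<Longrightarrow> cmod (U t \<zeta>) \<le> \<delta> * majorant T t \<zeta>"
      "\<And>t \<zeta>. U t \<zeta> = cis (- (t * dispersion \<alpha> \<zeta>)) * (g \<zeta> + duhamel \<alpha> U U t \<zeta>)"
      using integral_equation_solution[OF gm gb \<delta> \<delta>2 gs a(1)] by metis
    have gi: "integrable lborel g" unfolding g_def by (intro integrable_mult_right qi)
    interpret sol: fourier_solution \<alpha> T \<delta> g U
      by standard (use T \<delta> gi U in auto)
    have g0: "dist_of g = x *\<^sub>R dist_of q" unfolding g_def by (rule dist_of_scale[OF qi, symmetric])
    have "dist_of g \<in> sobolev s1 s2" using sol.U_sobolev[of 0 s1 s2] T by (simp add: sol.U_0)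
    from S[OF this sol.solution] have SU: "S (x *\<^sub>R dist_of q) = dist_of (U t)" by (simp add: g0)
    have fr: "free_evolution \<alpha> g = (\<lambda>s p. of_real x * V s p)"
      by (simp add: fun_eq_iff free_evolution_def V_def g_def)
    let ?E = "\<lambda>\<zeta>. U t \<zeta> - of_real x * V t \<zeta> - of_real (x\<^sup>2) * P \<zeta>"
    have gb': "cmod (g \<zeta>) \<le> \<delta> * majorant T 0 \<zeta>" for \<zeta>
      using gb[of \<zeta>] mult_nonneg_nonneg[OF \<delta> majorant_nonneg[of T 0 \<zeta>]] by simp
    have E: "cmod (?E \<zeta>) \<le> 2 * \<delta> ^ 3 * conv_const\<^sup>2 * decay \<zeta>" for \<zeta>
    proof -
      have "?E \<zeta> = U t \<zeta> - free_evolution \<alpha> g t \<zeta> - cis (- (t * dispersion \<alpha> \<zeta>)) * duhamel \<alpha> (free_evolution \<alpha> g) (free_evolution \<alpha> g) t \<zeta>"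
        unfolding fr duhamel_scale P_def by simp
      also have "cmod \<dots> \<le> 2 * \<delta> ^ 3 * conv_const\<^sup>2 * majorant T t \<zeta>" by (rule sol.second_order_expansion[OF gb' t])
      also have "\<dots> \<le> 2 * \<delta> ^ 3 * conv_const\<^sup>2 * decay \<zeta>" using \<delta> by (intro mult_left_mono majorant_le_decay tT) auto
      finally show ?thesis .
    qed
    have Ui: "integrable lborel (U t)" by (rule sol.U_integrable[OF t])
    have Ei: "integrable lborel ?E"
      by (intro Bochner_Integration.integrable_diff integrable_mult_right Ui Vi Pi)
    have "freq_functional R k (S (x *\<^sub>R dist_of q)) - x * Re (\<integral>\<zeta>. indicator R \<zeta> * (k \<zeta> * V t \<zeta>) \<partial>lborel)
      - x\<^sup>2 * Re (\<integral>\<zeta>. indicator R \<zeta> * (k \<zeta> * P \<zeta>) \<partial>lborel)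
      = Re (\<integral>\<zeta>. indicator R \<zeta> * (k \<zeta> * ?E \<zeta>) \<partial>lborel)"
    proof -
      have "(\<integral>\<zeta>. indicator R \<zeta> * (k \<zeta> * ?E \<zeta>) \<partial>lborel)
        = (\<integral>\<zeta>. indicator R \<zeta> * (k \<zeta> * U t \<zeta>) - of_real x * (indicator R \<zeta> * (k \<zeta> * V t \<zeta>)) - of_real (x\<^sup>2) * (indicator R \<zeta> * (k \<zeta> * P \<zeta>)) \<partial>lborel)"
        by (intro Bochner_Integration.integral_cong) (simp_all add: algebra_simps)
      also have "\<dots> = (\<integral>\<zeta>. indicator R \<zeta> * (k \<zeta> * U t \<zeta>) \<partial>lborel) - of_real x * (\<integral>\<zeta>. indicator R \<zeta> * (k \<zeta> * V t \<zeta>) \<partial>lborel) - of_real (x\<^sup>2) * (\<integral>\<zeta>. indicator R \<zeta> * (k \<zeta> * P \<zeta>) \<partial>lborel)"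
        using ki[OF Ui] ki[OF Vi] ki[OF Pi] by simp
      finally show ?thesis
        unfolding SU freq_functional_eq[OF sol.U_fourier[OF t] k(1) R] by simp
    qed
    also have "\<bar>\<dots>\<bar> \<le> cmod (\<integral>\<zeta>. indicator R \<zeta> * (k \<zeta> * ?E \<zeta>) \<partial>lborel)" by (rule abs_Re_le_cmod)
    also have "\<dots> \<le> (\<integral>\<zeta>. 2 * \<delta> ^ 3 * conv_const\<^sup>2 * decay \<zeta> \<partial>lborel)"
    proof (rule Bochner_Integration.integral_norm_bound_integral[OF ki[OF Ei]])
      show "integrable lborel (\<lambda>\<zeta>. 2 * \<delta> ^ 3 * conv_const\<^sup>2 * decay \<zeta>)" by (intro integrable_mult_right integrable_decay)
      show "cmod (indicator R \<zeta> * (k \<zeta> * ?E \<zeta>)) \<le> 2 * \<delta> ^ 3 * conv_const\<^sup>2 * decay \<zeta>" for \<zeta>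
      proof -
        have "cmod (indicator R \<zeta> * (k \<zeta> * ?E \<zeta>)) \<le> cmod (?E \<zeta>)"
          using k(2)[of \<zeta>] by (simp only: norm_mult) (simp add: indicator_def mult_left_le_one_le)
        then show ?thesis using E[of \<zeta>] by linarith
      qed
    qed
    also have "\<dots> = C * \<bar>x\<bar> ^ 3" by (simp add: C_def \<delta>_def power_mult_distrib)
    finally show ?thesis .
  qed
  then show ?thesis using e unfolding P_def by blast
qed

section \<open>Resonant interaction of a low and a high frequency\<close>

text \<open>With \<open>\<chi> = \<omega>(p + q) - \<omega>(p) - \<omega>(q)\<close> for \<open>p = (x, y)\<close> near \<open>0\<close> and \<open>q = (X, Z)\<close>, the leading terms
  \<open>3 x X\<^sup>2\<close> and \<open>\<alpha> x X powr (\<alpha> - 1) Z\<^sup>2\<close> of \<open>\<chi>\<close> cancel for \<open>\<bar>\<alpha>\<bar> Z\<^sup>2 = 3 X powr (3 - \<alpha>)\<close>. The sizes \<open>d\<close> and \<open>e\<close> of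
  the boxes are the largest for which the remaining terms stay bounded.\<close>

lemma resonance_bound:
  fixes \<alpha> c n :: real
  assumes \<alpha>: "-1 \<le> \<alpha>" "\<alpha> < 0" and c: "0 < c" "c \<le> 1" and n: "1 \<le> n"
  defines "N \<equiv> n\<^sup>2" and "d \<equiv> c / n" and "\<sigma> \<equiv> sqrt (3 / - \<alpha>)"
  defines "Y \<equiv> \<sigma> * n powr (3 - \<alpha>)" and "e \<equiv> c * n powr (- (3 + \<alpha>))"
  assumes x: "d \<le> x" "x \<le> 2 * d" and y: "0 \<le> y" "y \<le> e"
    and X: "N \<le> X" "X \<le> N + 2 * d" and Z: "Y \<le> Z" "Z \<le> Y + 2 * e"
  shows "\<bar>dispersion \<alpha> (x + X, y + Z) - dispersion \<alpha> (x, y) - dispersion \<alpha> (X, Z)\<bar> \<le> (133 + 22 * \<sigma>) * c"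
proof -
  define A where "A = - \<alpha>"
  have A: "0 < A" "A \<le> 1" using \<alpha> by (auto simp: A_def)
  have n0: "0 < n" using n by simp
  have N: "1 \<le> N" using n by (simp add: N_def one_le_power)
  have d: "0 < d" "d \<le> c" using c n by (auto simp: d_def divide_le_eq mult_le_cancel_left1)
  have dN: "d \<le> N" using d c N by linarith
  have "1 \<le> 3 / A" using A by (simp add: pos_le_divide_eq)
  moreover have "\<sigma> = sqrt (3 / A)" by (simp add: \<sigma>_def A_def)
  ultimately have \<sigma>: "1 \<le> \<sigma>" "\<sigma>\<^sup>2 = 3 / A" using A by auto
  have e: "0 < e" "e \<le> 1"
  proof -
    show "0 < e" using c n by (simp add: e_def)
    have "n powr (- (3 + \<alpha>)) \<le> n powr 0" using n \<alpha> by (intro powr_mono) auto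
    then have "c * n powr (- (3 + \<alpha>)) \<le> 1 * 1" using c n by (intro mult_mono) auto
    then show "e \<le> 1" by (simp add: e_def)
  qed
  have Y: "1 \<le> Y"
  proof -
    have "n powr 0 \<le> n powr (3 - \<alpha>)" using n \<alpha> by (intro powr_mono) auto
    then have "1 * 1 \<le> \<sigma> * n powr (3 - \<alpha>)" using \<sigma> n by (intro mult_mono) auto
    then show ?thesis by (simp add: Y_def)
  qed
  have eY: "e \<le> Y" using e Y by linarith
  have Nn: "N powr r = n powr (2 * r)" for r
    using n0 by (simp add: N_def powr_powr flip: powr_numeral)
  \<comment> \<open>The size \<open>e\<close> is tuned to this product, which controls the mixed
    term of the phase, containing y Z.\<close>
  have eYN: "e * Y * N powr \<alpha> = c * \<sigma>"
  proof -
    have "e * Y * N powr \<alpha> = c * \<sigma> * (n powr (- (3 + \<alpha>)) * n powr (3 - \<alpha>) * n powr (2 * \<alpha>))"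
      by (simp add: e_def Y_def Nn)
    also have "n powr (- (3 + \<alpha>)) * n powr (3 - \<alpha>) * n powr (2 * \<alpha>) = n powr (- (3 + \<alpha>) + (3 - \<alpha>) + 2 * \<alpha>)"
      by (simp only: powr_add)
    also have "\<dots> = 1" using n0 by simp
    finally show ?thesis by simp
  qed
  \<comment> \<open>The size \<open>d\<close> is tuned to this product: after the cancellation, the
    leading terms leave x times a rest of order d N.\<close>
  have ddN: "d\<^sup>2 * N = c\<^sup>2" using n0 by (simp add: d_def N_def power_divide)
  have xX: "0 < x" "0 < X" "N \<le> x + X" using x X d N by linarith+
  \<comment> \<open>The mean value theorem extracts the small frequency x as a factor, as in the
    cubic part of the phase.\<close>
  obtain z where z: "X < z" "z < x + X" "(x + X) powr \<alpha> - X powr \<alpha> = x * (\<alpha> * z powr (\<alpha> - 1))"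
  proof -
    have "\<exists>z>X. z < x + X \<and> (x + X) powr \<alpha> - X powr \<alpha> = (x + X - X) * (\<alpha> * z powr (\<alpha> - 1))"
      by (rule MVT2) (use xX in \<open>auto intro!: derivative_eq_intros\<close>)
    then show ?thesis using that by auto
  qed
  have zN: "N \<le> z" "z \<le> N + 4 * d" "0 < z" using z X x N by linarith+
  define q where "q = N / z"
  \<comment> \<open>The choice of Y turns the second leading term into - 3 x N^2 Q, see
    \<open>zY\<close>. Its defect 1 - Q is at most 1 - q^2, because 1 - \<alpha> \<le> 2; this is
    one place where \<alpha> \<ge> -1 enters.\<close>
  define Q where "Q = q powr (1 - \<alpha>)"
  have q: "0 < q" "q \<le> 1" using zN N by (auto simp: q_def)
  have Q: "Q \<le> 1" "q\<^sup>2 \<le> Q"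
  proof -
    have "q powr (1 - \<alpha>) \<le> 1 powr (1 - \<alpha>)" using q \<alpha> by (intro powr_mono2) auto
    then show "Q \<le> 1" by (simp add: Q_def)
    have "q powr 2 \<le> q powr (1 - \<alpha>)" using q \<alpha> by (intro powr_mono') auto
    then show "q\<^sup>2 \<le> Q" using q by (simp add: Q_def)
  qed
  have q1: "N * (1 - q) \<le> 4 * d"
  proof -
    have "1 - q = (z - N) / z" using zN by (simp add: q_def diff_divide_distrib)
    then have "N * (1 - q) = q * (z - N)" by (simp add: q_def)
    also have "\<dots> \<le> 1 * (z - N)" using q zN by (intro mult_right_mono) auto
    finally show ?thesis using zN by simp
  qed
  have NQ: "3 * N\<^sup>2 * (1 - Q) \<le> 24 * (d * N)"
  proof -
    have "1 - Q \<le> (1 - q) * (1 + q)" using Q by (simp add: algebra_simps power2_eq_square)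
    also have "\<dots> \<le> (1 - q) * 2" using q by (intro mult_left_mono) auto
    finally have "3 * N\<^sup>2 * (1 - Q) \<le> 3 * N\<^sup>2 * ((1 - q) * 2)" by (intro mult_left_mono) auto
    also have "\<dots> = 6 * N * (N * (1 - q))" by (simp add: power2_eq_square)
    also have "\<dots> \<le> 6 * N * (4 * d)" using N by (intro mult_left_mono q1) auto
    finally show ?thesis by (simp add: mult_ac)
  qed
  have zY: "A * z powr (\<alpha> - 1) * Y\<^sup>2 = 3 * N\<^sup>2 * Q"
  proof -
    have "Y\<^sup>2 = 3 / A * N powr (3 - \<alpha>)"
      using n0 by (simp add: Y_def power_mult_distrib \<sigma> Nn powr_power mult.commute)
    moreover have "N powr (3 - \<alpha>) = N\<^sup>2 * N powr (1 - \<alpha>)"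
      using N by (simp flip: powr_add powr_numeral)
    moreover have "Q = N powr (1 - \<alpha>) * z powr (\<alpha> - 1)"
      using zN N by (simp add: Q_def q_def powr_divide powr_minus_divide[of z "1 - \<alpha>", simplified])
    ultimately show ?thesis using A by simp
  qed
  \<comment> \<open>The resonance: each of the two terms is 3 N^2 up to an error of order d
    N.\<close>
  have b1: "\<bar>3 * (x + X) * X - A * z powr (\<alpha> - 1) * Y\<^sup>2\<bar> \<le> 66 * (d * N)"
  proof -
    have "(x + X) * X \<le> (N + 4 * d) * (N + 2 * d)" using x X N d by (intro mult_mono) auto
    also have "\<dots> = N\<^sup>2 + 6 * (d * N) + 8 * (d * d)" by (simp add: algebra_simps power2_eq_square)
    also have "d * d \<le> d * N" using d dN by (intro mult_left_mono) auto
    finally have u: "(x + X) * X \<le> N\<^sup>2 + 14 * (d * N)" by (simp add: mult.commute)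
    have "N * N \<le> (x + X) * X" using xX X N by (intro mult_mono) auto
    then have l: "N\<^sup>2 \<le> (x + X) * X" by (simp add: power2_eq_square)
    have "0 \<le> 3 * N\<^sup>2 * (1 - Q)" using Q by (intro mult_nonneg_nonneg) auto
    then show ?thesis unfolding zY using u l NQ by (simp add: algebra_simps abs_le_iff)
  qed
  have ZY: "0 \<le> Z\<^sup>2 - Y\<^sup>2" "Z\<^sup>2 - Y\<^sup>2 \<le> 8 * (e * Y)"
  proof -
    have f: "Z\<^sup>2 - Y\<^sup>2 = (Z - Y) * (Z + Y)" by (simp add: algebra_simps power2_eq_square)
    show "0 \<le> Z\<^sup>2 - Y\<^sup>2" unfolding f using Z Y by (intro mult_nonneg_nonneg) auto
    have "(Z - Y) * (Z + Y) \<le> (2 * e) * (4 * Y)" using Z Y e eY by (intro mult_mono) auto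
    then show "Z\<^sup>2 - Y\<^sup>2 \<le> 8 * (e * Y)" unfolding f by simp
  qed
  have b2: "\<bar>A * z powr (\<alpha> - 1) * (Z\<^sup>2 - Y\<^sup>2)\<bar> \<le> 8 * (c * \<sigma>) / N"
  proof -
    have "z powr (\<alpha> - 1) \<le> N powr (\<alpha> - 1)" using zN N \<alpha> by (intro powr_mono2') auto
    then have "A * z powr (\<alpha> - 1) * (Z\<^sup>2 - Y\<^sup>2) \<le> 1 * N powr (\<alpha> - 1) * (8 * (e * Y))"
      using A ZY by (intro mult_mono) auto
    also have "\<dots> = 8 * (e * Y * N powr \<alpha>) / N" using N by (simp add: powr_diff)
    finally show ?thesis unfolding eYN using A ZY by (simp add: abs_of_nonneg)
  qed
  \<comment> \<open>The part of the phase difference that contains the two cancelling leading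
    terms.\<close>
  define M where "M = 3 * (x + X) * x * X + ((x + X) powr \<alpha> - X powr \<alpha>) * Z\<^sup>2"
  have M: "\<bar>M\<bar> \<le> 132 * c + 16 * (c * \<sigma>)"
  proof -
    have "M = x * ((3 * (x + X) * X - A * z powr (\<alpha> - 1) * Y\<^sup>2) - A * z powr (\<alpha> - 1) * (Z\<^sup>2 - Y\<^sup>2))"
      unfolding M_def z(3) by (simp add: A_def algebra_simps)
    also have "\<bar>\<dots>\<bar> \<le> (2 * d) * (66 * (d * N) + 8 * (c * \<sigma>) / N)"
      unfolding abs_mult using x xX d by (intro mult_mono order_trans[OF abs_triangle_ineq4] add_mono b1 b2) auto
    also have "\<dots> = 132 * (d\<^sup>2 * N) + 16 * (c * \<sigma>) * (d / N)" by (simp add: algebra_simps power2_eq_square)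
    also have "\<dots> \<le> 132 * c + 16 * (c * \<sigma>) * 1"
    proof (intro add_mono mult_left_mono)
      show "d\<^sup>2 * N \<le> c" unfolding ddN using c by (simp add: power2_eq_square mult_left_le)
      show "d / N \<le> 1" using dN N by simp
    qed (use c \<sigma> in auto)
    finally show ?thesis by simp
  qed
  have b3: "\<bar>2 * (x + X) powr \<alpha> * y * Z\<bar> \<le> 6 * (c * \<sigma>)"
  proof -
    have "(x + X) powr \<alpha> \<le> N powr \<alpha>" using xX N \<alpha> by (intro powr_mono2') auto
    then have "2 * (x + X) powr \<alpha> * y * Z \<le> 2 * N powr \<alpha> * e * (3 * Y)"
      using y Z Y e eY by (intro mult_mono) auto
    also have "\<dots> = 6 * (e * Y * N powr \<alpha>)" by simp
    finally show ?thesis unfolding eYN using y Z Y by (simp add: abs_of_nonneg)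
  qed
  \<comment> \<open>The power of x is singular as x tends to 0, but y is at most e: the resulting
    exponent - 6 - 3 \<alpha> of n is negative, and the exponent \<alpha> + 2 of c is at least
    1.\<close>
  have b4: "\<bar>((x + X) powr \<alpha> - x powr \<alpha>) * y\<^sup>2\<bar> \<le> c"
  proof -
    have "(x + X) powr \<alpha> \<le> x powr \<alpha>" using xX \<alpha> by (intro powr_mono2') auto
    then have "\<bar>(x + X) powr \<alpha> - x powr \<alpha>\<bar> \<le> x powr \<alpha>" by (simp add: abs_le_iff)
    also have "\<dots> \<le> d powr \<alpha>" using x d \<alpha> by (intro powr_mono2') auto
    finally have "\<bar>((x + X) powr \<alpha> - x powr \<alpha>) * y\<^sup>2\<bar> \<le> d powr \<alpha> * e\<^sup>2"
      unfolding abs_mult using y by (intro mult_mono) (auto intro!: power_mono)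
    also have "\<dots> = (c powr \<alpha> * c\<^sup>2) * (n powr (- \<alpha>) * n powr (2 * (- (3 + \<alpha>))))"
      using c n0 by (simp add: d_def e_def powr_divide power_mult_distrib powr_power powr_minus_divide mult.commute)
    also have "c powr \<alpha> * c\<^sup>2 = c powr (\<alpha> + 2)" using c by (simp add: powr_add)
    also have "n powr (- \<alpha>) * n powr (2 * (- (3 + \<alpha>))) = n powr (- 6 - 3 * \<alpha>)"
      unfolding powr_add[symmetric] by (rule arg_cong) simp
    also have "c powr (\<alpha> + 2) * n powr (- 6 - 3 * \<alpha>) \<le> c powr 1 * n powr 0"
      using c n \<alpha> by (intro mult_mono powr_mono powr_mono') auto
    finally show ?thesis using c n0 by simp
  qed
  have "dispersion \<alpha> (x + X, y + Z) - dispersion \<alpha> (x, y) - dispersion \<alpha> (X, Z)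
    = M + 2 * (x + X) powr \<alpha> * y * Z + ((x + X) powr \<alpha> - x powr \<alpha>) * y\<^sup>2"
    using xX by (simp add: dispersion_def M_def algebra_simps power2_eq_square power3_eq_cube)
  also have "\<bar>\<dots>\<bar> \<le> (132 * c + 16 * (c * \<sigma>)) + 6 * (c * \<sigma>) + c"
    by (intro order_trans[OF abs_triangle_ineq] add_mono M b3 b4)
  finally show ?thesis by (simp add: algebra_simps)
qed

section \<open>Comparison of Sobolev weights\<close>

lemma japanese_le:
  assumes "\<bar>a\<bar> \<le> 4 * \<bar>b\<bar> \<or> \<bar>a\<bar> \<le> 3"
  shows "japanese a \<le> 4 * japanese b"
proof -
  have "a\<^sup>2 \<le> 16 * b\<^sup>2 \<or> a\<^sup>2 \<le> 9"
    using assms power_mono[of "\<bar>a\<bar>" "4 * \<bar>b\<bar>" 2] power_mono[of "\<bar>a\<bar>" 3 2] by (auto simp: power_mult_distrib)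
  then have "1 + a\<^sup>2 \<le> 16 * (1 + b\<^sup>2)"
  proof
    assume "a\<^sup>2 \<le> 9"
    from add_mono[OF this mult_left_mono[OF zero_le_power2[of b], of 16]] show ?thesis by simp
  qed simp
  then have "sqrt (1 + a\<^sup>2) \<le> sqrt (16 * (1 + b\<^sup>2))" by (rule real_sqrt_le_mono)
  also have "sqrt (16 * (1 + b\<^sup>2)) = sqrt 16 * sqrt (1 + b\<^sup>2)" by (rule real_sqrt_mult)
  also have "sqrt 16 = 4" by (rule real_sqrt_unique) auto
  finally show ?thesis by (simp add: japanese_def)
qed

text \<open>Comparability in both directions is assumed since r may have either sign.\<close>

lemma japanese_powr_le:
  assumes "japanese a \<le> 4 * japanese b" "japanese b \<le> 4 * japanese a"
  shows "japanese a powr r \<le> 4 powr \<bar>r\<bar> * japanese b powr r"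
proof -
  have p: "0 < japanese a" "0 < japanese b" using japanese_ge_1[of a] japanese_ge_1[of b] by linarith+
  show ?thesis
  proof (cases "0 \<le> r")
    case True
    then have "japanese a powr r \<le> (4 * japanese b) powr r" using assms p by (intro powr_mono2) auto
    then show ?thesis using True p by (simp add: powr_mult)
  next
    case False
    then have "(4 * japanese a) powr r \<le> japanese b powr r" using assms p by (intro powr_mono2') auto
    then have "4 powr (- r) * (4 powr r * japanese a powr r) \<le> 4 powr (- r) * japanese b powr r"
      using p by (intro mult_left_mono) (auto simp: powr_mult)
    also have "4 powr (- r) * (4 powr r * japanese a powr r) = japanese a powr r" by (simp add: powr_minus)
    finally show ?thesis using False by simp
  qed
qed

text \<open>The alternative with 3 serves the low box, which is compared with the origin; the
  alternative with 4 serves the high box and the output box, compared with (N, Y).\<close>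

lemma sobolev_weight_le:
  assumes "\<bar>fst p\<bar> \<le> 4 * \<bar>fst q\<bar> \<or> \<bar>fst p\<bar> \<le> 3" "\<bar>fst q\<bar> \<le> 4 * \<bar>fst p\<bar> \<or> \<bar>fst q\<bar> \<le> 3"
    and "\<bar>snd p\<bar> \<le> 4 * \<bar>snd q\<bar> \<or> \<bar>snd p\<bar> \<le> 3" "\<bar>snd q\<bar> \<le> 4 * \<bar>snd p\<bar> \<or> \<bar>snd q\<bar> \<le> 3"
  shows "sobolev_weight s1 s2 p \<le> 4 powr (2 * \<bar>s1\<bar> + 2 * \<bar>s2\<bar>) * sobolev_weight s1 s2 q"
proof -
  have "japanese (fst p) powr (2 * s1) \<le> 4 powr \<bar>2 * s1\<bar> * japanese (fst q) powr (2 * s1)"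
    "japanese (snd p) powr (2 * s2) \<le> 4 powr \<bar>2 * s2\<bar> * japanese (snd q) powr (2 * s2)"
    by (intro japanese_powr_le japanese_le assms)+
  moreover have "4 powr \<bar>2 * s1\<bar> \<le> (4::real) powr (2 * \<bar>s1\<bar> + 2 * \<bar>s2\<bar>)" "4 powr \<bar>2 * s2\<bar> \<le> (4::real) powr (2 * \<bar>s1\<bar> + 2 * \<bar>s2\<bar>)"
    by (intro powr_mono; simp)+
  ultimately have "japanese (fst p) powr (2 * s1) \<le> 4 powr (2 * \<bar>s1\<bar> + 2 * \<bar>s2\<bar>) * japanese (fst q) powr (2 * s1)"
    "japanese (snd p) powr (2 * s2) \<le> 4 powr (2 * \<bar>s1\<bar> + 2 * \<bar>s2\<bar>) * japanese (snd q) powr (2 * s2)"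
    by (meson mult_right_mono order_trans powr_ge_zero)+
  then show ?thesis by (simp add: sobolev_weight_def split_beta distrib_left)
qed

lemma sobolev_weight_pos: "0 < sobolev_weight s1 s2 p"
  using japanese_ge_1[of "fst p"] japanese_ge_1[of "snd p"]
  by (auto simp: sobolev_weight_def split_beta intro!: add_pos_pos)

text \<open>Consequently every bounded function supported on such a set lies below a multiple of the
  majorant, as the Picard construction requires of the data.\<close>

lemma majorant_lower_bound:
  assumes D: "bounded D" "\<And>p. p \<in> D \<Longrightarrow> 0 \<le> fst p" and T: "0 \<le> T"
  obtains m where "0 < m" "\<And>p. p \<in> D \<Longrightarrow> m \<le> majorant T 0 p"
proof -
  obtain \<rho> where \<rho>: "\<And>p. p \<in> D \<Longrightarrow> norm p \<le> \<rho>" using D(1) by (auto simp: bounded_iff)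
  define r where "r = max \<rho> 0"
  have r: "0 \<le> r" "\<And>p. p \<in> D \<Longrightarrow> norm p \<le> r" using \<rho> by (auto simp: r_def le_max_iff_disj)
  show ?thesis
  proof
    show "0 < inverse ((1 + r\<^sup>2)\<^sup>2) * exp (- ((T + 1) * r) - r)"
      by (intro mult_pos_pos positive_imp_inverse_positive zero_less_power one_plus_square_pos) simp
    fix p assume p: "p \<in> D"
    have "inverse ((1 + r\<^sup>2)\<^sup>2) \<le> decay p"
      unfolding decay_def
      by (intro le_imp_inverse_le power_mono add_left_mono r(2)[OF p] zero_less_power one_plus_square_pos) auto
    moreover have "exp (- ((T + 1) * r) - r) \<le> exp (- ((T + 1 - 0) * fst p) - \<bar>snd p\<bar>)"
    proof -
      have "fst p \<le> r" "\<bar>snd p\<bar> \<le> r"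
        using r(2)[OF p] norm_fst_le[of "fst p" "snd p"] norm_snd_le[of "snd p" "fst p"] by (auto simp: real_norm_def)
      moreover then have "(T + 1) * fst p \<le> (T + 1) * r" using T by (intro mult_left_mono) auto
      ultimately show ?thesis by simp
    qed
    ultimately show "inverse ((1 + r\<^sup>2)\<^sup>2) * exp (- ((T + 1) * r) - r) \<le> majorant T 0 p"
      using D(2)[OF p] less_imp_le[OF decay_pos[of p]] unfolding majorant_def by (auto intro!: mult_mono)
  qed
qed

section \<open>Lower bound for the second iterate\<close>

lemma cos_ge_half: fixes x :: real assumes "\<bar>x\<bar> \<le> 1" shows "1 / 2 \<le> cos x"
proof -
  have "cos x = 1 - 2 * (sin (x / 2))\<^sup>2" using cos_double_sin[of "x / 2"] by simp
  moreover have "\<bar>sin (x / 2)\<bar> \<le> 1 / 2" using abs_sin_x_le_abs_x[of "x / 2"] assms by simp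
  then have "(sin (x / 2))\<^sup>2 \<le> (1 / 2)\<^sup>2" by (simp add: abs_le_square_iff[symmetric])
  ultimately show ?thesis by (simp add: power_divide)
qed

lemma mem_cbox_2d: "p \<in> cbox a b \<longleftrightarrow> fst a \<le> fst p \<and> fst p \<le> fst b \<and> snd a \<le> snd p \<and> snd p \<le> snd b"
  for a b p :: "real \<times> real"
  by (cases a; cases b; cases p) (auto simp: cbox_def Basis_prod_def)

lemma measure_cbox_2d:
  fixes a b c d :: real
  assumes "a \<le> b" "c \<le> d"
  shows "measure lborel (cbox (a, c) (b, d)) = (b - a) * (d - c)"
  using assms by (simp add: content_Pair)

lemma integrable_indicator_cbox: "integrable lborel (indicat_real (cbox a b))" for a b :: "'a::euclidean_space"
  by (rule integrable_real_indicator) (simp, rule emeasure_bounded_finite[OF bounded_cbox])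

text \<open>Output frequencies in \<open>R\<close> arise only from one low and one high frequency:
  two low ones give \<xi> \<le> 4 d < N, two high ones give \<xi> \<ge> 2 N > N + 4 d. For such
  pairs the phase times s is at most 1 in modulus, so the cosine is at least 1 / 2 and nothing
  cancels, neither in frequency nor in time. The factors are N from the derivative, T from time, and
  the area d e once from \<open>D1\<close> and once from \<open>R\<close>.\<close>

lemma duhamel_lower_bound:
  fixes N Y d e \<beta> T :: real
  assumes T: "0 < T" and d: "0 < d" and e: "0 < e" and N: "0 < N" and \<beta>: "0 \<le> \<beta>" and dN: "4 * d < N"
  defines "D1 \<equiv> cbox (d, 0) (2 * d, e)" and "D2 \<equiv> cbox (N, Y) (N + 2 * d, Y + 2 * e)"
    and "R \<equiv> cbox (N + 2 * d, Y + e) (N + 3 * d, Y + 2 * e)"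
  defines "r \<equiv> \<lambda>\<zeta>. indicat_real D1 \<zeta> + \<beta> * indicat_real D2 \<zeta>"
  defines "q \<equiv> \<lambda>\<zeta>. complex_of_real (r \<zeta>)"
  assumes q: "\<And>\<zeta>. cmod (q \<zeta>) \<le> K * majorant T 0 \<zeta>" and K: "0 \<le> K"
    and res: "\<And>p p'. p \<in> D1 \<Longrightarrow> p' \<in> D2 \<Longrightarrow> T * \<bar>dispersion \<alpha> (p + p') - dispersion \<alpha> p - dispersion \<alpha> p'\<bar> \<le> 1"
  defines "V \<equiv> free_evolution \<alpha> q"
  shows "N * T * \<beta> * (d * e)\<^sup>2 / (4 * (2 * pi)\<^sup>2) \<le>
    Re (\<integral>\<zeta>. indicator R \<zeta> * ((- \<i> * cis (T * dispersion \<alpha> \<zeta>)) * (cis (- (T * dispersion \<alpha> \<zeta>)) * duhamel \<alpha> V V T \<zeta>)) \<partial>lborel)"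
proof -
  let ?D = "dispersion \<alpha>"
  have TT: "T \<in> {0..T}" using T by simp
  have sets [measurable]: "D1 \<in> sets borel" "D2 \<in> sets borel" "R \<in> sets borel" by (auto simp: D1_def D2_def R_def)
  have rb [measurable]: "r \<in> borel_measurable borel" unfolding r_def by measurable
  have qb [measurable]: "q \<in> borel_measurable borel" unfolding q_def by measurable
  have r0: "0 \<le> r \<zeta>" for \<zeta> using \<beta> by (simp add: r_def)
  have Vm: "case_prod V \<in> borel_measurable (borel \<Otimes>\<^sub>M borel)" unfolding V_def by (rule measurable_free_evolution[OF qb])
  have bV: "cmod (V s \<zeta>) \<le> K * majorant T s \<zeta>" if "s \<in> {0..T}" for s \<zeta>
    using that K by (simp add: V_def free_evolution_def norm_mult) (intro order_trans[OF q] mult_left_mono majorant_mono; simp)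
  have Vb: "V s \<in> borel_measurable borel" for s
    using measurable_uncurry[OF Vm measurable_const measurable_ident_sets] by auto
  have cos: "1 / 2 * (r (\<zeta> - p) * r p) \<le> cos (s * (?D \<zeta> - ?D (\<zeta> - p) - ?D p)) * (r (\<zeta> - p) * r p)"
    if \<zeta>: "\<zeta> \<in> R" and s: "s \<in> {0..T}" for \<zeta> p s
  proof (cases "r (\<zeta> - p) * r p = 0")
    case False
    then have nz: "r (\<zeta> - p) \<noteq> 0" "r p \<noteq> 0" by auto
    then have mem: "\<zeta> - p \<in> D1 \<or> \<zeta> - p \<in> D2" "p \<in> D1 \<or> p \<in> D2"
      by (auto simp: r_def indicator_def split: if_splits)
    have "\<not> (\<zeta> - p \<in> D1 \<and> p \<in> D1)" "\<not> (\<zeta> - p \<in> D2 \<and> p \<in> D2)"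
      using \<zeta> d dN unfolding R_def D1_def D2_def mem_cbox_2d by auto
    then have "(\<zeta> - p \<in> D1 \<and> p \<in> D2) \<or> (p \<in> D1 \<and> \<zeta> - p \<in> D2)" using mem by blast
    then have "T * \<bar>?D \<zeta> - ?D (\<zeta> - p) - ?D p\<bar> \<le> 1"
      using res[of "\<zeta> - p" p] res[of p "\<zeta> - p"] by (auto simp: abs_minus_commute algebra_simps)
    moreover have "\<bar>s * (?D \<zeta> - ?D (\<zeta> - p) - ?D p)\<bar> \<le> T * \<bar>?D \<zeta> - ?D (\<zeta> - p) - ?D p\<bar>"
      unfolding abs_mult using s by (intro mult_right_mono) auto
    ultimately have "1 / 2 \<le> cos (s * (?D \<zeta> - ?D (\<zeta> - p) - ?D p))" by (intro cos_ge_half) linarith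
    then show ?thesis by (intro mult_right_mono mult_nonneg_nonneg r0)
  next
    case True
    then show ?thesis by (simp only: mult_zero_right order_refl)
  qed
  have conv: "\<beta> * (d * e) / 2 \<le> Re (cis (s * ?D \<zeta>) * conv (V s) (V s) \<zeta>)"
    if \<zeta>: "\<zeta> \<in> R" and s: "s \<in> {0..T}" for \<zeta> s
  proof -
    let ?f = "\<lambda>p. cis (s * ?D \<zeta>) * (V s (\<zeta> - p) * V s p)"
    have i: "integrable lborel ?f"
      by (intro integrable_mult_right conv_bound(1)[OF Vb Vb bV[OF s] bV[OF s] K K])
    have f: "Re (?f p) = cos (s * (?D \<zeta> - ?D (\<zeta> - p) - ?D p)) * (r (\<zeta> - p) * r p)" for p
    proof -
      have "?f p = cis (s * (?D \<zeta> - ?D (\<zeta> - p) - ?D p)) * of_real (r (\<zeta> - p) * r p)"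
      proof -
        have "cis (s * (?D \<zeta> - ?D (\<zeta> - p) - ?D p)) = cis (s * ?D \<zeta>) * cis (- (s * ?D (\<zeta> - p))) * cis (- (s * ?D p))"
          by (simp add: cis_mult algebra_simps)
        then show ?thesis by (simp only: V_def free_evolution_def q_def of_real_mult mult_ac)
      qed
      then show ?thesis by simp
    qed
    \<comment> \<open>\<open>R\<close> is placed such that subtracting any point of
      \<open>D1\<close> from a point of \<open>R\<close> lands in \<open>D2\<close>; hence all of
      \<open>D1\<close> contributes. The remaining p only contribute nonnegative terms.\<close>
    have le: "\<beta> / 2 * indicat_real D1 p \<le> Re (?f p)" for p
    proof (cases "p \<in> D1")
      case True
      then have "\<zeta> - p \<in> D2" using \<zeta> unfolding R_def D1_def D2_def mem_cbox_2d by auto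
      then have "\<beta> * 1 \<le> r (\<zeta> - p) * r p"
        using True \<beta> by (intro mult_mono) (auto simp: r_def)
      then show ?thesis unfolding f using cos[OF \<zeta> s, of p] True by simp
    next
      case False
      have "0 \<le> 1 / 2 * (r (\<zeta> - p) * r p)" by (intro mult_nonneg_nonneg r0) simp
      then show ?thesis unfolding f using cos[OF \<zeta> s, of p] False by simp
    qed
    have iD: "integrable lborel (indicat_real D1)"
      unfolding D1_def by (rule integrable_indicator_cbox)
    have "\<beta> * (d * e) / 2 = (\<integral>p. \<beta> / 2 * indicat_real D1 p \<partial>lborel)"
      using d e by (simp add: D1_def measure_cbox_2d)
    also have "\<dots> \<le> (\<integral>p. Re (?f p) \<partial>lborel)"
      by (intro integral_mono integrable_mult_right iD integrable_Re i le)
    also have "\<dots> = Re (cis (s * ?D \<zeta>) * conv (V s) (V s) \<zeta>)"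
      unfolding integral_Re[OF i] integral_mult_right_zero conv_def ..
    finally show ?thesis .
  qed
  define J where "J \<zeta> = (LINT s:{0..T}|lborel. cis (s * ?D \<zeta>) * conv (V s) (V s) \<zeta>)" for \<zeta>
  have J: "T * (\<beta> * (d * e) / 2) \<le> Re (J \<zeta>)" if \<zeta>: "\<zeta> \<in> R" for \<zeta>
  proof -
    let ?g = "\<lambda>s. indicat_real {0..T} s *\<^sub>R (cis (s * ?D \<zeta>) * conv (V s) (V s) \<zeta>)"
    have i: "integrable lborel ?g"
      using duhamel_bound(1)[OF Vm Vm K K TT bV bV] unfolding set_integrable_def .
    have iT: "integrable lborel (indicat_real {0..T})"
      by (rule integrable_real_indicator) (auto simp: emeasure_lborel_Icc_eq)
    have "T * (\<beta> * (d * e) / 2) = (\<integral>s. \<beta> * (d * e) / 2 * indicat_real {0..T} s \<partial>lborel)"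
      using T by simp
    also have "\<dots> \<le> (\<integral>s. Re (?g s) \<partial>lborel)"
    proof (intro integral_mono integrable_mult_right iT integrable_Re i)
      show "\<beta> * (d * e) / 2 * indicat_real {0..T} s \<le> Re (?g s)" for s
        using conv[OF \<zeta>, of s] by (cases "s \<in> {0..T}") auto
    qed
    also have "\<dots> = Re (J \<zeta>)" unfolding J_def set_lebesgue_integral_def by (rule integral_Re[OF i])
    finally show ?thesis .
  qed
  define k where "k = 1 / (2 * (2 * pi)\<^sup>2)"
  have k: "0 < k" by (simp add: k_def)
  let ?h = "\<lambda>\<zeta>. indicator R \<zeta> * ((- \<i> * cis (T * ?D \<zeta>)) * (cis (- (T * ?D \<zeta>)) * duhamel \<alpha> V V T \<zeta>))"
  have h: "?h \<zeta> = indicator R \<zeta> * of_real (fst \<zeta> * k) * J \<zeta>" for \<zeta>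
  proof -
    have "cis (T * ?D \<zeta>) * cis (- (T * ?D \<zeta>)) = 1" by (simp add: cis_mult)
    then have "?h \<zeta> = indicator R \<zeta> * (- \<i> * duhamel \<alpha> V V T \<zeta>)" by (simp add: mult.assoc[symmetric])
    also have "- \<i> * duhamel \<alpha> V V T \<zeta> = of_real (fst \<zeta> * k) * J \<zeta>"
      by (simp add: duhamel_def J_def k_def mult.assoc[symmetric])
    finally show ?thesis by simp
  qed
  have hi: "integrable lborel ?h"
  proof (rule integrable_le_majorant[of _ "K * K * conv_const" T T])
    have "(\<lambda>\<zeta>. duhamel \<alpha> V V T \<zeta>) \<in> borel_measurable borel"
      by (intro measurable_uncurry[OF measurable_duhamel[OF Vm Vm]] measurable_ident_sets) auto
    then show "?h \<in> borel_measurable borel"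
      by (intro borel_measurable_times borel_measurable_cis borel_measurable_uminus borel_measurable_const borel_measurable_dispersion borel_measurable_indicator sets)
    show "cmod (?h \<zeta>) \<le> K * K * conv_const * majorant T T \<zeta>" for \<zeta>
    proof -
      have "cmod (?h \<zeta>) \<le> cmod (duhamel \<alpha> V V T \<zeta>)" by (auto simp: norm_mult indicator_def)
      also have "\<dots> \<le> K * K * conv_const * majorant T T \<zeta>" by (rule duhamel_bound(2)[OF Vm Vm K K TT bV bV])
      finally show ?thesis .
    qed
  qed (use K conv_const_nonneg in auto)
  let ?b = "N * k * (T * (\<beta> * (d * e) / 2))"
  have iR: "integrable lborel (indicat_real R)"
    unfolding R_def by (rule integrable_indicator_cbox)
  have le: "?b * indicat_real R \<zeta> \<le> Re (?h \<zeta>)" for \<zeta>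
  proof (cases "\<zeta> \<in> R")
    case True
    then have "N \<le> fst \<zeta>" using d unfolding R_def mem_cbox_2d by auto
    then have "N * k * (T * (\<beta> * (d * e) / 2)) \<le> fst \<zeta> * k * Re (J \<zeta>)"
      using k N T \<beta> d e by (intro mult_mono J[OF True]) auto
    then show ?thesis unfolding h using True by simp
  qed (simp add: h)
  have "N * T * \<beta> * (d * e)\<^sup>2 / (4 * (2 * pi)\<^sup>2) = ?b * (d * e)"
    by (simp add: k_def power2_eq_square)
  also have "\<dots> = (\<integral>\<zeta>. ?b * indicat_real R \<zeta> \<partial>lborel)"
    using d e by (simp add: R_def measure_cbox_2d)
  also have "\<dots> \<le> (\<integral>\<zeta>. Re (?h \<zeta>) \<partial>lborel)"
    by (intro integral_mono integrable_mult_right iR integrable_Re hi le)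
  also have "\<dots> = Re (\<integral>\<zeta>. ?h \<zeta> \<partial>lborel)" by (rule integral_Re[OF hi])
  finally show ?thesis .
qed

text \<open>Dividing by the square root of \<open>w\<close> normalises the high box, so that both
  boxes contribute their area up to constants: 4 \<kappa> d e from \<open>D1\<close>, as the weight
  at the origin is 2, and 2 \<kappa> times the area 4 d e of \<open>D2\<close>.\<close>

lemma box_data_norm:
  fixes N Y d e s1 s2 :: real
  assumes d: "0 < d" "d \<le> 1" and e: "0 < e" "e \<le> 1" and N: "1 \<le> N" and Y: "1 \<le> Y"
  defines "D1 \<equiv> cbox (d, 0) (2 * d, e)" and "D2 \<equiv> cbox (N, Y) (N + 2 * d, Y + 2 * e)"
  defines "w \<equiv> sobolev_weight s1 s2 (N, Y)" and "\<kappa> \<equiv> 4 powr (2 * \<bar>s1\<bar> + 2 * \<bar>s2\<bar>)"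
  defines "q \<equiv> \<lambda>\<zeta>. complex_of_real (indicat_real D1 \<zeta> + 1 / sqrt w * indicat_real D2 \<zeta>)"
  assumes q: "\<And>\<zeta>. cmod (q \<zeta>) \<le> K * majorant T 0 \<zeta>" and K: "0 \<le> K" and T: "0 \<le> T"
  shows "dist_of q \<in> sobolev s1 s2" and "(sobolev_norm s1 s2 (dist_of q))\<^sup>2 \<le> 12 * \<kappa> * (d * e)"
proof -
  have w: "0 < w" unfolding w_def by (rule sobolev_weight_pos)
  have sets [measurable]: "D1 \<in> sets borel" "D2 \<in> sets borel" by (auto simp: D1_def D2_def)
  have qb [measurable]: "q \<in> borel_measurable borel" unfolding q_def by measurable
  have qi: "integrable lborel q" by (rule integrable_le_majorant[OF qb q T K])
  let ?b = "\<lambda>\<zeta>. 4 * \<kappa> * indicat_real D1 \<zeta> + 2 * \<kappa> * indicat_real D2 \<zeta>"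
  have \<kappa>: "0 < \<kappa>" by (simp add: \<kappa>_def)
  have ib: "integrable lborel ?b"
    unfolding D1_def D2_def
    by (intro Bochner_Integration.integrable_add integrable_mult_right integrable_indicator_cbox)
  have le: "sobolev_weight s1 s2 \<zeta> * (cmod (q \<zeta>))\<^sup>2 \<le> ?b \<zeta>" for \<zeta>
  proof -
    let ?w = "sobolev_weight s1 s2 \<zeta>"
    have "(cmod (q \<zeta>))\<^sup>2 = (indicat_real D1 \<zeta> + 1 / sqrt w * indicat_real D2 \<zeta>)\<^sup>2"
      unfolding q_def norm_of_real power2_abs ..
    also have "\<dots> \<le> 2 * (indicat_real D1 \<zeta>)\<^sup>2 + 2 * (1 / sqrt w * indicat_real D2 \<zeta>)\<^sup>2"
      using sum_squares_bound[of "indicat_real D1 \<zeta>" "1 / sqrt w * indicat_real D2 \<zeta>"] by (simp only: power2_sum)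
    also have "\<dots> = 2 * indicat_real D1 \<zeta> + 2 * (indicat_real D2 \<zeta> / w)"
      using w by (auto simp: indicator_def power_divide)
    finally have "?w * (cmod (q \<zeta>))\<^sup>2 \<le> ?w * (2 * indicat_real D1 \<zeta> + 2 * (indicat_real D2 \<zeta> / w))"
      by (intro mult_left_mono sobolev_weight_nonneg)
    also have "\<dots> = 2 * (?w * indicat_real D1 \<zeta>) + 2 * (?w / w * indicat_real D2 \<zeta>)" by (simp add: algebra_simps)
    also have "\<dots> \<le> 2 * (2 * \<kappa> * indicat_real D1 \<zeta>) + 2 * (\<kappa> * indicat_real D2 \<zeta>)"
    proof (intro add_mono mult_left_mono)
      show "?w * indicat_real D1 \<zeta> \<le> 2 * \<kappa> * indicat_real D1 \<zeta>"
      proof (cases "\<zeta> \<in> D1")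
        case True
        then have "?w \<le> \<kappa> * sobolev_weight s1 s2 (0, 0)"
          unfolding \<kappa>_def using d e unfolding D1_def mem_cbox_2d by (intro sobolev_weight_le) auto
        then show ?thesis using True by (simp add: sobolev_weight_def japanese_def)
      qed simp
      show "?w / w * indicat_real D2 \<zeta> \<le> \<kappa> * indicat_real D2 \<zeta>"
      proof (cases "\<zeta> \<in> D2")
        case True
        then have "?w \<le> \<kappa> * w"
          unfolding \<kappa>_def w_def using d e N Y unfolding D2_def mem_cbox_2d by (intro sobolev_weight_le) auto
        then show ?thesis using True w by (simp add: pos_divide_le_eq)
      qed simp
    qed auto
    finally show ?thesis by simp
  qed
  have i: "integrable lborel (\<lambda>\<zeta>. sobolev_weight s1 s2 \<zeta> * (cmod (q \<zeta>))\<^sup>2)"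
  proof (rule Bochner_Integration.integrable_bound[OF ib])
    show "AE \<zeta> in lborel. norm (sobolev_weight s1 s2 \<zeta> * (cmod (q \<zeta>))\<^sup>2) \<le> norm (?b \<zeta>)"
      using le \<kappa> by (intro always_eventually allI) (simp add: sobolev_weight_nonneg abs_mult)
  qed measurable
  note s = sobolevI[OF has_fourier_dist_of[OF qi] i]
  show "dist_of q \<in> sobolev s1 s2" by (rule s(1))
  have "(sobolev_norm s1 s2 (dist_of q))\<^sup>2 \<le> (\<integral>\<zeta>. ?b \<zeta> \<partial>lborel)"
    unfolding s(2) by (intro integral_mono i ib le)
  also have "\<dots> = 4 * \<kappa> * (d * e) + 2 * \<kappa> * (4 * (d * e))"
  proof -
    have "integrable lborel (indicat_real D1)" "integrable lborel (indicat_real D2)"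
      unfolding D1_def D2_def by (rule integrable_indicator_cbox)+
    then show ?thesis using d e by (simp add: D1_def D2_def measure_cbox_2d)
  qed
  finally show "(sobolev_norm s1 s2 (dist_of q))\<^sup>2 \<le> 12 * \<kappa> * (d * e)" by (simp add: algebra_simps)
qed

section \<open>Upper bound against lower bound as the frequency grows\<close>

theorem theorem4p1:
  fixes s1 s2 \<alpha> :: real
  assumes "-1 \<le> \<alpha>" and "\<alpha> < 0"
  shows "\<not> (\<exists>T>0. \<exists>S :: real \<Rightarrow> tdist \<Rightarrow> tdist.
           (\<forall>\<phi>\<in>sobolev s1 s2.
              is_solution \<alpha> s1 s2 T \<phi> (\<lambda>t. S t \<phi>) \<and>
              (\<forall>u. is_solution \<alpha> s1 s2 T \<phi> u \<longrightarrow> (\<forall>t\<in>{0..T}. u t = S t \<phi>))) \<and>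
           (\<forall>t\<in>{0..T}. C2_at (sobolev s1 s2) (sobolev_norm s1 s2) (S t) 0))"
proof
  assume "\<exists>T>0. \<exists>S :: real \<Rightarrow> tdist \<Rightarrow> tdist.
           (\<forall>\<phi>\<in>sobolev s1 s2.
              is_solution \<alpha> s1 s2 T \<phi> (\<lambda>t. S t \<phi>) \<and>
              (\<forall>u. is_solution \<alpha> s1 s2 T \<phi> u \<longrightarrow> (\<forall>t\<in>{0..T}. u t = S t \<phi>))) \<and>
           (\<forall>t\<in>{0..T}. C2_at (sobolev s1 s2) (sobolev_norm s1 s2) (S t) 0)"
  then obtain T S where T: "0 < T"
    and sol: "\<And>\<phi>. \<phi> \<in> sobolev s1 s2 \<Longrightarrow> is_solution \<alpha> s1 s2 T \<phi> (\<lambda>t. S t \<phi>)"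
    and uniq: "\<And>\<phi> u t. \<phi> \<in> sobolev s1 s2 \<Longrightarrow> is_solution \<alpha> s1 s2 T \<phi> u \<Longrightarrow> t \<in> {0..T} \<Longrightarrow> u t = S t \<phi>"
    and C2: "\<And>t. t \<in> {0..T} \<Longrightarrow> C2_at (sobolev s1 s2) (sobolev_norm s1 s2) (S t) 0"
    by blast
  have TT: "T \<in> {0..T}" and T0: "0 \<le> T" using T by auto
  have ST: "S T x \<in> sobolev s1 s2" if "x \<in> sobolev s1 s2" for x
    using sol[OF that] TT unfolding is_solution_def by blast
  obtain K where K: "0 \<le> K" and quad: "\<And>l c \<phi> a b C e. \<lbrakk>\<phi> \<in> sobolev s1 s2; 0 \<le> c;
      \<And>x y. x \<in> sobolev s1 s2 \<Longrightarrow> y \<in> sobolev s1 s2 \<Longrightarrow> l (x + y) = l x + l y;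
      \<And>x r. x \<in> sobolev s1 s2 \<Longrightarrow> l (r *\<^sub>R x) = r * l x;
      \<And>x. x \<in> sobolev s1 s2 \<Longrightarrow> \<bar>l x\<bar> \<le> c * sobolev_norm s1 s2 x; 0 < e;
      \<And>x. \<bar>x\<bar> < e \<Longrightarrow> \<bar>l (S T (x *\<^sub>R \<phi>)) - x * a - x\<^sup>2 * b\<bar> \<le> C * \<bar>x\<bar> ^ 3\<rbrakk>
      \<Longrightarrow> \<bar>2 * b\<bar> \<le> c * K * (sobolev_norm s1 s2 \<phi>)\<^sup>2"
    using C2_at_quadratic_bound[OF C2[OF TT] sobolev_add sobolev_scaleR(1) ST sobolev_norm_nonneg sobolev_scaleR(2)]
    by blast
  define \<sigma> where "\<sigma> = sqrt (3 / - \<alpha>)"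
  \<comment> \<open>The second bound makes T times the phase of \<open>resonance_bound\<close> at
    most 1; the bound 1 / 8 ensures 4 d < N.\<close>
  define c where "c = min (1 / 8) (1 / (T * (133 + 22 * \<sigma>)))"
  have \<sigma>: "1 \<le> \<sigma>" 
  proof -
    have "1 \<le> 3 / - \<alpha>" using assms by (subst pos_le_divide_eq) auto
    then show ?thesis by (simp add: \<sigma>_def)
  qed
  have c: "0 < c" "c \<le> 1 / 8" "T * ((133 + 22 * \<sigma>) * c) \<le> 1"
  proof -
    have p: "0 < T * (133 + 22 * \<sigma>)" using T \<sigma> by (intro mult_pos_pos) auto
    then show "0 < c" "c \<le> 1 / 8" by (simp_all add: c_def)
    have "c \<le> 1 / (T * (133 + 22 * \<sigma>))" by (simp add: c_def)
    then have "c * (T * (133 + 22 * \<sigma>)) \<le> 1" using p by (simp only: pos_le_divide_eq)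
    then show "T * ((133 + 22 * \<sigma>) * c) \<le> 1" by (simp only: mult_ac)
  qed
  define \<kappa> where "\<kappa> = (4::real) powr (2 * \<bar>s1\<bar> + 2 * \<bar>s2\<bar>)"
  have \<kappa>: "0 < \<kappa>" by (simp add: \<kappa>_def)
  \<comment> \<open>What remains of the constants after comparing the two bounds; it is independent
    of n.\<close>
  define M where "M = 24 * K * \<kappa> * sqrt \<kappa> * (2 * pi)\<^sup>2 / T"
  have M: "0 \<le> M" using K \<kappa> T by (simp add: M_def)
  have main: "c * n powr (- \<alpha> / 2) \<le> M" if n: "1 \<le> n" for n
  proof -
    define N where "N = n\<^sup>2"
    define d where "d = c / n"
    define Y where "Y = \<sigma> * n powr (3 - \<alpha>)"
    define e where "e = c * n powr (- (3 + \<alpha>))"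
    have n0: "0 < n" using n by simp
    have N: "1 \<le> N" using n by (simp add: N_def one_le_power)
    have d: "0 < d" "d \<le> 1 / 8" using c n n0 by (auto simp: d_def pos_divide_le_eq intro: order_trans[of _ "1 / 8 * 1"])
    have e: "0 < e" "e \<le> 1"
    proof -
      show "0 < e" using c n0 by (simp add: e_def)
      have "n powr (- (3 + \<alpha>)) \<le> n powr 0" using n assms by (intro powr_mono) auto
      then have "c * n powr (- (3 + \<alpha>)) \<le> 1 * 1" using c n0 by (intro mult_mono) auto
      then show "e \<le> 1" by (simp add: e_def)
    qed
    have Y: "1 \<le> Y"
    proof -
      have "n powr 0 \<le> n powr (3 - \<alpha>)" using n assms by (intro powr_mono) auto
      then have "1 * 1 \<le> \<sigma> * n powr (3 - \<alpha>)" using \<sigma> n0 by (intro mult_mono) auto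
      then show ?thesis by (simp add: Y_def)
    qed
    define D1 where "D1 = cbox (d, 0) (2 * d, e)"
    define D2 where "D2 = cbox (N, Y) (N + 2 * d, Y + 2 * e)"
    define R where "R = cbox (N + 2 * d, Y + e) (N + 3 * d, Y + 2 * e)"
    define w where "w = sobolev_weight s1 s2 (N, Y)"
    have w: "0 < w" unfolding w_def by (rule sobolev_weight_pos)
    define \<beta> where "\<beta> = 1 / sqrt w"
    have \<beta>: "0 < \<beta>" using w by (simp add: \<beta>_def)
    define q where "q = (\<lambda>\<zeta>. complex_of_real (indicat_real D1 \<zeta> + \<beta> * indicat_real D2 \<zeta>))"
    have qb: "q \<in> borel_measurable borel" unfolding q_def D1_def D2_def by measurable
    obtain m where m: "0 < m" "\<And>p. p \<in> D1 \<union> D2 \<Longrightarrow> m \<le> majorant T 0 p"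
    proof (rule majorant_lower_bound[of "D1 \<union> D2" T])
      show "bounded (D1 \<union> D2)" by (simp add: D1_def D2_def)
      show "0 \<le> fst p" if "p \<in> D1 \<union> D2" for p using that d N by (auto simp: D1_def D2_def mem_cbox_2d)
    qed (use T in auto)
    \<comment> \<open>\<open>L\<close> depends on n, but it only influences the range
      \<open>x0\<close> and the remainder constant \<open>C\<close> of the expansion, not the
      quadratic coefficient or its bound.\<close>
    define L where "L = (1 + \<beta>) / m"
    have L: "0 \<le> L" using m \<beta> by (simp add: L_def)
    have qL: "cmod (q \<zeta>) \<le> L * majorant T 0 \<zeta>" for \<zeta>
    proof (cases "\<zeta> \<in> D1 \<union> D2")
      case True
      have "cmod (q \<zeta>) \<le> 1 + \<beta>" unfolding q_def norm_of_real using \<beta> by (auto simp: indicator_def)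
      also have "\<dots> = L * m" using m by (simp add: L_def)
      also have "\<dots> \<le> L * majorant T 0 \<zeta>" by (intro mult_left_mono m L True)
      finally show ?thesis .
    next
      case False
      then show ?thesis using L majorant_nonneg by (simp add: q_def)
    qed
    have supp: "q \<zeta> = 0" if "fst \<zeta> < d" for \<zeta>
      using that d N by (auto simp: q_def D1_def D2_def mem_cbox_2d indicator_def)
    \<comment> \<open>The conjugate of the phase carried by the second iterate at time T, times -
      \<i> to cancel the factor \<i> of the derivative.\<close>
    define k where "k = (\<lambda>\<zeta>. - \<i> * cis (T * dispersion \<alpha> \<zeta>))"
    have kb: "k \<in> borel_measurable borel" unfolding k_def by measurable
    have k1: "cmod (k \<zeta>) \<le> 1" for \<zeta> by (simp add: k_def norm_mult)
    have Rs: "R \<in> sets borel" "emeasure lborel R < \<infinity>" unfolding R_def by (simp, rule emeasure_bounded_finite[OF bounded_cbox])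
    have Rw: "w / \<kappa> \<le> sobolev_weight s1 s2 \<zeta>" if "\<zeta> \<in> R" for \<zeta>
    proof -
      have "w \<le> \<kappa> * sobolev_weight s1 s2 \<zeta>"
        unfolding w_def \<kappa>_def using that d e N Y unfolding R_def mem_cbox_2d by (intro sobolev_weight_le) auto
      then show ?thesis using \<kappa> by (simp add: pos_divide_le_eq mult.commute)
    qed
    have w\<kappa>: "0 < w / \<kappa>" using w \<kappa> by simp
    let ?l = "freq_functional R k"
    let ?V = "free_evolution \<alpha> q"
    define b where "b = Re (\<integral>\<zeta>. indicator R \<zeta> * (k \<zeta> * (cis (- (T * dispersion \<alpha> \<zeta>)) * duhamel \<alpha> ?V ?V T \<zeta>)) \<partial>lborel)"
    have d1: "d \<le> 1" using d by simp
    note data = box_data_norm[OF d(1) d1 e N Y qL[unfolded q_def \<beta>_def w_def D1_def D2_def] L T0,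
        folded D1_def D2_def, folded w_def, folded \<beta>_def, folded q_def \<kappa>_def]
    note q_sob = data(1) and q_norm = data(2)
    have "\<exists>e>0. \<exists>C. \<forall>x. \<bar>x\<bar> < e \<longrightarrow> \<bar>?l (S T (x *\<^sub>R dist_of q))
        - x * Re (\<integral>\<zeta>. indicator R \<zeta> * (k \<zeta> * ?V T \<zeta>) \<partial>lborel) - x\<^sup>2 * b\<bar> \<le> C * \<bar>x\<bar> ^ 3"
      unfolding b_def
    proof (rule flow_expansion[OF T0 TT qb qL L d(1) supp _ kb k1 Rs(1)])
      show "u T = S T \<phi>" if "\<phi> \<in> sobolev s1 s2" "is_solution \<alpha> s1 s2 T \<phi> u" for \<phi> u
        by (rule uniq[OF that TT])
    qed
    then obtain x0 C where x0: "0 < x0" and expansion: "\<And>x. \<bar>x\<bar> < x0 \<Longrightarrow> \<bar>?l (S T (x *\<^sub>R dist_of q))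
        - x * Re (\<integral>\<zeta>. indicator R \<zeta> * (k \<zeta> * ?V T \<zeta>) \<partial>lborel) - x\<^sup>2 * b\<bar> \<le> C * \<bar>x\<bar> ^ 3"
      by blast
    have cnn: "0 \<le> sqrt (measure lborel R / (w / \<kappa>))"
      by (intro real_sqrt_ge_zero divide_nonneg_nonneg measure_nonneg less_imp_le[OF w\<kappa>])
    have "\<bar>2 * b\<bar> \<le> sqrt (measure lborel R / (w / \<kappa>)) * K * (sobolev_norm s1 s2 (dist_of q))\<^sup>2"
      by (rule quad[OF q_sob _ freq_functional_add[OF _ _ Rs w\<kappa> Rw kb k1] freq_functional_scaleR[OF _ Rs(1) kb]
            freq_functional_bound(2)[OF _ Rs w\<kappa> Rw kb k1] x0 expansion]) (rule cnn)
    also have "\<dots> \<le> sqrt (measure lborel R / (w / \<kappa>)) * K * (12 * \<kappa> * (d * e))"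
      by (intro mult_left_mono q_norm mult_nonneg_nonneg K cnn)
    also have "measure lborel R = d * e" using d e by (simp add: R_def measure_cbox_2d)
    also have "sqrt (d * e / (w / \<kappa>)) = \<beta> * sqrt \<kappa> * sqrt (d * e)"
      using w \<kappa> by (simp add: \<beta>_def real_sqrt_mult real_sqrt_divide)
    finally have upper: "2 * b \<le> \<beta> * sqrt \<kappa> * sqrt (d * e) * K * (12 * \<kappa> * (d * e))"
      by (rule order_trans[OF abs_ge_self])
    have "N * T * \<beta> * (d * e)\<^sup>2 / (4 * (2 * pi)\<^sup>2) \<le> b"
      unfolding b_def k_def q_def D1_def D2_def R_def
    proof (rule duhamel_lower_bound[OF T d(1) e(1) _ _ _ _ L])
      show "cmod (complex_of_real (indicat_real (cbox (d, 0) (2 * d, e)) \<zeta> + \<beta> * indicat_real (cbox (N, Y) (N + 2 * d, Y + 2 * e)) \<zeta>)) \<le> L * majorant T 0 \<zeta>" for \<zeta>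
        using qL[of \<zeta>] unfolding q_def D1_def D2_def .
      fix p p' assume p: "p \<in> cbox (d, 0) (2 * d, e)" and p': "p' \<in> cbox (N, Y) (N + 2 * d, Y + 2 * e)"
      have "\<bar>dispersion \<alpha> (fst p + fst p', snd p + snd p') - dispersion \<alpha> (fst p, snd p) - dispersion \<alpha> (fst p', snd p')\<bar> \<le> (133 + 22 * \<sigma>) * c"
        unfolding \<sigma>_def
        by (rule resonance_bound[OF assms c(1) _ n])
           (use p p' c in \<open>auto simp: mem_cbox_2d d_def e_def N_def Y_def \<sigma>_def\<close>)
      then have "T * \<bar>dispersion \<alpha> (p + p') - dispersion \<alpha> p - dispersion \<alpha> p'\<bar> \<le> T * ((133 + 22 * \<sigma>) * c)"
        using T by (intro mult_left_mono) (simp_all add: plus_prod_def)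
      then show "T * \<bar>dispersion \<alpha> (p + p') - dispersion \<alpha> p - dispersion \<alpha> p'\<bar> \<le> 1" using c(3) by linarith
    qed (use N d \<beta> in auto)
    with upper have "2 * (N * T * \<beta> * (d * e)\<^sup>2 / (4 * (2 * pi)\<^sup>2)) \<le> \<beta> * sqrt \<kappa> * sqrt (d * e) * K * (12 * \<kappa> * (d * e))"
      by linarith
    \<comment> \<open>The factor \<beta>, which enters once through the data on the left and once
      through the weight on \<open>R\<close> on the right, is linear on both sides and cancels; of
      s1 and s2 only \<kappa> remains.\<close>
    then have ineq: "N * T * (\<beta> * (d * e)) * (d * e) \<le> 24 * K * \<kappa> * sqrt \<kappa> * (2 * pi)\<^sup>2 * (\<beta> * (d * e)) * sqrt (d * e)"
      by (simp add: field_simps power2_eq_square)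
    have de: "0 < d * e" using d e by simp
    define z where "z = sqrt (d * e)"
    have z: "0 < z" "d * e = z * z" using de by (auto simp: z_def)
    have "N * T * (\<beta> * (z * z)) * (z * z) \<le> 24 * K * \<kappa> * sqrt \<kappa> * (2 * pi)\<^sup>2 * (\<beta> * (z * z)) * z"
      using ineq unfolding z_def[symmetric] unfolding z(2) .
    then have "(\<beta> * z * z * z) * (N * T * z) \<le> (\<beta> * z * z * z) * (24 * K * \<kappa> * sqrt \<kappa> * (2 * pi)\<^sup>2)"
      by (simp only: mult_ac)
    then have "N * T * z \<le> 24 * K * \<kappa> * sqrt \<kappa> * (2 * pi)\<^sup>2"
      by (rule mult_left_le_imp_le) (intro mult_pos_pos \<beta> z)
    then have Nz: "N * z \<le> M" using T by (simp add: M_def pos_le_divide_eq mult_ac)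
    \<comment> \<open>The square root z of the area of a box, times N = n^2, is the growing quantity
      c n^(- \<alpha> / 2).\<close>
    have "d * e = (c * n powr (- (4 + \<alpha>) / 2))\<^sup>2"
    proof -
      have "d * e = c\<^sup>2 * (n powr (- 1) * n powr (- (3 + \<alpha>)))"
        using n0 by (simp add: d_def e_def power2_eq_square powr_minus_divide)
      also have "n powr (- 1) * n powr (- (3 + \<alpha>)) = n powr (- (4 + \<alpha>) / 2 + - (4 + \<alpha>) / 2)"
        unfolding powr_add[symmetric] by (rule arg_cong) (simp add: field_simps)
      also have "\<dots> = (n powr (- (4 + \<alpha>) / 2))\<^sup>2" by (simp only: powr_add power2_eq_square)
      finally show ?thesis by (simp add: power_mult_distrib)
    qed
    then have "z = c * n powr (- (4 + \<alpha>) / 2)" using c by (simp add: z_def)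
    moreover have "N = n powr 2" using n0 by (simp add: N_def)
    ultimately have "N * z = c * (n powr 2 * n powr (- (4 + \<alpha>) / 2))" by simp
    also have "n powr 2 * n powr (- (4 + \<alpha>) / 2) = n powr (- \<alpha> / 2)"
      unfolding powr_add[symmetric] by (rule arg_cong) (simp add: field_simps)
    finally show ?thesis using Nz by simp
  qed
  \<comment> \<open>Solves n^(- \<alpha> / 2) = M / c + 1, so that the left-hand side of
    \<open>main\<close> becomes M + c.\<close>
  define n where "n = (M / c + 1) powr (2 / - \<alpha>)"
  have Mc: "1 \<le> M / c + 1" using M c by simp
  have "(M / c + 1) powr 0 \<le> n" unfolding n_def using Mc assms by (intro powr_mono) (auto simp: zero_le_divide_iff)
  then have "1 \<le> n" using Mc by simp
  from main[OF this] have "c * n powr (- \<alpha> / 2) \<le> M" .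
  moreover have "n powr (- \<alpha> / 2) = M / c + 1"
    unfolding n_def powr_powr using Mc assms by simp
  ultimately show False using c by (simp add: field_simps)
qed

end
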